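(* Let $H=\prod_{i\in I}H_i$ be the product of a family of pseudo-feathered Abelian topological groups. Then the group $PH$ is reflexive.
   Context: Topological groups are assumed Hausdorff. A topological group is pseudo-feathered if it contains a nonempty compact subset of type $G_\delta$. For a topological group $H$, $PH$ ($P$-modification) is the same group with the finer group topology whose base consists of all $G_\delta$-sets of $H$. Products carry the Tychonoff product topology. $\mathbb T=\{z\in\mathbb C:|z|=1\}$ is the circle group. For a topological Abelian group $G$, $G^\wedge$ is the group of continuous characters (continuous homomorphisms $G\to\mathbb T$) with the topology of uniform convergence on compact subsets of $G$. $G$ is reflexive if the evaluation homomorphism $\alpha_G:G\to G^{\wedge\wedge}$, $\alpha_G(x)(\chi)=\chi(x)$, is a topological isomorphism of $G$ onto $G^{\wedge\wedge}=(G^\wedge)^\wedge$. *)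

theory Defs
  imports "HOL-Analysis.Analysis" "HOL-Algebra.Product_Groups"
begin

text \<open>A topological group is a HOL-Algebra group \<open>G\<close> together with an abstract
  topology \<open>T\<close> whose underlying set is \<open>carrier G\<close>; it is Hausdorff by convention.\<close>

definition topological_group :: "('a, 'b) monoid_scheme \<Rightarrow> 'a topology \<Rightarrow> bool"
  where "topological_group G T \<longleftrightarrow>
    group G \<and> topspace T = carrier G \<and>
    continuous_map (prod_topology T T) T (\<lambda>(x, y). x \<otimes>\<^bsub>G\<^esub> y) \<and>
    continuous_map T T (\<lambda>x. inv\<^bsub>G\<^esub> x) \<and>
    Hausdorff_space T"

definition topological_abelian_group :: "('a, 'b) monoid_scheme \<Rightarrow> 'a topology \<Rightarrow> bool"
  where "topological_abelian_group G T \<longleftrightarrow> topological_group G T \<and> comm_group G"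

definition pseudo_feathered :: "('a, 'b) monoid_scheme \<Rightarrow> 'a topology \<Rightarrow> bool"
  where "pseudo_feathered G T \<longleftrightarrow>
    topological_group G T \<and> (\<exists>K. K \<noteq> {} \<and> compactin T K \<and> gdelta_in T K)"

definition P_modification :: "'a topology \<Rightarrow> 'a topology"
  where "P_modification T = topology (arbitrary union_of gdelta_in T)"

lemma openin_P_modification:
  "openin (P_modification T) = arbitrary union_of gdelta_in T"
  unfolding P_modification_def
  by (rule topology_inverse') (rule istopology_base, rule gdelta_in_Int)

lemma topspace_P_modification [simp]: "topspace (P_modification T) = topspace T"
proof (rule subset_antisym)
  have "(arbitrary union_of gdelta_in T) (topspace (P_modification T))"
    by (metis openin_P_modification openin_topspace)
  then show "topspace (P_modification T) \<subseteq> topspace T"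
    unfolding union_of_def using gdelta_in_subset by fastforce
  have "openin (P_modification T) (topspace T)"
    by (simp add: openin_P_modification arbitrary_union_of_inc open_imp_gdelta_in)
  then show "topspace T \<subseteq> topspace (P_modification T)"
    by (rule openin_subset)
qed

definition circle_group :: "complex monoid"
  where "circle_group = \<lparr>carrier = sphere 0 1, monoid.mult = (*), one = 1\<rparr>"

text \<open>Characters are taken to be \<open>undefined\<close> outside \<open>carrier G\<close>, so that two characters
  are equal as HOL functions iff they agree on \<open>G\<close>.\<close>

definition characters :: "('a, 'b) monoid_scheme \<Rightarrow> 'a topology \<Rightarrow> ('a \<Rightarrow> complex) set"
  where "characters G T =
    {\<phi> \<in> extensional (carrier G).
       \<phi> \<in> hom G circle_group \<and> continuous_map T (top_of_set (carrier circle_group)) \<phi>}"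

definition dual_group :: "('a, 'b) monoid_scheme \<Rightarrow> 'a topology \<Rightarrow> ('a \<Rightarrow> complex) monoid"
  where "dual_group G T =
    \<lparr>carrier = characters G T,
     monoid.mult = (\<lambda>\<phi> \<psi>. \<lambda>x\<in>carrier G. \<phi> x \<otimes>\<^bsub>circle_group\<^esub> \<psi> x),
     one = (\<lambda>x\<in>carrier G. \<one>\<^bsub>circle_group\<^esub>)\<rparr>"

text \<open>Uniform convergence on compact sets: the basic neighbourhoods of \<open>\<phi>\<close> are the sets of
  characters uniformly \<open>\<epsilon>\<close>-close to \<open>\<phi>\<close> on a compact \<open>K\<close>.\<close>

definition dual_topology :: "('a, 'b) monoid_scheme \<Rightarrow> 'a topology \<Rightarrow> ('a \<Rightarrow> complex) topology"
  where "dual_topology G T = topology (\<lambda>U. U \<subseteq> characters G T \<and>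
    (\<forall>\<phi>\<in>U. \<exists>K \<epsilon>. compactin T K \<and> \<epsilon> > 0 \<and>
       {\<psi> \<in> characters G T. \<forall>x\<in>K. dist (\<psi> x) (\<phi> x) < \<epsilon>} \<subseteq> U))"

lemma openin_dual_topology:
  "openin (dual_topology G T) U \<longleftrightarrow> U \<subseteq> characters G T \<and>
    (\<forall>\<phi>\<in>U. \<exists>K \<epsilon>. compactin T K \<and> \<epsilon> > 0 \<and>
       {\<psi> \<in> characters G T. \<forall>x\<in>K. dist (\<psi> x) (\<phi> x) < \<epsilon>} \<subseteq> U)"
proof -
  let ?N = "\<lambda>\<phi> K \<epsilon>. {\<psi> \<in> characters G T. \<forall>x\<in>K. dist (\<psi> x) (\<phi> x) < \<epsilon>}"
  let ?O = "\<lambda>U. U \<subseteq> characters G T \<and>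
    (\<forall>\<phi>\<in>U. \<exists>K \<epsilon>. compactin T K \<and> \<epsilon> > 0 \<and> ?N \<phi> K \<epsilon> \<subseteq> U)"
  have "istopology ?O"
    unfolding istopology_def
  proof (intro conjI allI impI)
    fix U V assume U: "?O U" and V: "?O V"
    show "U \<inter> V \<subseteq> characters G T" using U by blast
    show "\<forall>\<phi>\<in>U \<inter> V. \<exists>K \<epsilon>. compactin T K \<and> \<epsilon> > 0 \<and> ?N \<phi> K \<epsilon> \<subseteq> U \<inter> V"
    proof
      fix \<phi> assume "\<phi> \<in> U \<inter> V"
      then have "\<phi> \<in> U" "\<phi> \<in> V" by simp_all
      obtain K \<epsilon> where K: "compactin T K" "\<epsilon> > 0" "?N \<phi> K \<epsilon> \<subseteq> U"
        using U \<open>\<phi> \<in> U\<close> by meson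
      obtain L \<delta> where L: "compactin T L" "\<delta> > 0" "?N \<phi> L \<delta> \<subseteq> V"
        using V \<open>\<phi> \<in> V\<close> by meson
      have "?N \<phi> (K \<union> L) (min \<epsilon> \<delta>) \<subseteq> ?N \<phi> K \<epsilon> \<inter> ?N \<phi> L \<delta>" by simp blast
      then have "?N \<phi> (K \<union> L) (min \<epsilon> \<delta>) \<subseteq> U \<inter> V"
        using Int_mono[OF K(3) L(3)] by (rule subset_trans)
      moreover have "compactin T (K \<union> L)" "min \<epsilon> \<delta> > 0"
        using K L by (simp_all add: compactin_Un)
      ultimately show "\<exists>K \<epsilon>. compactin T K \<and> \<epsilon> > 0 \<and> ?N \<phi> K \<epsilon> \<subseteq> U \<inter> V" by meson
    qed
  next
    fix \<U> assume *: "\<forall>U\<in>\<U>. ?O U"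
    show "\<Union>\<U> \<subseteq> characters G T" using * by blast
    show "\<forall>\<phi>\<in>\<Union>\<U>. \<exists>K \<epsilon>. compactin T K \<and> \<epsilon> > 0 \<and> ?N \<phi> K \<epsilon> \<subseteq> \<Union>\<U>"
    proof
      fix \<phi> assume "\<phi> \<in> \<Union>\<U>"
      then obtain U where "U \<in> \<U>" "\<phi> \<in> U" by blast
      then obtain K \<epsilon> where "compactin T K" "\<epsilon> > 0" and N: "?N \<phi> K \<epsilon> \<subseteq> U"
        using * by meson
      moreover have "?N \<phi> K \<epsilon> \<subseteq> \<Union>\<U>" using N Union_upper[OF \<open>U \<in> \<U>\<close>] by (rule subset_trans)
      ultimately show "\<exists>K \<epsilon>. compactin T K \<and> \<epsilon> > 0 \<and> ?N \<phi> K \<epsilon> \<subseteq> \<Union>\<U>" by meson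
    qed
  qed
  then show ?thesis
    unfolding dual_topology_def by (simp add: topology_inverse')
qed

lemma topspace_dual_topology [simp]: "topspace (dual_topology G T) = characters G T"
proof (rule subset_antisym)
  show "topspace (dual_topology G T) \<subseteq> characters G T"
    using openin_topspace openin_dual_topology by blast
  have "openin (dual_topology G T) (characters G T)"
    unfolding openin_dual_topology
    by (intro conjI ballI exI[of _ "{}"] exI[of _ 1]) auto
  then show "characters G T \<subseteq> topspace (dual_topology G T)"
    by (rule openin_subset)
qed

abbreviation bidual_group :: "('a, 'b) monoid_scheme \<Rightarrow> 'a topology \<Rightarrow> (('a \<Rightarrow> complex) \<Rightarrow> complex) monoid"
  where "bidual_group G T \<equiv> dual_group (dual_group G T) (dual_topology G T)"

abbreviation bidual_topology :: "('a, 'b) monoid_scheme \<Rightarrow> 'a topology \<Rightarrow> (('a \<Rightarrow> complex) \<Rightarrow> complex) topology"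
  where "bidual_topology G T \<equiv> dual_topology (dual_group G T) (dual_topology G T)"

definition evaluation :: "('a, 'b) monoid_scheme \<Rightarrow> 'a topology \<Rightarrow> 'a \<Rightarrow> ('a \<Rightarrow> complex) \<Rightarrow> complex"
  where "evaluation G T x = (\<lambda>\<phi>\<in>carrier (dual_group G T). \<phi> x)"

definition reflexive_group :: "('a, 'b) monoid_scheme \<Rightarrow> 'a topology \<Rightarrow> bool"
  where "reflexive_group G T \<longleftrightarrow>
    topological_abelian_group G T \<and>
    evaluation G T \<in> iso G (bidual_group G T) \<and>
    homeomorphic_map T (bidual_topology G T) (evaluation G T)"

end

(*
  In a Hausdorff P-group compact sets are finite, so the dual of PH carries the topology of
  pointwise convergence.  PH has a base of open subgroups, namely the boxes with countably many
  nontrivial factors, each of which is a compact G_delta subgroup.  The continuous characters of PH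
  are the homomorphisms to the circle that are trivial on some box N, and those trivial on N form a
  compact group.  On this compact group a continuous character is, by Stone-Weierstrass and averaging, the evaluation at a point
  x_N; since families of cosets of boxes with the finite intersection property have nonempty
  intersection, one point x serves for all N.  This gives surjectivity of the evaluation map, and
  its openness follows from the compactness of the annihilators.  For its continuity one has to show
  that a compact set of characters is contained in the annihilator of one box; this is a recursion
  of length omega_1 which again uses the intersection property of cosets.
*)

theory Submission
  imports Defs
begin

section \<open>Preliminaries\<close>

text \<open>Continuity of evaluation amounts to compact sets of characters being trivial on a common
  box. A character that is nontrivial on a box is trivial on a smaller one, and countable
  intersections of boxes are boxes, so a shrinking chain of boxes survives every countable stage;
  only a cluster point along omega_1 gives a contradiction. The obstacle is that this cluster point
  is trivial on a box that need not contain any box of the chain. The axiom \<open>absorbing\<close>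
  of \<open>complete_P_group\<close> repairs this: if every countable subfamily of a family of boxes
  has a lower bound in the family, some member lies in the product of a prescribed box with the
  intersection of the family. It holds because a box restricts only countably many coordinates, and
  in each of them countably many members suffice, by compactness of the factor subgroups. No
  invariant integral enters the duality on annihilators: averaging over the powers of a single
  element already shows that a character keeps uniform distance at least 1 from the linear
  combinations of finitely many other characters.\<close>

instance "fun" :: (type, t0_space) t0_space
proof
  fix f g :: "'a \<Rightarrow> 'b"
  assume "f \<noteq> g"
  then obtain x where "f x \<noteq> g x" by blast
  then obtain U where U: "open U" "(f x \<in> U) \<noteq> (g x \<in> U)"
    using t0_space_class.t0_space[OF \<open>f x \<noteq> g x\<close>] by blast
  have "continuous_on UNIV (\<lambda>h::'a \<Rightarrow> 'b. h x)" by simp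
  then have "open ((\<lambda>h. h x) -` U)" using U open_vimage by blast
  then show "\<exists>U. open U \<and> (f \<in> U) \<noteq> (g \<in> U)"
    using U by (intro exI[of _ "(\<lambda>h. h x) -` U"]) auto
qed

instance "fun" :: (type, t1_space) t1_space
proof
  fix f g :: "'a \<Rightarrow> 'b"
  assume "f \<noteq> g"
  then obtain x where "f x \<noteq> g x" by blast
  then obtain U where U: "open U" "f x \<in> U" "g x \<notin> U"
    using t1_space_class.t1_space[OF \<open>f x \<noteq> g x\<close>] by blast
  have "continuous_on UNIV (\<lambda>h::'a \<Rightarrow> 'b. h x)" by simp
  then have "open ((\<lambda>h. h x) -` U)" using U open_vimage by blast
  then show "\<exists>U. open U \<and> f \<in> U \<and> g \<notin> U"
    using U by (intro exI[of _ "(\<lambda>h. h x) -` U"]) auto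
qed

text \<open>Characters live in a function type with the topology of pointwise convergence.
  Stone-Weierstrass is applied to compact subsets of this type and asks for the Hausdorff
  property.\<close>

instance "fun" :: (type, t2_space) t2_space
proof
  fix f g :: "'a \<Rightarrow> 'b"
  assume "f \<noteq> g"
  then obtain x where "f x \<noteq> g x" by blast
  then obtain U V where UV: "open U" "open V" "f x \<in> U" "g x \<in> V" "U \<inter> V = {}"
    using hausdorff[OF \<open>f x \<noteq> g x\<close>] by blast
  have "continuous_on UNIV (\<lambda>h::'a \<Rightarrow> 'b. h x)" by simp
  then have "open ((\<lambda>h. h x) -` U)" "open ((\<lambda>h. h x) -` V)"
    using UV open_vimage by blast+
  then show "\<exists>U V. open U \<and> open V \<and> f \<in> U \<and> g \<in> V \<and> U \<inter> V = {}"
    using UV by (intro exI[of _ "(\<lambda>h. h x) -` U"] exI[of _ "(\<lambda>h. h x) -` V"]) auto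
qed

text \<open>Squaring expands: |w^2 - 1| = |w + 1| |w - 1|, and |w + 1| is at least 3/2 as long as |w
  - 1| < 1. Hence the squares cannot all stay near 1. This is the absence of small subgroups in the
  circle, used wherever closeness to 1 has to become equality.\<close>

lemma exists_power_far_from_one:
  fixes z :: complex
  assumes "cmod z = 1" "z \<noteq> 1"
  shows "\<exists>k::nat. 1 \<le> dist (z ^ k) 1"
proof (rule ccontr)
  assume "\<not> ?thesis"
  then have near: "cmod (z ^ k - 1) < 1" for k :: nat
    by (auto simp: dist_norm not_le)
  have grow: "(3/2) ^ k * cmod (z - 1) \<le> cmod (z ^ (2 ^ k) - 1)" for k :: nat
  proof (induction k)
    case (Suc k)
    define w where "w = z ^ (2 ^ k)"
    have w: "cmod w = 1" by (simp add: w_def norm_power assms)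
    have wn: "cmod (w - 1) < 1" unfolding w_def by (rule near)
    \<comment> \<open>The parallelogram law leaves |w + 1|^2 > 3 > 9/4, which is the origin of the
      factor 3/2.\<close>
    have "(cmod (w - 1))\<^sup>2 + (cmod (w + 1))\<^sup>2 = 2 * (cmod w)\<^sup>2 + 2"
      unfolding cmod_power2 by (simp add: power2_eq_square algebra_simps)
    moreover have "(cmod (w - 1))\<^sup>2 < 1" using wn by (simp add: power_less_one_iff abs_square_less_1)
    ultimately have "(3/2)\<^sup>2 \<le> (cmod (w + 1))\<^sup>2" using w by (simp add: power2_eq_square)
    then have far: "3/2 \<le> cmod (w + 1)" using power2_le_imp_le norm_ge_zero by blast
    have "(3/2) ^ Suc k * cmod (z - 1) = (3/2) * ((3/2) ^ k * cmod (z - 1))" by simp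
    also have "\<dots> \<le> cmod (w + 1) * cmod (w - 1)"
      using Suc far by (intro mult_mono) (auto simp: w_def)
    also have "\<dots> = cmod ((w + 1) * (w - 1))" by (simp add: norm_mult)
    also have "(w + 1) * (w - 1) = z ^ (2 ^ Suc k) - 1"
    proof -
      have "z ^ (2 ^ Suc k) = w * w"
        unfolding w_def by (simp only: power_Suc mult_2 power_add)
      then show ?thesis by (simp add: algebra_simps)
    qed
    finally show ?case .
  qed auto
  have "cmod (z - 1) > 0" using assms by simp
  then obtain k where "1 < (3/2) ^ k * cmod (z - 1)"
    using real_arch_pow[of "3/2" "1 / cmod (z - 1)"] by (auto simp: field_simps)
  then show False using grow[of k] near[of "2 ^ k"] by linarith
qed

text \<open>The order is cut from a well-order of the reals: \<open>\<Omega>\<close> is the least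
  uncountable proper initial segment, or the whole line if all proper segments are
  countable.\<close>

lemma exists_omega_1_order:
  obtains r :: "real rel" and \<Omega> where "wf r" "trans r" "total_on \<Omega> r" "r \<subseteq> \<Omega> \<times> \<Omega>" "\<Omega> \<noteq> {}"
    "\<And>a. countable {b. (b, a) \<in> r}"
    "\<And>E. countable E \<Longrightarrow> E \<subseteq> \<Omega> \<Longrightarrow> \<exists>c\<in>\<Omega>. \<forall>b\<in>E. (b, c) \<in> r"
proof -
  obtain w :: "real rel" where w: "well_order w" using well_order_on by blast
  define s where "s = w - Id"
  have wfs: "wf s" using w by (simp add: s_def well_order_on_def)
  have trs: "trans s"
    using w unfolding s_def
    by (simp add: trans_diff_Id order_on_defs)
  have tots: "a = b \<or> (a, b) \<in> s \<or> (b, a) \<in> s" for a b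
    using w unfolding s_def by (auto simp: order_on_defs total_on_def)
  obtain \<Omega> where \<Omega>: "uncountable \<Omega>" "\<And>a. a \<in> \<Omega> \<Longrightarrow> countable {b. (b, a) \<in> s}"
    "\<And>a b. a \<in> \<Omega> \<Longrightarrow> (b, a) \<in> s \<Longrightarrow> b \<in> \<Omega>"
  proof (cases "\<exists>a. uncountable {b. (b, a) \<in> s}")
    case True
    then obtain d where "d \<in> {a. uncountable {b. (b, a) \<in> s}}" by blast
    from wfE_min[OF wfs this] obtain a where a: "uncountable {b. (b, a) \<in> s}"
      and min: "\<And>b. (b, a) \<in> s \<Longrightarrow> countable {c. (c, b) \<in> s}"
      by (metis mem_Collect_eq)
    show ?thesis
      by (rule that[of "{b. (b, a) \<in> s}"]) (use a min transD[OF trs] in auto)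
  next
    case False
    show ?thesis
      by (rule that[of UNIV]) (use False uncountable_UNIV_real in auto)
  qed
  have bdd: "\<exists>c\<in>\<Omega>. \<forall>b\<in>E. (b, c) \<in> s" if E: "countable E" "E \<subseteq> \<Omega>" for E
  proof -
    \<comment> \<open>Countably many countable segments cannot cover the uncountable
      \<open>\<Omega>\<close>; a point that they miss lies strictly above all of
      \<open>E\<close>.\<close>
    have "countable (\<Union>b\<in>E. insert b {c. (c, b) \<in> s})"
      using E \<Omega>(2) by (intro countable_UN) auto
    then have "\<not> \<Omega> \<subseteq> (\<Union>b\<in>E. insert b {c. (c, b) \<in> s})"
      using \<Omega>(1) countable_subset[of \<Omega>] by iprover
    then obtain c where "c \<in> \<Omega>" "c \<notin> (\<Union>b\<in>E. insert b {c. (c, b) \<in> s})"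
      by (meson subsetI)
    then show ?thesis using tots by (intro bexI[of _ c]) auto
  qed
  show ?thesis
  proof (rule that[of "s \<inter> \<Omega> \<times> \<Omega>" \<Omega>])
    show "wf (s \<inter> \<Omega> \<times> \<Omega>)" using wfs by (rule wf_subset) auto
    show "trans (s \<inter> \<Omega> \<times> \<Omega>)" using trs by (auto simp: trans_def)
    show "total_on \<Omega> (s \<inter> \<Omega> \<times> \<Omega>)" using tots by (auto simp: total_on_def)
    show "\<Omega> \<noteq> {}" using \<Omega>(1) by auto
    show "countable {b. (b, a) \<in> s \<inter> \<Omega> \<times> \<Omega>}" for a
      by (cases "a \<in> \<Omega>") (auto intro: countable_subset[OF _ \<Omega>(2)])
    show "\<exists>c\<in>\<Omega>. \<forall>b\<in>E. (b, c) \<in> s \<inter> \<Omega> \<times> \<Omega>" if "countable E" "E \<subseteq> \<Omega>" for E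
      using bdd[OF that] that(2) by blast
  qed auto
qed

lemma comm_group_circle_group: "comm_group circle_group"
proof (rule comm_groupI)
  show "\<exists>y\<in>carrier circle_group. y \<otimes>\<^bsub>circle_group\<^esub> x = \<one>\<^bsub>circle_group\<^esub>"
    if "x \<in> carrier circle_group" for x
  proof -
    have "x \<noteq> 0" "cmod x = 1" using that by (auto simp: circle_group_def)
    then show ?thesis
      by (intro bexI[of _ "inverse x"]) (simp_all add: circle_group_def norm_inverse)
  qed
qed (auto simp: circle_group_def norm_mult)

section \<open>Characters of discrete Abelian groups\<close>

lemma circle_group_simps [simp]:
  "z \<in> carrier circle_group \<longleftrightarrow> cmod z = 1"
  "z \<otimes>\<^bsub>circle_group\<^esub> w = z * w" "\<one>\<^bsub>circle_group\<^esub> = 1"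
  by (auto simp: circle_group_def)

lemma circle_group_nat_pow [simp]: "z [^]\<^bsub>circle_group\<^esub> (n::nat) = z ^ n"
  by (induction n) (auto simp: nat_pow_def circle_group_def)

text \<open>Divisibility of the circle, sharpened by \<open>w \<noteq> 1\<close> so that an extended
  character can be made nontrivial at the new point.\<close>

lemma exists_root_on_circle:
  assumes "cmod c = 1" "2 \<le> k"
  shows "\<exists>w. cmod w = 1 \<and> w ^ k = c \<and> w \<noteq> 1"
proof (cases "c = 1")
  case True
  have "real k * (2 * pi / k) = 2 * pi" using assms(2) by simp
  then have "cis (2 * pi / k) ^ k = 1" by (metis Complex.DeMoivre cis_2pi)
  moreover have "cis (2 * pi / k) \<noteq> 1"
  proof
    assume *: "cis (2 * pi / k) = 1"
    \<comment> \<open>\<open>2 \<le> k\<close> puts the angle into (0, pi], where the cosine is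
      strictly below its value at 0.\<close>
    have "cos (2 * pi / k) < 1"
    proof -
      have "cos (2 * pi / k) < cos 0"
        using assms by (intro cos_monotone_0_pi) (auto simp: field_simps)
      then show ?thesis by simp
    qed
    with * show False by (metis cis.simps(1) one_complex.simps(1) less_irrefl)
  qed
  ultimately show ?thesis using True by (intro exI[of _ "cis (2 * pi / k)"]) simp
next
  case False
  have "c = cis (Arg c)"
    using rcis_cmod_Arg[of c] assms(1) by (simp add: rcis_def)
  then obtain t where t: "c = cis t" by blast
  have "real k * (t / k) = t" using assms(2) by simp
  then have "cis (t / k) ^ k = c" unfolding t by (metis Complex.DeMoivre)
  then show ?thesis using False by (intro exI[of _ "cis (t / k)"]) auto
qed

lemma int_pow_DirProd:
  assumes "group G" "group H" "x \<in> carrier G" "y \<in> carrier H"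
  shows "(x, y) [^]\<^bsub>G \<times>\<times> H\<^esub> (m::int) = (x [^]\<^bsub>G\<^esub> m, y [^]\<^bsub>H\<^esub> m)"
proof -
  interpret G: group G by fact
  interpret H: group H by fact
  have nat: "(x, y) [^]\<^bsub>G \<times>\<times> H\<^esub> (n::nat) = (x [^]\<^bsub>G\<^esub> n, y [^]\<^bsub>H\<^esub> n)" for n
    by (induction n) (simp_all add: nat_pow_def DirProd_def)
  show ?thesis
    unfolding int_pow_def2 by (simp add: nat assms)
qed

text \<open>A subgroup of the product that meets the fibre over \<open>\<one>\<close> only in 1 is
  the graph of a homomorphism from a subgroup of \<open>G\<close> to the circle. For graphs,
  extension is inclusion and the supremum of a chain is its union.\<close>

definition partial_character :: "('a, 'b) monoid_scheme \<Rightarrow> ('a \<times> complex) set \<Rightarrow> bool"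
  where "partial_character G R \<longleftrightarrow>
    subgroup R (G \<times>\<times> circle_group) \<and> (\<forall>z. (\<one>\<^bsub>G\<^esub>, z) \<in> R \<longrightarrow> z = 1)"

context comm_group
begin

interpretation C: comm_group circle_group by (rule comm_group_circle_group)

interpretation D: comm_group "G \<times>\<times> circle_group"
  by (intro comm_groupI) (auto simp: m_ac norm_mult DirProd_def intro!: l_inv_ex C.l_inv_ex[simplified])

lemma partial_character_unique:
  assumes "partial_character G R" "(x, z) \<in> R" "(x, w) \<in> R"
  shows "z = w"
proof -
  have R: "subgroup R (G \<times>\<times> circle_group)" and one: "\<And>z. (\<one>, z) \<in> R \<Longrightarrow> z = 1"
    using assms by (auto simp: partial_character_def)
  have mem: "x \<in> carrier G" "cmod z = 1" "cmod w = 1"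
    using subgroup.subset[OF R] assms by auto
  have "inv\<^bsub>circle_group\<^esub> w = inverse w"
    using mem by (intro C.inv_equality) (auto simp: norm_inverse intro!: left_inverse)
  then have "(inv x, inverse w) \<in> R"
    using subgroup.m_inv_closed[OF R assms(3)] mem
    by (simp add: inv_DirProd[OF is_group C.is_group])
  from subgroup.m_closed[OF R assms(2) this] have "(\<one>, z * inverse w) \<in> R"
    using mem by simp
  then have "z * inverse w = 1" by (rule one)
  then show ?thesis using mem by (simp add: field_simps flip: divide_inverse)
qed

text \<open>\<open>compat\<close> makes \<open>w\<close> agree with the values already assigned to
  powers of \<open>g\<close>; this keeps the product of \<open>R\<close> with the cyclic group
  generated by \<open>(g, w)\<close> single-valued.\<close>

lemma partial_character_extend_step:
  assumes R: "partial_character G R" and g: "g \<in> carrier G" and w: "cmod w = 1"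
    and compat: "\<And>m::int. g [^] m \<in> Domain R \<Longrightarrow> (g [^] m, w [^]\<^bsub>circle_group\<^esub> m) \<in> R"
  shows "\<exists>R'. partial_character G R' \<and> R \<subseteq> R' \<and> (g, w) \<in> R'"
proof -
  have sR: "subgroup R (G \<times>\<times> circle_group)" and one: "\<And>z. (\<one>, z) \<in> R \<Longrightarrow> z = 1"
    using R by (auto simp: partial_character_def)
  have gw: "(g, w) \<in> carrier (G \<times>\<times> circle_group)" using g w by simp
  let ?P = "generate (G \<times>\<times> circle_group) {(g, w)}"
  let ?R' = "R <#>\<^bsub>G \<times>\<times> circle_group\<^esub> ?P"
  have sP: "subgroup ?P (G \<times>\<times> circle_group)" using gw by (intro D.generate_is_subgroup) auto
  have P: "?P = {(g [^] m, w [^]\<^bsub>circle_group\<^esub> m) | m::int. True}"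
    using D.generate_pow[OF gw] int_pow_DirProd[OF is_group C.is_group g, of w] w by auto
  have "z = 1" if z: "(\<one>, z) \<in> ?R'" for z
  proof -
    obtain x c m where m: "(x, c) \<in> R" "\<one> = x \<otimes> g [^] (m::int)" "z = c * w [^]\<^bsub>circle_group\<^esub> m"
      using z unfolding set_mult_def P by auto
    have x: "x \<in> carrier G" "cmod c = 1" using subgroup.subset[OF sR] m(1) by auto
    have wm: "cmod (w [^]\<^bsub>circle_group\<^esub> m) = 1" using C.int_pow_closed[of w m] w by simp
    have "inv x = g [^] m" using m(2) x g by (metis inv_equality inv_inv inv_closed int_pow_closed)
    moreover have "inv\<^bsub>G \<times>\<times> circle_group\<^esub> (x, c) \<in> R" by (rule subgroup.m_inv_closed[OF sR m(1)])
    ultimately have "(g [^] m, inv\<^bsub>circle_group\<^esub> c) \<in> R"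
      using x by (simp add: inv_DirProd[OF is_group C.is_group])
    then have "(g [^] m, w [^]\<^bsub>circle_group\<^esub> m) \<in> R" by (intro compat) auto
    from subgroup.m_closed[OF sR m(1) this] show "z = 1"
      using m(2,3) one by simp
  qed
  moreover have "subgroup ?R' (G \<times>\<times> circle_group)" by (rule D.mult_subgroups[OF sR sP])
  moreover have "R \<subseteq> ?R'"
  proof
    fix p assume p: "p \<in> R"
    then have "p = p \<otimes>\<^bsub>G \<times>\<times> circle_group\<^esub> \<one>\<^bsub>G \<times>\<times> circle_group\<^esub>"
      using subgroup.subset[OF sR] by (intro D.r_one[symmetric]) auto
    with p subgroup.one_closed[OF sP] show "p \<in> ?R'" unfolding set_mult_def by blast
  qed
  moreover have "(g, w) \<in> ?R'"
  proof -
    have "(g, w) = \<one>\<^bsub>G \<times>\<times> circle_group\<^esub> \<otimes>\<^bsub>G \<times>\<times> circle_group\<^esub> (g, w)"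
      using g w by simp
    moreover have "(g, w) \<in> ?P" by (rule generate.incl) simp
    ultimately show ?thesis
      using subgroup.one_closed[OF sR] unfolding set_mult_def by blast
  qed
  ultimately show ?thesis unfolding partial_character_def by blast
qed

lemma partial_character_extend:
  assumes R: "partial_character G R" and g: "g \<in> carrier G" "g \<notin> Domain R"
  shows "\<exists>R' w. partial_character G R' \<and> R \<subseteq> R' \<and> (g, w) \<in> R' \<and> w \<noteq> 1"
proof -
  have sR: "subgroup R (G \<times>\<times> circle_group)" using R by (auto simp: partial_character_def)
  have one: "(\<one>, 1) \<in> R" using subgroup.one_closed[OF sR] by simp
  have mult: "(x \<otimes> y, c * d) \<in> R" if "(x, c) \<in> R" "(y, d) \<in> R" for x y c d
    using subgroup.m_closed[OF sR that] by simp
  have pow: "(x [^] m, c [^]\<^bsub>circle_group\<^esub> m) \<in> R" if "(x, c) \<in> R" for x c and m :: int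
  proof -
    have "x \<in> carrier G" "cmod c = 1" using subgroup.subset[OF sR] that by auto
    then show ?thesis
      using D.subgroup_int_pow_closed[OF sR that, of m] int_pow_DirProd[OF is_group C.is_group, of x c m]
      by simp
  qed
  have neg: "g [^] nat \<bar>m\<bar> \<in> Domain R" if m: "g [^] (m::int) \<in> Domain R" for m
  proof -
    obtain c where c: "(g [^] m, c) \<in> R" using m by blast
    show ?thesis
    proof (cases "m \<ge> 0")
      case True
      then show ?thesis using m by (simp flip: int_pow_int)
    next
      case False
      then show ?thesis using pow[OF c, of "-1"] g
        by (auto simp: int_pow_neg inv_inv simp flip: int_pow_int intro: DomainI)
    qed
  qed
  obtain w where w: "cmod w = 1" "w \<noteq> 1"
    and compat: "\<And>m::int. g [^] m \<in> Domain R \<Longrightarrow> (g [^] m, w [^]\<^bsub>circle_group\<^esub> m) \<in> R"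
  proof (cases "\<exists>n::nat. n > 0 \<and> g [^] n \<in> Domain R")
    \<comment> \<open>Only the zeroth power of \<open>g\<close> has a value yet, so the value at
      \<open>g\<close> is free; -1 is chosen as a point other than 1.\<close>
    case False
    have "m = 0" if "g [^] (m::int) \<in> Domain R" for m
      using neg[OF that] False by (metis zero_less_nat_eq zero_less_abs_iff)
    with one have "(g [^] m, (-1) [^]\<^bsub>circle_group\<^esub> m) \<in> R" if "g [^] (m::int) \<in> Domain R" for m
      using that by fastforce
    then show ?thesis by (intro that[of "-1"]) auto
  next
    case True
    \<comment> \<open>The exponents with a power of \<open>g\<close> in the domain are the multiples
      of \<open>k\<close>, and \<open>k\<close> is at least 2 because \<open>g\<close> itself is
      outside. So \<open>w\<close> may be any \<open>k\<close>-th root of the value at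
      \<open>g [^] k\<close>, in particular one other than 1.\<close>
    define k where "k = (LEAST n::nat. n > 0 \<and> g [^] n \<in> Domain R)"
    have "k > 0 \<and> g [^] k \<in> Domain R" unfolding k_def by (rule LeastI_ex[OF True])
    then have k: "k > 0" "g [^] k \<in> Domain R" by simp_all
    have least: "\<And>n. n > 0 \<Longrightarrow> n < k \<Longrightarrow> g [^] n \<notin> Domain R"
      unfolding k_def using not_less_Least by blast
    have "k \<noteq> 1" using k(2) g by auto
    then have "2 \<le> k" using k(1) by linarith
    obtain c where c: "(g [^] k, c) \<in> R" using k(2) by blast
    then have "cmod c = 1" using subgroup.subset[OF sR] by auto
    then obtain w where w: "cmod w = 1" "w ^ k = c" "w \<noteq> 1"
      using exists_root_on_circle \<open>2 \<le> k\<close> by blast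
    show ?thesis
    proof (rule that[OF w(1,3)])
      fix m :: int
      assume m: "g [^] m \<in> Domain R"
      define q r where "q = m div int k" and "r = m mod int k"
      have mqr: "m = int k * q + r" by (simp add: q_def r_def)
      have r: "0 \<le> r" "r < int k" using k(1) by (simp_all add: r_def)
      have gk: "(g [^] (int k * q), w [^]\<^bsub>circle_group\<^esub> (int k * q)) \<in> R" for q
        using pow[OF c, of q] g w C.int_pow_pow[of w "int k" q] int_pow_pow[of g "int k" q]
        by (simp add: int_pow_int)
      have "g [^] r = g [^] m \<otimes> g [^] (int k * (- q))"
        using g by (simp add: mqr flip: int_pow_mult)
      moreover obtain d where "(g [^] m, d) \<in> R" using m by blast
      ultimately have "g [^] r \<in> Domain R" using mult gk by (metis DomainI)
      then have "r = 0"
        using neg[of r] least[of "nat r"] r by (metis abs_of_nonneg nat_less_iff order_le_less zero_less_nat_eq)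
      then show "(g [^] m, w [^]\<^bsub>circle_group\<^esub> m) \<in> R" using gk[of q] mqr by simp
    qed
  qed
  from partial_character_extend_step[OF R g(1) w(1) compat] w(2) show ?thesis by blast
qed

text \<open>The trivial character of \<open>N\<close> is first extended to \<open>x\<close> with a
  value other than 1; Zorn's lemma then keeps this value while enlarging the domain to all of
  \<open>G\<close>. No topology is involved: triviality on a member of \<open>\<N>\<close> will
  supply continuity.\<close>

theorem exists_separating_character:
  assumes N: "subgroup N G" and x: "x \<in> carrier G" "x \<notin> N"
  shows "\<exists>\<phi> \<in> hom G circle_group. (\<forall>n\<in>N. \<phi> n = 1) \<and> \<phi> x \<noteq> 1"
proof -
  have R0: "partial_character G (N \<times> {1})"
    unfolding partial_character_def
    using DirProd_subgroups[OF is_group N C.is_group, of "{1}"] C.triv_subgroup by simp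
  have "x \<notin> Domain (N \<times> {1::complex})" using x(2) by auto
  from partial_character_extend[OF R0 x(1) this] obtain R1 w where
    R1: "partial_character G R1" "N \<times> {1} \<subseteq> R1" "(x, w) \<in> R1" "w \<noteq> 1" by blast
  let ?A = "{R. partial_character G R \<and> R1 \<subseteq> R}"
  have "\<exists>M\<in>?A. \<forall>X\<in>?A. M \<subseteq> X \<longrightarrow> X = M"
  proof (rule subset_Zorn_nonempty)
    show "?A \<noteq> {}" using R1 by blast
    fix \<C> assume ne: "\<C> \<noteq> {}" and "subset.chain ?A \<C>"
    then have \<C>: "\<And>R. R \<in> \<C> \<Longrightarrow> partial_character G R \<and> R1 \<subseteq> R"
      and chain: "\<And>R S. R \<in> \<C> \<Longrightarrow> S \<in> \<C> \<Longrightarrow> R \<subseteq> S \<or> S \<subseteq> R"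
      unfolding subset.chain_def subset_chain_def by blast+
    have sub: "subgroup R (G \<times>\<times> circle_group)" if "R \<in> \<C>" for R
      using \<C>[OF that] by (simp add: partial_character_def)
    have "subgroup (\<Union>\<C>) (G \<times>\<times> circle_group)"
    proof (rule subgroup.intro)
      show "\<Union>\<C> \<subseteq> carrier (G \<times>\<times> circle_group)" using subgroup.subset[OF sub] by blast
      show "\<one>\<^bsub>G \<times>\<times> circle_group\<^esub> \<in> \<Union>\<C>" using ne subgroup.one_closed[OF sub] by blast
      show "inv\<^bsub>G \<times>\<times> circle_group\<^esub> p \<in> \<Union>\<C>" if "p \<in> \<Union>\<C>" for p
        using that subgroup.m_inv_closed[OF sub] by blast
      show "p \<otimes>\<^bsub>G \<times>\<times> circle_group\<^esub> q \<in> \<Union>\<C>" if pq: "p \<in> \<Union>\<C>" "q \<in> \<Union>\<C>" for p q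
      proof -
        obtain R where "R \<in> \<C>" "p \<in> R" "q \<in> R" using pq chain by blast
        then show ?thesis using subgroup.m_closed[OF sub] by blast
      qed
    qed
    moreover have "z = 1" if "(\<one>, z) \<in> \<Union>\<C>" for z
      using that \<C> by (auto simp: partial_character_def)
    moreover have "R1 \<subseteq> \<Union>\<C>" using ne \<C> by blast
    ultimately show "\<Union>\<C> \<in> ?A" by (simp add: partial_character_def)
  qed
  then obtain M where M: "partial_character G M" "R1 \<subseteq> M"
    and max: "\<And>X. partial_character G X \<Longrightarrow> M \<subseteq> X \<Longrightarrow> X = M"
    by (metis (mono_tags, lifting) mem_Collect_eq subset_trans)
  have sM: "subgroup M (G \<times>\<times> circle_group)" using M by (simp add: partial_character_def)
  have dom: "g \<in> Domain M" if g: "g \<in> carrier G" for g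
  proof (rule ccontr)
    assume *: "g \<notin> Domain M"
    from partial_character_extend[OF M(1) g this] obtain X z
      where X: "partial_character G X" "M \<subseteq> X" "(g, z) \<in> X" by blast
    then have "X = M" using max by blast
    with X(3) * show False by blast
  qed
  define \<phi> where "\<phi> g = (THE z. (g, z) \<in> M)" for g
  have \<phi>: "\<phi> g = z" if "(g, z) \<in> M" for g z
    unfolding \<phi>_def using that partial_character_unique[OF M(1)] by blast
  have \<phi>M: "(g, \<phi> g) \<in> M" if "g \<in> carrier G" for g
    using dom[OF that] \<phi> by (metis DomainE)
  have "\<phi> \<in> hom G circle_group"
  proof (rule homI)
    show "\<phi> g \<in> carrier circle_group" if "g \<in> carrier G" for g
      using subgroup.subset[OF sM] \<phi>M[OF that] by auto
    show "\<phi> (g \<otimes> h) = \<phi> g \<otimes>\<^bsub>circle_group\<^esub> \<phi> h" if "g \<in> carrier G" "h \<in> carrier G" for g h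
      using subgroup.m_closed[OF sM \<phi>M[OF that(1)] \<phi>M[OF that(2)]] by (intro \<phi>) simp
  qed
  moreover have "\<phi> n = 1" if "n \<in> N" for n using that R1(2) M(2) by (intro \<phi>) auto
  moreover have "\<phi> x \<noteq> 1" using \<phi>[of x w] R1(3,4) M(2) by blast
  ultimately show ?thesis by blast
qed

end

section \<open>P-groups with a base of open subgroups\<close>

lemma (in comm_group) hom_circle_group:
  assumes "\<phi> \<in> hom G circle_group"
  shows "x \<in> carrier G \<Longrightarrow> cmod (\<phi> x) = 1"
    and "x \<in> carrier G \<Longrightarrow> y \<in> carrier G \<Longrightarrow> \<phi> (x \<otimes> y) = \<phi> x * \<phi> y"
    and "\<phi> \<one> = 1"
    and "x \<in> carrier G \<Longrightarrow> \<phi> (inv x) = cnj (\<phi> x)"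
    and "x \<in> carrier G \<Longrightarrow> \<phi> (x [^] (n::nat)) = \<phi> x ^ n"
proof -
  have C: "group circle_group" using comm_group_circle_group by (rule comm_group.axioms)
  show norm: "cmod (\<phi> x) = 1" if "x \<in> carrier G" for x
    using hom_in_carrier[OF assms that] by simp
  show mult: "\<phi> (x \<otimes> y) = \<phi> x * \<phi> y" if "x \<in> carrier G" "y \<in> carrier G" for x y
    using hom_mult[OF assms that] by simp
  show one: "\<phi> \<one> = 1" using hom_one[OF assms is_group C] by simp
  show "\<phi> (inv x) = cnj (\<phi> x)" if "x \<in> carrier G" for x
  proof -
    have "\<phi> (inv x) * \<phi> x = 1" using mult[of "inv x" x] that one by simp
    moreover have "cnj (\<phi> x) * \<phi> x = 1"
      using norm[OF that] complex_norm_square[of "\<phi> x"] by (simp add: mult.commute)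
    moreover have "\<phi> x \<noteq> 0" using norm[OF that] by auto
    ultimately show ?thesis by (metis mult_right_cancel)
  qed
  show "\<phi> (x [^] n) = \<phi> x ^ n" if "x \<in> carrier G" for x and n :: nat
    using that by (induction n) (simp_all add: one mult)
qed

text \<open>An abstraction of \<open>PH\<close> in which \<open>\<N>\<close> stands for the boxes.
  \<open>Inter_mem\<close> makes countable intersections of open sets open, and
  \<open>separating\<close> gives the Hausdorff property. Annihilators, their compactness and the
  form of the bidual characters on them need only these axioms.\<close>

locale linear_P_group = comm_group G for G (structure) +
  fixes T and \<N>
  assumes topspace: "topspace T = carrier G"
    and openin_iff: "openin T U \<longleftrightarrow> U \<subseteq> carrier G \<and> (\<forall>x\<in>U. \<exists>N\<in>\<N>. x <# N \<subseteq> U)"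
    and subgroup: "N \<in> \<N> \<Longrightarrow> subgroup N G"
    and carrier_mem: "carrier G \<in> \<N>"
    and Inter_mem: "countable \<D> \<Longrightarrow> \<D> \<noteq> {} \<Longrightarrow> \<D> \<subseteq> \<N> \<Longrightarrow> \<Inter>\<D> \<in> \<N>"
    and separating: "x \<in> carrier G \<Longrightarrow> x \<noteq> \<one> \<Longrightarrow> \<exists>N\<in>\<N>. x \<notin> N"
begin

lemma coset_iff: "N \<in> \<N> \<Longrightarrow> x \<in> carrier G \<Longrightarrow> y \<in> x <# N \<longleftrightarrow> y \<in> carrier G \<and> inv x \<otimes> y \<in> N"
  using subgroup.subset[OF subgroup, of N]
  by (auto simp: l_coset_def m_assoc[symmetric] intro!: bexI[of _ "inv x \<otimes> y"])

lemma Int_mem: "M \<in> \<N> \<Longrightarrow> N \<in> \<N> \<Longrightarrow> M \<inter> N \<in> \<N>"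
  using Inter_mem[of "{M, N}"] by simp

lemma mem_subset: "N \<in> \<N> \<Longrightarrow> x \<in> N \<Longrightarrow> x \<in> carrier G"
  using subgroup.subset[OF subgroup] by blast

lemma one_mem: "N \<in> \<N> \<Longrightarrow> \<one> \<in> N"
  using subgroup.one_closed[OF subgroup] by blast

lemma mem_coset_self: "N \<in> \<N> \<Longrightarrow> x \<in> carrier G \<Longrightarrow> x \<in> x <# N"
  by (simp add: coset_iff one_mem)

lemma coset_subset: "N \<in> \<N> \<Longrightarrow> x \<in> carrier G \<Longrightarrow> x <# N \<subseteq> carrier G"
  using coset_iff by blast

lemma coset_eq:
  assumes "N \<in> \<N>" "x \<in> carrier G" "y \<in> x <# N"
  shows "y <# N = x <# N"
proof -
  have y: "y \<in> carrier G" "inv x \<otimes> y \<in> N" using assms coset_iff by auto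
  have N: "subgroup N G" by (rule subgroup[OF assms(1)])
  have cancel: "a \<otimes> (inv a \<otimes> z) = z" if "a \<in> carrier G" "z \<in> carrier G" for a z
    using that by (simp add: m_assoc[symmetric])
  have "inv y \<otimes> z \<in> N \<longleftrightarrow> inv x \<otimes> z \<in> N" if z: "z \<in> carrier G" for z
  proof
    assume "inv y \<otimes> z \<in> N"
    from subgroup.m_closed[OF N y(2) this] have "(inv x \<otimes> y) \<otimes> (inv y \<otimes> z) \<in> N" .
    moreover have "(inv x \<otimes> y) \<otimes> (inv y \<otimes> z) = inv x \<otimes> z"
      using assms y z by (simp add: m_assoc cancel)
    ultimately show "inv x \<otimes> z \<in> N" by simp
  next
    assume "inv x \<otimes> z \<in> N"
    from subgroup.m_closed[OF N subgroup.m_inv_closed[OF N y(2)] this]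
    have mem: "inv (inv x \<otimes> y) \<otimes> (inv x \<otimes> z) \<in> N" .
    have "inv (inv x \<otimes> y) = inv y \<otimes> x" using assms(2) y(1) by (simp add: inv_mult_group)
    then have "inv (inv x \<otimes> y) \<otimes> (inv x \<otimes> z) = inv y \<otimes> z"
      using assms(2) y(1) z by (simp add: m_assoc cancel)
    with mem show "inv y \<otimes> z \<in> N" by (simp only:)
  qed
  with assms y(1) show ?thesis by (auto simp only: set_eq_iff coset_iff)
qed

lemma openin_coset: "N \<in> \<N> \<Longrightarrow> x \<in> carrier G \<Longrightarrow> openin T (x <# N)"
  unfolding openin_iff using coset_subset coset_eq by blast

lemma topological_abelian_group: "topological_abelian_group G T"
  unfolding topological_abelian_group_def topological_group_def
proof (intro conjI is_group topspace comm_group_axioms)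
  show "continuous_map (prod_topology T T) T (\<lambda>(x, y). x \<otimes> y)"
    unfolding continuous_map_def openin_prod_topology_alt
  proof (intro conjI allI impI)
    show "(\<lambda>(x, y). x \<otimes> y) \<in> topspace (prod_topology T T) \<rightarrow> topspace T"
      by (auto simp: topspace)
    fix U x y
    assume U: "openin T U"
      and "(x, y) \<in> {p \<in> topspace (prod_topology T T). (case p of (x, y) \<Rightarrow> x \<otimes> y) \<in> U}"
    then have xy: "x \<in> carrier G" "y \<in> carrier G" "x \<otimes> y \<in> U" by (auto simp: topspace)
    then obtain N where N: "N \<in> \<N>" "(x \<otimes> y) <# N \<subseteq> U" using U openin_iff by meson
    have "a \<otimes> b \<in> (x \<otimes> y) <# N" if "a \<in> x <# N" "b \<in> y <# N" for a b
    proof -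
      have ab: "a \<in> carrier G" "inv x \<otimes> a \<in> N" "b \<in> carrier G" "inv y \<otimes> b \<in> N"
        using that N xy coset_iff by auto
      then have "(inv x \<otimes> a) \<otimes> (inv y \<otimes> b) \<in> N"
        using subgroup.m_closed[OF subgroup[OF N(1)]] by blast
      also have "(inv x \<otimes> a) \<otimes> (inv y \<otimes> b) = inv (x \<otimes> y) \<otimes> (a \<otimes> b)"
        using ab xy by (simp add: inv_mult m_ac)
      finally show ?thesis using ab xy N coset_iff by simp
    qed
    then have "(x <# N) \<times> (y <# N) \<subseteq> {p \<in> topspace (prod_topology T T). (case p of (x, y) \<Rightarrow> x \<otimes> y) \<in> U}"
      using N xy coset_iff by (auto simp: topspace)
    then show "\<exists>V W. openin T V \<and> openin T W \<and> x \<in> V \<and> y \<in> W \<and>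
        V \<times> W \<subseteq> {p \<in> topspace (prod_topology T T). (case p of (x, y) \<Rightarrow> x \<otimes> y) \<in> U}"
      using xy N openin_coset mem_coset_self by meson
  qed
  show "continuous_map T T (\<lambda>x. inv x)"
    unfolding continuous_map_def
  proof (intro conjI allI impI)
    show "(\<lambda>x. inv x) \<in> topspace T \<rightarrow> topspace T" by (auto simp: topspace)
    fix U assume U: "openin T U"
    show "openin T {x \<in> topspace T. inv x \<in> U}"
      unfolding openin_iff
    proof (intro conjI ballI)
      fix x assume "x \<in> {x \<in> topspace T. inv x \<in> U}"
      then have x: "x \<in> carrier G" "inv x \<in> U" by (auto simp: topspace)
      then obtain N where N: "N \<in> \<N>" "inv x <# N \<subseteq> U" using U openin_iff by meson
      have "inv y \<in> inv x <# N" if "y \<in> x <# N" for y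
      proof -
        have y: "y \<in> carrier G" "inv x \<otimes> y \<in> N" using that N x coset_iff by auto
        then have "inv (inv x \<otimes> y) \<in> N" using subgroup.m_inv_closed[OF subgroup[OF N(1)]] by blast
        then show ?thesis using x y N coset_iff by (simp add: inv_mult)
      qed
      then show "\<exists>N\<in>\<N>. x <# N \<subseteq> {x \<in> topspace T. inv x \<in> U}"
        using N x coset_iff by (intro bexI[of _ N]) (auto simp: topspace)
    qed (auto simp: topspace)
  qed
  show "Hausdorff_space T"
    unfolding Hausdorff_space_def
  proof (intro allI impI, elim conjE)
    fix x y assume "x \<in> topspace T" "y \<in> topspace T" and ne: "x \<noteq> y"
    then have xy: "x \<in> carrier G" "y \<in> carrier G" by (auto simp: topspace)
    then have "inv x \<otimes> y \<noteq> \<one>" using ne by (metis inv_equality inv_closed inv_inv)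
    then obtain N where N: "N \<in> \<N>" "inv x \<otimes> y \<notin> N" using separating xy by (metis inv_closed m_closed)
    then have "y \<notin> x <# N" using xy coset_iff by blast
    then have "disjnt (x <# N) (y <# N)"
      unfolding disjnt_iff using coset_eq N xy mem_coset_self by metis
    then show "\<exists>U V. openin T U \<and> openin T V \<and> x \<in> U \<and> y \<in> V \<and> disjnt U V"
      using N xy openin_coset mem_coset_self by meson
  qed
qed

section \<open>Compact sets, continuous characters and the topology of the dual\<close>

text \<open>An infinite compact set would contain a countable infinite set with an accumulation
  point \<open>x\<close>. Each point of the countable set other than \<open>x\<close> is excluded
  from some coset at \<open>x\<close>, and the intersection of these countably many cosets is still
  a neighbourhood of \<open>x\<close>.\<close>

lemma finite_if_compactin:
  assumes "compactin T K"
  shows "finite K"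
proof (rule ccontr)
  assume "infinite K"
  then obtain S where S: "S \<subseteq> K" "countable S" "infinite S"
    by (meson infinite_countable_subset' uncountable_infinite countable_image countableI_type)
  then obtain x where x: "x \<in> K" "x \<in> T derived_set_of S"
    using compactin_imp_Bolzano_Weierstrass[OF assms] by blast
  have K: "K \<subseteq> carrier G" using compactin_subset_topspace[OF assms] topspace by simp
  have "\<exists>N\<in>\<N>. s \<notin> x <# N" if s: "s \<in> S - {x}" for s
  proof -
    have c: "s \<in> carrier G" "x \<in> carrier G" "s \<noteq> x" using s S x K by auto
    then have "inv x \<otimes> s \<noteq> \<one>" by (metis inv_equality inv_closed inv_inv)
    then obtain N where "N \<in> \<N>" "inv x \<otimes> s \<notin> N" using separating c by (metis inv_closed m_closed)
    then show ?thesis using c coset_iff by blast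
  qed
  then obtain f where f: "\<And>s. s \<in> S - {x} \<Longrightarrow> f s \<in> \<N> \<and> s \<notin> x <# f s" by metis
  let ?N = "\<Inter>(insert (carrier G) (f ` (S - {x})))"
  have "?N \<in> \<N>" using f S carrier_mem by (intro Inter_mem) auto
  then have "openin T (x <# ?N)" "x \<in> x <# ?N" using x K openin_coset mem_coset_self by blast+
  then obtain y where y: "y \<noteq> x" "y \<in> S" "y \<in> x <# ?N"
    using x(2) by (auto simp: in_derived_set_of)
  then have "y \<in> x <# f y" unfolding l_coset_def by auto
  with f y show False by blast
qed

text \<open>Continuity at \<open>\<one>\<close> sends some member \<open>N\<close> of
  \<open>\<N>\<close> into the unit ball around 1. The image is closed under powers, so it must be
  trivial, since nontrivial points of the circle have powers far from 1.\<close>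

lemma character_iff:
  "\<phi> \<in> characters G T \<longleftrightarrow>
    \<phi> \<in> extensional (carrier G) \<and> \<phi> \<in> hom G circle_group \<and> (\<exists>N\<in>\<N>. \<forall>x\<in>N. \<phi> x = 1)"
proof -
  have "continuous_map T (top_of_set (carrier circle_group)) \<phi> \<longleftrightarrow> (\<exists>N\<in>\<N>. \<forall>x\<in>N. \<phi> x = 1)"
    if hom: "\<phi> \<in> hom G circle_group"
  proof
    assume "continuous_map T (top_of_set (carrier circle_group)) \<phi>"
    then have "continuous_map T euclidean \<phi>" by (simp add: continuous_map_in_subtopology)
    then have "openin T {x \<in> topspace T. \<phi> x \<in> ball 1 1}"
      by (rule openin_continuous_map_preimage) simp
    moreover have "\<one> \<in> {x \<in> topspace T. \<phi> x \<in> ball 1 1}"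
      by (simp add: topspace hom_circle_group(3)[OF hom])
    ultimately obtain N where N: "N \<in> \<N>" "\<one> <# N \<subseteq> {x \<in> topspace T. \<phi> x \<in> ball 1 1}"
      unfolding openin_iff by meson
    have "\<phi> x = 1" if x: "x \<in> N" for x
    proof (rule ccontr)
      assume "\<phi> x \<noteq> 1"
      moreover have xc: "x \<in> carrier G" using N x mem_subset by blast
      ultimately obtain k :: nat where k: "1 \<le> dist (\<phi> x ^ k) 1"
        using exists_power_far_from_one hom_circle_group(1)[OF hom] by blast
      have "x [^] k \<in> N" by (induction k) (use N x one_mem subgroup.m_closed[OF subgroup] in auto)
      then have "x [^] k \<in> \<one> <# N" using N xc by (simp add: coset_iff)
      then have "\<phi> (x [^] k) \<in> ball 1 1" using N by blast
      with k show False by (simp add: hom_circle_group(5)[OF hom xc] dist_commute)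
    qed
    with N show "\<exists>N\<in>\<N>. \<forall>x\<in>N. \<phi> x = 1" by blast
  next
    assume "\<exists>N\<in>\<N>. \<forall>x\<in>N. \<phi> x = 1"
    then obtain N where N: "N \<in> \<N>" "\<And>x. x \<in> N \<Longrightarrow> \<phi> x = 1" by blast
    have eq: "\<phi> y = \<phi> x" if "x \<in> carrier G" "y \<in> x <# N" for x y
    proof -
      have y: "y \<in> carrier G" "inv x \<otimes> y \<in> N" using that N coset_iff by auto
      then have "\<phi> (x \<otimes> (inv x \<otimes> y)) = \<phi> x"
        using N that by (subst hom_circle_group(2)[OF hom]) auto
      moreover have "x \<otimes> (inv x \<otimes> y) = y" using that y by (simp add: m_assoc[symmetric])
      ultimately show ?thesis by simp
    qed
    have "openin T {x \<in> topspace T. \<phi> x \<in> U}" for U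
      unfolding openin_iff topspace
    proof (intro conjI ballI)
      fix x assume "x \<in> {x \<in> carrier G. \<phi> x \<in> U}"
      then have x: "x \<in> carrier G" "\<phi> x \<in> U" by auto
      then have "x <# N \<subseteq> {x \<in> carrier G. \<phi> x \<in> U}"
        using eq[OF x(1)] coset_subset[OF N(1) x(1)] by auto
      then show "\<exists>N\<in>\<N>. x <# N \<subseteq> {x \<in> carrier G. \<phi> x \<in> U}" using N(1) by blast
    qed auto
    then have "continuous_map T euclidean \<phi>" unfolding continuous_map by simp
    then show "continuous_map T (top_of_set (carrier circle_group)) \<phi>"
      using hom_circle_group(1)[OF hom] by (auto simp: continuous_map_in_subtopology topspace)
  qed
  then show ?thesis unfolding characters_def by blast
qed

lemma character_hom: "\<phi> \<in> characters G T \<Longrightarrow> \<phi> \<in> hom G circle_group"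
  by (simp add: characters_def)

lemmas character_simps = hom_circle_group[OF character_hom]

text \<open>Compact sets are finite, so uniform convergence on them is pointwise convergence, and
  compactness in the dual becomes compactness in a function space.\<close>

lemma dual_topology_eq: "dual_topology G T = top_of_set (characters G T)"
  unfolding topology_eq
proof (intro allI iffI)
  fix U assume U: "openin (dual_topology G T) U"
  show "openin (top_of_set (characters G T)) U"
    unfolding openin_subopen[of _ U]
  proof
    fix \<phi> assume "\<phi> \<in> U"
    then obtain K \<epsilon> where K: "compactin T K" "\<epsilon> > 0"
      and sub: "{\<psi> \<in> characters G T. \<forall>x\<in>K. dist (\<psi> x) (\<phi> x) < \<epsilon>} \<subseteq> U"
      using U unfolding openin_dual_topology by meson
    have "open {\<psi>. \<forall>x\<in>K. \<psi> x \<in> ball (\<phi> x) \<epsilon>}"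
      using product_topology_basis'[OF finite_if_compactin[OF K(1)], of "\<lambda>x. ball (\<phi> x) \<epsilon>" "\<lambda>x. x"]
      by simp
    moreover have "characters G T \<inter> {\<psi>. \<forall>x\<in>K. \<psi> x \<in> ball (\<phi> x) \<epsilon>} \<subseteq> U"
      using sub by (auto simp: dist_commute)
    moreover have "\<phi> \<in> characters G T" using U \<open>\<phi> \<in> U\<close> unfolding openin_dual_topology by blast
    ultimately show "\<exists>V. openin (top_of_set (characters G T)) V \<and> \<phi> \<in> V \<and> V \<subseteq> U"
      using K(2) by (intro exI[of _ "characters G T \<inter> {\<psi>. \<forall>x\<in>K. \<psi> x \<in> ball (\<phi> x) \<epsilon>}"])
        (auto intro: openin_open_Int)
  qed
next
  fix U assume "openin (top_of_set (characters G T)) U"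
  then obtain W where W: "open W" "U = characters G T \<inter> W" by (auto simp: openin_open)
  show "openin (dual_topology G T) U"
    unfolding openin_dual_topology
  proof (intro conjI ballI)
    show "U \<subseteq> characters G T" using W by blast
    fix \<phi> assume \<phi>: "\<phi> \<in> U"
    then obtain X where X: "\<And>i. \<phi> i \<in> X i" "\<And>i. open (X i)" "finite {i. X i \<noteq> UNIV}" "PiE UNIV X \<subseteq> W"
      using product_topology_open_contains_basis[of "\<lambda>_. euclidean" UNIV W \<phi>] W
      unfolding open_fun_def by auto
    define K where "K = {i \<in> carrier G. X i \<noteq> UNIV}"
    have K: "finite K" "K \<subseteq> carrier G" using X(3) by (auto simp: K_def)
    have "\<exists>e>0. ball (\<phi> i) e \<subseteq> X i" for i using X(1,2) open_contains_ball by blast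
    then obtain e where e: "\<And>i. e i > 0" "\<And>i. ball (\<phi> i) (e i) \<subseteq> X i" by metis
    define \<epsilon> where "\<epsilon> = Min (insert 1 (e ` K))"
    have "\<epsilon> > 0" using K e by (simp add: \<epsilon>_def)
    moreover have \<epsilon>: "\<epsilon> \<le> e i" if "i \<in> K" for i using K that by (simp add: \<epsilon>_def)
    moreover have "compactin T K" using K by (simp add: finite_imp_compactin topspace)
    moreover have "\<psi> \<in> U" if \<psi>: "\<psi> \<in> characters G T" "\<forall>x\<in>K. dist (\<psi> x) (\<phi> x) < \<epsilon>" for \<psi>
    proof -
      have "\<psi> i \<in> X i" for i
      proof (cases "i \<in> carrier G")
        case True
        show ?thesis
        proof (cases "i \<in> K")
          case True
          then have "\<psi> i \<in> ball (\<phi> i) (e i)" using \<psi>(2) \<epsilon>[OF True] by (force simp: dist_commute)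
          then show ?thesis using e(2) by blast
        qed (use True in \<open>auto simp: K_def\<close>)
      next
        \<comment> \<open>Outside the carrier both characters are \<open>undefined\<close>, so these
          coordinates impose no condition.\<close>
        case False
        then have "\<psi> i = \<phi> i"
          using \<psi>(1) \<phi> W unfolding characters_def by (auto simp: extensional_def)
        then show ?thesis using X(1) by simp
      qed
      then show ?thesis using X(4) W \<psi>(1) by auto
    qed
    ultimately show "\<exists>K \<epsilon>. compactin T K \<and> \<epsilon> > 0 \<and>
        {\<psi> \<in> characters G T. \<forall>x\<in>K. dist (\<psi> x) (\<phi> x) < \<epsilon>} \<subseteq> U" by blast
  qed
qed

lemma compactin_dual_iff: "compactin (dual_topology G T) C \<longleftrightarrow> C \<subseteq> characters G T \<and> compact C"
  by (auto simp: dual_topology_eq compactin_subtopology compactin_euclidean_iff)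

lemma carrier_dual [simp]: "carrier (dual_group G T) = characters G T"
  by (simp add: dual_group_def)

lemma dual_mult: "\<phi> \<otimes>\<^bsub>dual_group G T\<^esub> \<psi> = (\<lambda>x\<in>carrier G. \<phi> x * \<psi> x)"
  by (simp add: dual_group_def circle_group_def)

definition annihilator where "annihilator N = {\<phi> \<in> characters G T. \<forall>x\<in>N. \<phi> x = 1}"

lemma character_annihilator: "\<phi> \<in> characters G T \<Longrightarrow> \<exists>N\<in>\<N>. \<phi> \<in> annihilator N"
  using character_iff unfolding annihilator_def by blast

lemma annihilator_mult:
  assumes "N \<in> \<N>" "\<phi> \<in> annihilator N" "\<psi> \<in> annihilator N"
  shows "\<phi> \<otimes>\<^bsub>dual_group G T\<^esub> \<psi> \<in> annihilator N"
proof -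
  have h: "\<phi> \<in> hom G circle_group" "\<psi> \<in> hom G circle_group"
    using assms character_hom by (auto simp: annihilator_def)
  have "(\<lambda>x\<in>carrier G. \<phi> x * \<psi> x) \<in> hom G circle_group"
    by (rule homI) (auto simp: norm_mult hom_circle_group(1,2)[OF h(1)] hom_circle_group(1,2)[OF h(2)])
  moreover have triv: "\<forall>x\<in>N. (\<lambda>x\<in>carrier G. \<phi> x * \<psi> x) x = 1"
    using assms mem_subset by (auto simp: annihilator_def)
  ultimately have "(\<lambda>x\<in>carrier G. \<phi> x * \<psi> x) \<in> characters G T"
    unfolding character_iff using assms(1) by (intro conjI bexI[of _ N] restrict_extensional)
  with triv show ?thesis unfolding annihilator_def dual_mult by blast
qed

text \<open>Any homomorphism to the circle that is trivial on \<open>N\<close> is continuous, so the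
  purely algebraic extension theorem is enough.\<close>

lemma separated_by_annihilator:
  assumes "N \<in> \<N>" "x \<in> carrier G" "x \<notin> N"
  shows "\<exists>\<phi>\<in>annihilator N. \<phi> x \<noteq> 1"
proof -
  obtain \<phi> where \<phi>: "\<phi> \<in> hom G circle_group" "\<forall>n\<in>N. \<phi> n = 1" "\<phi> x \<noteq> 1"
    using exists_separating_character[OF subgroup[OF assms(1)] assms(2,3)] by blast
  have "restrict \<phi> (carrier G) \<in> hom G circle_group"
    using \<phi>(1) by (auto simp: hom_def)
  moreover have triv: "\<forall>n\<in>N. restrict \<phi> (carrier G) n = 1" using \<phi>(2) assms(1) mem_subset by simp
  ultimately have "restrict \<phi> (carrier G) \<in> characters G T"
    unfolding character_iff using assms(1) by (intro conjI bexI[of _ N] restrict_extensional)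
  with triv have "restrict \<phi> (carrier G) \<in> annihilator N" unfolding annihilator_def by blast
  then show ?thesis using \<phi> assms(2) by (intro bexI[of _ "restrict \<phi> (carrier G)"]) auto
qed

text \<open>Triviality on \<open>N\<close> makes continuity automatic, so only the closed conditions
  of being multiplicative and trivial on \<open>N\<close> remain, inside a compact product of
  circles.\<close>

lemma compact_annihilator:
  assumes "N \<in> \<N>"
  shows "compact (annihilator N)"
proof -
  \<comment> \<open>The one-point factors \<open>{undefined}\<close> encode extensionality and keep
    the full product over the type compact.\<close>
  let ?S = "PiE UNIV (\<lambda>x. if x \<in> carrier G then sphere 0 1 else {undefined}) :: ('a \<Rightarrow> complex) set"
  let ?M = "\<Inter>x\<in>carrier G. \<Inter>y\<in>carrier G. {\<phi>::'a \<Rightarrow> complex. \<phi> (x \<otimes> y) = \<phi> x * \<phi> y}"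
  have "compactin (product_topology (\<lambda>_. euclidean) UNIV) ?S"
    unfolding compactin_PiE by (auto simp: compactin_euclidean_iff)
  then have "compact ?S"
    by (metis euclidean_product_topology compactin_euclidean_iff)
  moreover have c: "continuous_on UNIV (\<lambda>\<phi>::'a \<Rightarrow> complex. \<phi> x)" for x by simp
  have m: "closed {\<phi>::'a \<Rightarrow> complex. \<phi> (x \<otimes> y) = \<phi> x * \<phi> y}" for x y
    by (rule closed_Collect_eq[OF c continuous_on_mult[OF c c]])
  have "closed ?M" by (intro closed_INT ballI m)
  moreover have o: "closed {\<phi>::'a \<Rightarrow> complex. \<phi> x = 1}" for x
    by (rule closed_Collect_eq[OF c continuous_on_const])
  have "closed (\<Inter>x\<in>N. {\<phi>::'a \<Rightarrow> complex. \<phi> x = 1})" by (intro closed_INT ballI o)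
  ultimately have "compact (?S \<inter> (?M \<inter> (\<Inter>x\<in>N. {\<phi>. \<phi> x = 1})))"
    by (intro compact_Int_closed closed_Int)
  also have "?S \<inter> (?M \<inter> (\<Inter>x\<in>N. {\<phi>. \<phi> x = 1})) = annihilator N"
  proof -
    have S: "\<phi> \<in> ?S \<longleftrightarrow> \<phi> \<in> extensional (carrier G) \<and> (\<forall>x\<in>carrier G. cmod (\<phi> x) = 1)" for \<phi>
      by (auto simp: PiE_iff extensional_def split: if_splits)
    have H: "\<phi> \<in> hom G circle_group \<longleftrightarrow> (\<forall>x\<in>carrier G. cmod (\<phi> x) = 1) \<and> \<phi> \<in> ?M" for \<phi>
      by (auto simp: hom_def)
    have E: "\<phi> \<in> annihilator N \<longleftrightarrow>
        \<phi> \<in> extensional (carrier G) \<and> \<phi> \<in> hom G circle_group \<and> (\<forall>x\<in>N. \<phi> x = 1)" for \<phi>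
      unfolding annihilator_def character_iff using assms by blast
    show ?thesis unfolding set_eq_iff Int_iff S E H INT_iff mem_Collect_eq by blast
  qed
  finally show ?thesis .
qed

lemma evaluation_in_bidual:
  assumes "x \<in> carrier G"
  shows "evaluation G T x \<in> characters (dual_group G T) (dual_topology G T)"
proof -
  have "continuous_on UNIV (\<lambda>\<phi>::'a \<Rightarrow> complex. \<phi> x)" by simp
  then have "continuous_on (characters G T) (\<lambda>\<phi>. \<phi> x)" by (rule continuous_on_subset) simp
  then have "continuous_on (characters G T) (evaluation G T x)"
    by (rule continuous_on_eq) (simp add: evaluation_def)
  moreover have "evaluation G T x \<in> hom (dual_group G T) circle_group"
  proof (rule homI)
    show "evaluation G T x \<phi> \<in> carrier circle_group" if "\<phi> \<in> carrier (dual_group G T)" for \<phi>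
      using that assms by (simp add: evaluation_def character_simps)
    show "evaluation G T x (\<phi> \<otimes>\<^bsub>dual_group G T\<^esub> \<psi>) =
        evaluation G T x \<phi> \<otimes>\<^bsub>circle_group\<^esub> evaluation G T x \<psi>"
      if \<phi>\<psi>: "\<phi> \<in> carrier (dual_group G T)" "\<psi> \<in> carrier (dual_group G T)" for \<phi> \<psi>
    proof -
      obtain M N where M: "M \<in> \<N>" "\<phi> \<in> annihilator M" and N: "N \<in> \<N>" "\<psi> \<in> annihilator N"
        using \<phi>\<psi> character_annihilator by (metis carrier_dual)
      then have "\<phi> \<in> annihilator (M \<inter> N)" "\<psi> \<in> annihilator (M \<inter> N)"
        by (auto simp: annihilator_def)
      then have "\<phi> \<otimes>\<^bsub>dual_group G T\<^esub> \<psi> \<in> characters G T"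
        using annihilator_mult[OF Int_mem[OF M(1) N(1)]] by (auto simp: annihilator_def)
      then show ?thesis using \<phi>\<psi> assms by (simp add: evaluation_def dual_mult)
    qed
  qed
  ultimately show ?thesis
    unfolding characters_def[of "dual_group G T"] dual_topology_eq
    using hom_in_carrier[of "evaluation G T x" "dual_group G T" circle_group]
    by (auto simp: continuous_map_in_subtopology evaluation_def)
qed

end

section \<open>Characters of the dual group\<close>

lemma multiplicative_funpow:
  fixes m :: "'x \<Rightarrow> complex"
  assumes "\<And>x y. x \<in> X \<Longrightarrow> y \<in> X \<Longrightarrow> op x y \<in> X"
    and "\<And>x y. x \<in> X \<Longrightarrow> y \<in> X \<Longrightarrow> m (op x y) = m x * m y"
    and "a \<in> X" "x \<in> X"
  shows "(op a ^^ k) x \<in> X \<and> m ((op a ^^ k) x) = m a ^ k * m x"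
  by (induction k) (auto simp: assms mult.assoc)

lemma one_le_if_div_nat_bound:
  assumes "\<And>N::nat. N > 0 \<Longrightarrow> (1::real) \<le> \<delta> + C / N"
  shows "1 \<le> \<delta>"
proof (rule ccontr)
  assume "\<not> 1 \<le> \<delta>"
  then have pos: "1 - \<delta> > 0" by simp
  obtain N :: nat where N: "C / (1 - \<delta>) < N" using reals_Archimedean2 by blast
  have "C < (1 - \<delta>) * (N + 1)"
    using N pos by (simp add: field_simps)
  then have "C / (N + 1) < 1 - \<delta>" using pos by (simp add: field_simps)
  then show False using assms[of "Suc N"] by (simp add: add.commute)
qed

text \<open>Averaging over the powers of a point where \<open>\<Phi>\<close> and one of the \<open>m j\<close> differ
  fixes \<open>\<Phi>\<close> and makes the coefficient of this \<open>m j\<close> arbitrarily small.\<close>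

lemma one_le_dist_character_combination:
  fixes \<Phi> :: "'x \<Rightarrow> complex" and m :: "nat \<Rightarrow> 'x \<Rightarrow> complex"
  assumes "X \<noteq> {}"
    and op: "\<And>x y. x \<in> X \<Longrightarrow> y \<in> X \<Longrightarrow> op x y \<in> X"
    and \<Phi>: "\<And>x. x \<in> X \<Longrightarrow> cmod (\<Phi> x) = 1" "\<And>x y. x \<in> X \<Longrightarrow> y \<in> X \<Longrightarrow> \<Phi> (op x y) = \<Phi> x * \<Phi> y"
    and m: "\<And>j x. j < n \<Longrightarrow> x \<in> X \<Longrightarrow> cmod (m j x) = 1"
      "\<And>j x y. j < n \<Longrightarrow> x \<in> X \<Longrightarrow> y \<in> X \<Longrightarrow> m j (op x y) = m j x * m j y"
      "\<And>j. j < n \<Longrightarrow> \<exists>x\<in>X. m j x \<noteq> \<Phi> x"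
    and bound: "\<And>x. x \<in> X \<Longrightarrow> cmod (\<Phi> x - (\<Sum>j<n. c j * m j x)) \<le> \<delta>"
  shows "1 \<le> \<delta>"
  using m bound
proof (induction n arbitrary: c \<delta>)
  case 0
  then show ?case using \<open>X \<noteq> {}\<close> \<Phi>(1) by fastforce
next
  case (Suc n)
  obtain a where a: "a \<in> X" "m n a \<noteq> \<Phi> a" using Suc.prems(3) by blast
  \<comment> \<open>\<open>u j\<close> is the quotient of \<open>m j a\<close> by
    \<open>\<Phi> a\<close>, since \<open>\<Phi> a\<close> is unimodular. The choice of
    \<open>a\<close> gives \<open>u n \<noteq> 1\<close>, so the means of its powers tend to
    0.\<close>
  define u where "u j = cnj (\<Phi> a) * m j a" for j
  have unit: "cnj (\<Phi> a) * \<Phi> a = 1"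
    using \<Phi>(1)[OF a(1)] complex_norm_square[of "\<Phi> a"] by (simp add: mult.commute)
  have u_norm: "cmod (u j) = 1" if "j < Suc n" for j
    using Suc.prems(1)[OF that a(1)] \<Phi>(1)[OF a(1)] by (simp add: u_def norm_mult)
  have un: "u n \<noteq> 1"
  proof
    assume "u n = 1"
    then have "cnj (\<Phi> a) * m n a = cnj (\<Phi> a) * \<Phi> a" by (simp add: u_def unit)
    moreover have "cnj (\<Phi> a) \<noteq> 0" using unit by auto
    ultimately show False using a(2) by simp
  qed
  \<comment> \<open>The sum of the first \<open>N\<close> powers of \<open>u n\<close> has modulus
    at most \<open>2 / cmod (u n - 1)\<close>; averaging therefore reduces the last coefficient to
    size at most \<open>C / N\<close>.\<close>
  define C where "C = cmod (c n) * 2 / cmod (u n - 1)"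
  have "1 \<le> \<delta> + C / N" if N: "N > 0" for N :: nat
  proof -
    define r where "r j = (\<Sum>k<N. u j ^ k) / N" for j
    have rn: "cmod (r n) \<le> 2 / cmod (u n - 1) / N"
    proof -
      have "(\<Sum>k<N. u n ^ k) = (u n ^ N - 1) / (u n - 1)" by (rule geometric_sum[OF un])
      moreover have "cmod (u n ^ N - 1) \<le> 2"
        using norm_triangle_ineq4[of "u n ^ N" 1] u_norm[of n] by (simp add: norm_power)
      ultimately show ?thesis
        using un N by (simp add: r_def norm_divide norm_mult divide_right_mono)
    qed
    have avg: "cmod (\<Phi> x - (\<Sum>j<Suc n. c j * r j * m j x)) \<le> \<delta>" if x: "x \<in> X" for x
    proof -
      let ?y = "\<lambda>k. (op a ^^ k) x"
      have y: "?y k \<in> X" for k using multiplicative_funpow[OF op \<Phi>(2) a(1) x] by blast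
      have \<Phi>y: "\<Phi> (?y k) = \<Phi> a ^ k * \<Phi> x" for k
        using multiplicative_funpow[OF op \<Phi>(2) a(1) x] by blast
      have my: "m j (?y k) = m j a ^ k * m j x" if "j < Suc n" for j k
        using multiplicative_funpow[OF op Suc.prems(2)[OF that] a(1) x] by blast
      \<comment> \<open>The unimodular weight cancels the factor that \<open>\<Phi>\<close> acquires
        at the \<open>k\<close>-th point and leaves each \<open>m j\<close> with
        \<open>u j ^ k\<close>. The error bound is unaffected, so it passes to the mean over
        \<open>k\<close>.\<close>
      have "cnj (\<Phi> a) ^ k * (\<Phi> (?y k) - (\<Sum>j<Suc n. c j * m j (?y k)))
          = \<Phi> x - (\<Sum>j<Suc n. c j * u j ^ k * m j x)" for k
      proof -
        have "cnj (\<Phi> a) ^ k * \<Phi> (?y k) = \<Phi> x"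
          by (simp add: \<Phi>y unit flip: mult.assoc power_mult_distrib)
        moreover have "cnj (\<Phi> a) ^ k * (\<Sum>j<Suc n. c j * m j (?y k)) = (\<Sum>j<Suc n. c j * u j ^ k * m j x)"
          unfolding sum_distrib_left
          by (rule sum.cong) (simp_all add: my u_def power_mult_distrib mult_ac)
        ultimately show ?thesis by (simp only: right_diff_distrib)
      qed
      then have "(\<Sum>k<N. cnj (\<Phi> a) ^ k * (\<Phi> (?y k) - (\<Sum>j<Suc n. c j * m j (?y k))))
          = N * \<Phi> x - (\<Sum>k<N. \<Sum>j<Suc n. c j * u j ^ k * m j x)"
        by (simp only: sum_subtractf) simp
      also have "(\<Sum>k<N. \<Sum>j<Suc n. c j * u j ^ k * m j x) = (\<Sum>j<Suc n. \<Sum>k<N. c j * u j ^ k * m j x)"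
        by (rule sum.swap)
      also have "\<dots> = (\<Sum>j<Suc n. N * (c j * r j * m j x))"
      proof (rule sum.cong[OF refl])
        fix j
        have "(\<Sum>k<N. c j * u j ^ k * m j x) = c j * m j x * (\<Sum>k<N. u j ^ k)"
          by (simp add: sum_distrib_left mult_ac)
        also have "(\<Sum>k<N. u j ^ k) = N * r j" using N by (simp add: r_def)
        finally show "(\<Sum>k<N. c j * u j ^ k * m j x) = N * (c j * r j * m j x)" by (simp add: mult_ac)
      qed
      also have "N * \<Phi> x - \<dots> = N * (\<Phi> x - (\<Sum>j<Suc n. c j * r j * m j x))"
        by (simp only: sum_distrib_left right_diff_distrib)
      finally have eq: "(\<Sum>k<N. cnj (\<Phi> a) ^ k * (\<Phi> (?y k) - (\<Sum>j<Suc n. c j * m j (?y k))))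
          = N * (\<Phi> x - (\<Sum>j<Suc n. c j * r j * m j x))" .
      have "N * cmod (\<Phi> x - (\<Sum>j<Suc n. c j * r j * m j x))
          = cmod (\<Sum>k<N. cnj (\<Phi> a) ^ k * (\<Phi> (?y k) - (\<Sum>j<Suc n. c j * m j (?y k))))"
        unfolding eq norm_mult by simp
      also have "\<dots> \<le> (\<Sum>k<N. cmod (cnj (\<Phi> a) ^ k * (\<Phi> (?y k) - (\<Sum>j<Suc n. c j * m j (?y k)))))"
        by (rule norm_sum)
      also have "\<dots> \<le> (\<Sum>k<N. \<delta>)"
        by (intro sum_mono) (use Suc.prems(4)[OF y] \<Phi>(1)[OF a(1)] in \<open>simp add: norm_mult norm_power\<close>)
      finally show ?thesis using N by simp
    qed
    \<comment> \<open>The induction hypothesis applies to the averaged coefficients after the last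
      term is moved into the error.\<close>
    have "1 \<le> \<delta> + cmod (c n * r n)"
    proof (rule Suc.IH[of "\<lambda>j. c j * r j"])
      fix x assume x: "x \<in> X"
      have "\<Phi> x - (\<Sum>j<n. c j * r j * m j x)
          = (\<Phi> x - (\<Sum>j<Suc n. c j * r j * m j x)) + c n * r n * m n x" by simp
      then have "cmod (\<Phi> x - (\<Sum>j<n. c j * r j * m j x))
          \<le> cmod (\<Phi> x - (\<Sum>j<Suc n. c j * r j * m j x)) + cmod (c n * r n * m n x)"
        by (metis norm_triangle_ineq)
      then show "cmod (\<Phi> x - (\<Sum>j<n. c j * r j * m j x)) \<le> \<delta> + cmod (c n * r n)"
        using avg[OF x] Suc.prems(1)[of n x] x by (simp add: norm_mult)
    qed (use Suc.prems in auto)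
    also have "cmod (c n * r n) \<le> C / N"
      using mult_left_mono[OF rn, of "cmod (c n)"] by (simp add: C_def norm_mult)
    finally show ?thesis by simp
  qed
  then show ?case by (intro one_le_if_div_nat_bound[of \<delta> C]) simp
qed

section \<open>Trigonometric polynomials on annihilators\<close>

context linear_P_group
begin

text \<open>The monomials are evaluations at points of \<open>G\<close>. A list may repeat points,
  so sums and products require no collecting of like terms, and only the values on \<open>X\<close>
  matter.\<close>

definition trig_polynomial :: "('a \<Rightarrow> complex) set \<Rightarrow> (('a \<Rightarrow> complex) \<Rightarrow> complex) \<Rightarrow> bool"
  where "trig_polynomial X f \<longleftrightarrow>
    (\<exists>L. (\<forall>(c, x)\<in>set L. x \<in> carrier G) \<and> (\<forall>\<phi>\<in>X. f \<phi> = (\<Sum>(c, x)\<leftarrow>L. c * \<phi> x)))"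

lemma trig_polynomial_add:
  assumes "trig_polynomial X f" "trig_polynomial X g"
  shows "trig_polynomial X (\<lambda>\<phi>. f \<phi> + g \<phi>)"
proof -
  obtain L M where "\<forall>(c, x)\<in>set L. x \<in> carrier G" "\<forall>\<phi>\<in>X. f \<phi> = (\<Sum>(c, x)\<leftarrow>L. c * \<phi> x)"
    "\<forall>(c, x)\<in>set M. x \<in> carrier G" "\<forall>\<phi>\<in>X. g \<phi> = (\<Sum>(c, x)\<leftarrow>M. c * \<phi> x)"
    using assms unfolding trig_polynomial_def by blast
  then show ?thesis
    unfolding trig_polynomial_def by (intro exI[of _ "L @ M"]) auto
qed

lemma trig_polynomial_monomial: "x \<in> carrier G \<Longrightarrow> trig_polynomial X (\<lambda>\<phi>. c * \<phi> x)"
  unfolding trig_polynomial_def by (rule exI[of _ "[(c, x)]"]) simp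

lemma trig_polynomial_const:
  assumes "X \<subseteq> characters G T"
  shows "trig_polynomial X (\<lambda>_. c)"
proof -
  have "\<phi> \<one> = 1" if "\<phi> \<in> X" for \<phi> using assms that character_simps(3) by blast
  then show ?thesis
    unfolding trig_polynomial_def by (intro exI[of _ "[(c, \<one>)]"]) simp
qed

lemma trig_polynomial_mult_monomial:
  assumes X: "X \<subseteq> characters G T" and f: "trig_polynomial X f" and x: "x \<in> carrier G"
  shows "trig_polynomial X (\<lambda>\<phi>. c * \<phi> x * f \<phi>)"
proof -
  obtain L where L: "\<forall>(d, y)\<in>set L. y \<in> carrier G" "\<forall>\<phi>\<in>X. f \<phi> = (\<Sum>(d, y)\<leftarrow>L. d * \<phi> y)"
    using f unfolding trig_polynomial_def by blast
  have "c * \<phi> x * (\<Sum>(d, y)\<leftarrow>L. d * \<phi> y) = (\<Sum>(d, y)\<leftarrow>map (\<lambda>(d, y). (c * d, x \<otimes> y)) L. d * \<phi> y)"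
    if "\<phi> \<in> characters G T" for \<phi>
    using L(1) by (induction L) (auto simp: algebra_simps character_simps(2)[OF that x])
  then show ?thesis
    unfolding trig_polynomial_def using L X x
    by (intro exI[of _ "map (\<lambda>(d, y). (c * d, x \<otimes> y)) L"]) auto
qed

lemma trig_polynomial_mult:
  assumes X: "X \<subseteq> characters G T" and "trig_polynomial X f" and g: "trig_polynomial X g"
  shows "trig_polynomial X (\<lambda>\<phi>. f \<phi> * g \<phi>)"
proof -
  obtain L where L: "\<forall>(d, y)\<in>set L. y \<in> carrier G" and f: "\<forall>\<phi>\<in>X. f \<phi> = (\<Sum>(d, y)\<leftarrow>L. d * \<phi> y)"
    using assms unfolding trig_polynomial_def by blast
  have "trig_polynomial X (\<lambda>\<phi>. (\<Sum>(d, y)\<leftarrow>L. d * \<phi> y) * g \<phi>)"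
    using L
  proof (induction L)
    case Nil
    then show ?case using trig_polynomial_const[OF X, of 0] by simp
  next
    case (Cons p L)
    obtain c x where p: "p = (c, x)" by force
    then have "trig_polynomial X (\<lambda>\<phi>. c * \<phi> x * g \<phi> + (\<Sum>(d, y)\<leftarrow>L. d * \<phi> y) * g \<phi>)"
      using Cons by (intro trig_polynomial_add trig_polynomial_mult_monomial[OF X g]) auto
    then show ?case by (simp add: p distrib_right)
  qed
  then show ?thesis using f unfolding trig_polynomial_def by auto
qed

text \<open>The conjugate of \<open>\<phi> x\<close> is \<open>\<phi> (inv x)\<close>, so real and
  imaginary parts are again combinations of evaluations. This lets real Stone-Weierstrass separate
  characters.\<close>

lemma trig_polynomial_Re_Im:
  assumes X: "X \<subseteq> characters G T" and x: "x \<in> carrier G"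
  shows "trig_polynomial X (\<lambda>\<phi>. of_real (Re (\<phi> x)))" "trig_polynomial X (\<lambda>\<phi>. of_real (Im (\<phi> x)))"
proof -
  have inv: "\<phi> (inv x) = cnj (\<phi> x)" if "\<phi> \<in> X" for \<phi> using that X character_simps(4) x by blast
  have "trig_polynomial X (\<lambda>\<phi>. 1/2 * \<phi> x + 1/2 * \<phi> (inv x))"
    using x by (intro trig_polynomial_add trig_polynomial_monomial) auto
  moreover have "\<forall>\<phi>\<in>X. of_real (Re (\<phi> x)) = 1/2 * \<phi> x + 1/2 * \<phi> (inv x)"
    by (simp add: inv complex_eq_iff)
  ultimately show "trig_polynomial X (\<lambda>\<phi>. of_real (Re (\<phi> x)))"
    unfolding trig_polynomial_def by auto
  have "trig_polynomial X (\<lambda>\<phi>. (- \<i> / 2) * \<phi> x + (\<i> / 2) * \<phi> (inv x))"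
    using x by (intro trig_polynomial_add trig_polynomial_monomial) auto
  moreover have "\<forall>\<phi>\<in>X. of_real (Im (\<phi> x)) = (- \<i> / 2) * \<phi> x + (\<i> / 2) * \<phi> (inv x)"
    by (simp add: inv complex_eq_iff)
  ultimately show "trig_polynomial X (\<lambda>\<phi>. of_real (Im (\<phi> x)))"
    unfolding trig_polynomial_def by auto
qed

lemma real_trig_polynomial_dense:
  assumes X: "compact X" "X \<subseteq> characters G T" and f: "continuous_on X f" and "\<epsilon> > 0"
  shows "\<exists>g. trig_polynomial X (\<lambda>\<phi>. of_real (g \<phi>)) \<and> (\<forall>\<phi>\<in>X. \<bar>f \<phi> - g \<phi>\<bar> < \<epsilon>)"
proof -
  let ?P = "\<lambda>f. trig_polynomial X (\<lambda>\<phi>. of_real (f \<phi>)) \<and> continuous_on X f"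
  have c: "continuous_on X (\<lambda>\<phi>. \<phi> x)" for x
    using continuous_on_subset[OF continuous_on_product_coordinates[of x]] by blast
  have "\<exists>g. ?P g \<and> (\<forall>\<phi>\<in>X. \<bar>f \<phi> - g \<phi>\<bar> < \<epsilon>)"
  proof (rule Stone_Weierstrass_HOL[OF X(1) _ _ _ _ _ f \<open>\<epsilon> > 0\<close>, of ?P])
    show "\<exists>f. ?P f \<and> f \<phi> \<noteq> f \<psi>" if \<section>: "\<phi> \<in> X \<and> \<psi> \<in> X \<and> \<phi> \<noteq> \<psi>" for \<phi> \<psi>
    proof -
      have "\<phi> \<in> extensional (carrier G)" "\<psi> \<in> extensional (carrier G)"
        using \<section> X(2) by (auto simp: characters_def)
      then obtain x where x: "x \<in> carrier G" "\<phi> x \<noteq> \<psi> x"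
        using \<section> extensionalityI by metis
      then consider "Re (\<phi> x) \<noteq> Re (\<psi> x)" | "Im (\<phi> x) \<noteq> Im (\<psi> x)"
        using complex_eqI by blast
      then show ?thesis
      proof cases
        case 1
        then show ?thesis
          using trig_polynomial_Re_Im(1)[OF X(2) x(1)] c
          by (intro exI[of _ "\<lambda>\<phi>. Re (\<phi> x)"]) (auto intro!: continuous_on_Re)
      next
        case 2
        then show ?thesis
          using trig_polynomial_Re_Im(2)[OF X(2) x(1)] c
          by (intro exI[of _ "\<lambda>\<phi>. Im (\<phi> x)"]) (auto intro!: continuous_on_Im)
      qed
    qed
  qed (auto intro: trig_polynomial_const[OF X(2)] trig_polynomial_add trig_polynomial_mult[OF X(2)]
      continuous_on_add continuous_on_mult)
  then show ?thesis by blast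
qed

text \<open>If \<open>\<Phi>\<close> differed from every evaluation on the annihilator, the
  averaging estimate would keep it at distance at least 1 from all trigonometric polynomials.
  Density, with error 1/4 in each of the real and imaginary parts, gives one within 1/2.\<close>

lemma bidual_eq_evaluation_on_annihilator:
  assumes \<Phi>: "\<Phi> \<in> characters (dual_group G T) (dual_topology G T)" and N: "N \<in> \<N>"
  shows "\<exists>x\<in>carrier G. \<forall>\<phi>\<in>annihilator N. \<Phi> \<phi> = \<phi> x"
proof (rule ccontr)
  assume neg: "\<not> ?thesis"
  let ?X = "annihilator N"
  have X: "?X \<subseteq> characters G T" by (auto simp: annihilator_def)
  have hom: "\<Phi> \<in> hom (dual_group G T) circle_group"
    and "continuous_map (top_of_set (characters G T)) (top_of_set (sphere 0 1)) \<Phi>"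
    using \<Phi> unfolding characters_def[of "dual_group G T"] dual_topology_eq
    by (auto simp: circle_group_def)
  then have "continuous_on (characters G T) \<Phi>" by (simp add: continuous_map_in_subtopology)
  then have cont: "continuous_on ?X \<Phi>" using X by (rule continuous_on_subset)
  obtain g1 g2 where g: "trig_polynomial ?X (\<lambda>\<phi>. of_real (g1 \<phi>))" "trig_polynomial ?X (\<lambda>\<phi>. of_real (g2 \<phi>))"
    and g1: "\<forall>\<phi>\<in>?X. \<bar>Re (\<Phi> \<phi>) - g1 \<phi>\<bar> < 1/4" and g2: "\<forall>\<phi>\<in>?X. \<bar>Im (\<Phi> \<phi>) - g2 \<phi>\<bar> < 1/4"
    using real_trig_polynomial_dense[OF compact_annihilator[OF N] X, of "\<lambda>\<phi>. Re (\<Phi> \<phi>)" "1/4"]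
      real_trig_polynomial_dense[OF compact_annihilator[OF N] X, of "\<lambda>\<phi>. Im (\<Phi> \<phi>)" "1/4"]
      continuous_on_Re[OF cont] continuous_on_Im[OF cont] by auto
  have "trig_polynomial ?X (\<lambda>\<phi>. of_real (g1 \<phi>) + \<i> * of_real (g2 \<phi>))"
    by (intro trig_polynomial_add trig_polynomial_mult trig_polynomial_const X g)
  then obtain L where L: "\<forall>(c, x)\<in>set L. x \<in> carrier G"
    "\<forall>\<phi>\<in>?X. of_real (g1 \<phi>) + \<i> * of_real (g2 \<phi>) = (\<Sum>(c, x)\<leftarrow>L. c * \<phi> x)"
    unfolding trig_polynomial_def by blast
  have Lx: "snd (L ! j) \<in> carrier G" if "j < length L" for j
    using L(1) nth_mem[OF that] by (metis case_prod_unfold)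
  have sum: "(\<Sum>(c, x)\<leftarrow>L. c * \<phi> x) = (\<Sum>j<length L. fst (L ! j) * \<phi> (snd (L ! j)))" for \<phi>
    by (simp add: sum_list_sum_nth case_prod_unfold atLeast0LessThan)
  have "(1::real) \<le> 1/2"
  proof (rule one_le_dist_character_combination[where X = ?X and \<Phi> = \<Phi> and n = "length L" and
        op = "\<lambda>\<phi> \<psi>. \<phi> \<otimes>\<^bsub>dual_group G T\<^esub> \<psi>" and m = "\<lambda>j \<phi>. \<phi> (snd (L ! j))" and c = "\<lambda>j. fst (L ! j)"])
    show "?X \<noteq> {}"
      using separated_by_annihilator[OF N] neg one_closed by blast
    show "\<phi> \<otimes>\<^bsub>dual_group G T\<^esub> \<psi> \<in> ?X" if "\<phi> \<in> ?X" "\<psi> \<in> ?X" for \<phi> \<psi>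
      using annihilator_mult[OF N that] .
    show "cmod (\<Phi> \<phi>) = 1" if "\<phi> \<in> ?X" for \<phi>
      using hom_in_carrier[OF hom, of \<phi>] that X by auto
    show "\<Phi> (\<phi> \<otimes>\<^bsub>dual_group G T\<^esub> \<psi>) = \<Phi> \<phi> * \<Phi> \<psi>" if "\<phi> \<in> ?X" "\<psi> \<in> ?X" for \<phi> \<psi>
      using hom_mult[OF hom, of \<phi> \<psi>] that X by auto
    show "cmod (\<phi> (snd (L ! j))) = 1" if "j < length L" "\<phi> \<in> ?X" for j \<phi>
      using character_simps(1) X Lx that by blast
    show "(\<phi> \<otimes>\<^bsub>dual_group G T\<^esub> \<psi>) (snd (L ! j)) = \<phi> (snd (L ! j)) * \<psi> (snd (L ! j))"
      if "j < length L" for j \<phi> \<psi>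
      using Lx[OF that] by (simp add: dual_mult)
    show "\<exists>\<phi>\<in>?X. \<phi> (snd (L ! j)) \<noteq> \<Phi> \<phi>" if "j < length L" for j
      using neg Lx[OF that] by metis
    show "cmod (\<Phi> \<phi> - (\<Sum>j<length L. fst (L ! j) * \<phi> (snd (L ! j)))) \<le> 1/2" if \<phi>: "\<phi> \<in> ?X" for \<phi>
    proof -
      let ?d = "\<Phi> \<phi> - (of_real (g1 \<phi>) + \<i> * of_real (g2 \<phi>))"
      have "cmod ?d \<le> \<bar>Re ?d\<bar> + \<bar>Im ?d\<bar>" by (rule cmod_le)
      also have "\<dots> \<le> 1/2" using bspec[OF g1 \<phi>] bspec[OF g2 \<phi>] by simp
      finally show ?thesis using L(2) \<phi> sum by simp
    qed
  qed
  then show False by simp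
qed

end

section \<open>Completeness with respect to cosets and surjectivity of evaluation\<close>

text \<open>These two axioms carry the compactness of the factors. \<open>coset_fip\<close> yields
  points from compatible cosets. \<open>absorbing\<close> is a version, for families with lower
  bounds of countable subfamilies, of the rule that multiplication by \<open>N\<close> commutes with
  decreasing intersections of compact sets, sharpened so that one member already lies in the
  product.\<close>

locale complete_P_group = linear_P_group +
  assumes coset_fip: "(\<And>c. c \<in> \<C> \<Longrightarrow> \<exists>x\<in>carrier G. \<exists>N\<in>\<N>. c = x <# N) \<Longrightarrow>
      (\<And>\<F>. finite \<F> \<Longrightarrow> \<F> \<subseteq> \<C> \<Longrightarrow> \<Inter>\<F> \<noteq> {}) \<Longrightarrow> carrier G \<inter> \<Inter>\<C> \<noteq> {}"
    and absorbing: "\<D> \<subseteq> \<N> \<Longrightarrow> (\<And>\<E>. countable \<E> \<Longrightarrow> \<E> \<subseteq> \<D> \<Longrightarrow> \<exists>M\<in>\<D>. \<forall>L\<in>\<E>. M \<subseteq> L) \<Longrightarrow> N \<in> \<N> \<Longrightarrow>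
      \<exists>M\<in>\<D>. M \<subseteq> N <#> \<Inter>\<D>"
begin

text \<open>On the annihilator of \<open>N\<close> the character is evaluation at some
  \<open>p N\<close>, unique modulo \<open>N\<close> by separation. For finitely many subgroups, the
  point chosen for their intersection lies in all the cosets \<open>p N <# N\<close>, because
  annihilators grow as subgroups shrink. So \<open>coset_fip\<close> glues the local points.\<close>

lemma bidual_eq_evaluation:
  assumes \<Phi>: "\<Phi> \<in> characters (dual_group G T) (dual_topology G T)"
  shows "\<exists>x\<in>carrier G. \<Phi> = evaluation G T x"
proof -
  obtain p where p: "\<And>N. N \<in> \<N> \<Longrightarrow> p N \<in> carrier G"
    "\<And>N \<phi>. N \<in> \<N> \<Longrightarrow> \<phi> \<in> annihilator N \<Longrightarrow> \<Phi> \<phi> = \<phi> (p N)"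
    using bidual_eq_evaluation_on_annihilator[OF \<Phi>] by metis
  let ?\<C> = "(\<lambda>N. p N <# N) ` \<N>"
  have "carrier G \<inter> \<Inter>?\<C> \<noteq> {}"
  proof (rule coset_fip)
    show "\<exists>x\<in>carrier G. \<exists>N\<in>\<N>. c = x <# N" if "c \<in> ?\<C>" for c using that p(1) by blast
    fix \<F> assume "finite \<F>" "\<F> \<subseteq> ?\<C>"
    then obtain \<D> where D: "\<D> \<subseteq> \<N>" "finite \<D>" "\<F> = (\<lambda>N. p N <# N) ` \<D>"
      by (meson finite_subset_image)
    show "\<Inter>\<F> \<noteq> {}"
    proof (cases "\<D> = {}")
      case False
      have M: "\<Inter>\<D> \<in> \<N>" using D False by (intro Inter_mem) (auto intro: countable_finite)
      have "p (\<Inter>\<D>) \<in> p N <# N" if N: "N \<in> \<D>" for N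
      proof (rule ccontr)
        have N': "N \<in> \<N>" using N D by blast
        have closed: "inv p N \<otimes> p (\<Inter>\<D>) \<in> carrier G" using p(1)[OF N'] p(1)[OF M] by simp
        assume "\<not> ?thesis"
        then have "inv p N \<otimes> p (\<Inter>\<D>) \<notin> N" using coset_iff[OF N' p(1)[OF N']] p(1)[OF M] by blast
        then obtain \<phi> where \<phi>: "\<phi> \<in> annihilator N" "\<phi> (inv p N \<otimes> p (\<Inter>\<D>)) \<noteq> 1"
          using separated_by_annihilator[OF N' closed] by blast
        then have ch: "\<phi> \<in> characters G T" and "\<phi> \<in> annihilator (\<Inter>\<D>)"
          using N by (auto simp: annihilator_def)
        then have eq: "\<phi> (p N) = \<phi> (p (\<Inter>\<D>))" using p(2)[OF M] p(2)[OF N' \<phi>(1)] by metis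
        have "\<phi> (inv p N \<otimes> p (\<Inter>\<D>)) = cnj (\<phi> (p N)) * \<phi> (p (\<Inter>\<D>))"
          using character_simps(2)[OF ch, of "inv p N" "p (\<Inter>\<D>)"] character_simps(4)[OF ch p(1)[OF N']]
            p(1)[OF N'] p(1)[OF M] by simp
        also have "\<dots> = 1"
          unfolding eq using character_simps(1)[OF ch p(1)[OF M]] complex_norm_square[of "\<phi> (p (\<Inter>\<D>))"]
          by (simp add: mult.commute)
        finally show False using \<phi>(2) by simp
      qed
      then show ?thesis using D by blast
    qed (use D in simp)
  qed
  then obtain x where x: "x \<in> carrier G" "\<And>N. N \<in> \<N> \<Longrightarrow> x \<in> p N <# N" by blast
  have ev: "\<Phi> \<phi> = \<phi> x" if \<phi>: "\<phi> \<in> characters G T" for \<phi>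
  proof -
    obtain N where N: "N \<in> \<N>" "\<phi> \<in> annihilator N" using character_annihilator[OF \<phi>] by blast
    have "inv p N \<otimes> x \<in> N" using x(2)[OF N(1)] coset_iff[OF N(1) p(1)[OF N(1)]] by blast
    then have "\<phi> (inv p N \<otimes> x) = 1" using N by (auto simp: annihilator_def)
    moreover have "x = p N \<otimes> (inv p N \<otimes> x)"
      using x(1) p(1)[OF N(1)] by (simp add: m_assoc[symmetric])
    ultimately have "\<phi> x = \<phi> (p N)"
      using character_simps(2)[OF \<phi> p(1)[OF N(1)], of "inv p N \<otimes> x"] x(1) p(1)[OF N(1)]
      by (metis inv_closed m_closed mult.right_neutral)
    then show ?thesis using p(2)[OF N] by simp
  qed
  have "\<Phi> \<in> extensional (characters G T)" using \<Phi> by (simp add: characters_def[of "dual_group G T"])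
  then have "\<Phi> = evaluation G T x"
    using ev by (auto simp: evaluation_def fun_eq_iff extensional_def)
  with x(1) show ?thesis by blast
qed

end

section \<open>Compact sets of characters\<close>

lemma exists_greatest_of_finite:
  assumes "finite B" "B \<noteq> {}" "trans r" "total_on B r"
  shows "\<exists>m\<in>B. \<forall>b\<in>B. b = m \<or> (b, m) \<in> r"
  using assms
proof (induction B rule: finite_ne_induct)
  case (insert a B)
  have "total_on B r" using insert.prems(2) by (auto simp: total_on_def)
  from insert.IH[OF insert.prems(1) this]
  obtain m where m: "m \<in> B" "\<forall>b\<in>B. b = m \<or> (b, m) \<in> r" by (rule bexE)
  consider "(a, m) \<in> r" | "(m, a) \<in> r"
    using insert.prems(2) insert.hyps(3) m(1) unfolding total_on_def by (metis insertCI)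
  then show ?case
  proof cases
    case 1
    then show ?thesis using m by blast
  next
    case 2
    then have "\<forall>b\<in>B. (b, a) \<in> r" using m(2) insert.prems(1) by (metis transD)
    then show ?thesis by blast
  qed
qed simp

lemma (in linear_P_group) annihilator_coset:
  assumes "N \<in> \<N>" "\<phi> \<in> annihilator N" "x \<in> carrier G" "y \<in> x <# N"
  shows "\<phi> y = \<phi> x"
proof -
  have y: "y \<in> carrier G" "inv x \<otimes> y \<in> N" using assms coset_iff by auto
  have ch: "\<phi> \<in> characters G T" and "\<phi> (inv x \<otimes> y) = 1" using assms y by (auto simp: annihilator_def)
  moreover have "x \<otimes> (inv x \<otimes> y) = y" using assms(3) y(1) by (simp add: m_assoc[symmetric])
  ultimately show ?thesis
    using character_simps(2)[OF ch assms(3), of "inv x \<otimes> y"] assms(3) y(1) by simp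
qed

context complete_P_group
begin

text \<open>If \<open>C\<close> is not contained in an annihilator, recursion of length \<open>\<omega>\<^sub>1\<close> yields subgroups
  \<open>n a\<close>, decreasing in \<open>a\<close>, and characters \<open>\<chi> a\<close> in \<open>C\<close> which are nontrivial on \<open>n a\<close>
  but trivial on all later \<open>n b\<close>.  A cluster point \<open>\<psi>\<close> of the \<open>\<chi> a\<close> is trivial on some \<open>n g\<close>,
  whereas a point \<open>s\<close> of \<open>n g\<close> can be chosen, again by recursion, such that all \<open>\<chi> a s\<close> with
  \<open>a\<close> beyond \<open>g\<close> stay away from 1.\<close>

theorem compact_subset_annihilator:
  assumes C: "C \<subseteq> characters G T" "compact C"
  shows "\<exists>N\<in>\<N>. C \<subseteq> annihilator N"
proof (rule ccontr)
  assume neg: "\<not> ?thesis"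
  \<comment> \<open>Passing to a power inside \<open>N\<close> replaces mere nontriviality by the
    bound 1, the same for all \<open>N\<close>; a uniform bound is needed to survive a limit of
    characters.\<close>
  have "\<exists>\<phi> x. \<phi> \<in> C \<and> x \<in> N \<and> 1 \<le> dist (\<phi> x) 1" if N: "N \<in> \<N>" for N
  proof -
    obtain \<phi> x where \<phi>: "\<phi> \<in> C" "x \<in> N" "\<phi> x \<noteq> 1"
      using neg N C(1) unfolding annihilator_def by blast
    have x: "x \<in> carrier G" and ch: "\<phi> \<in> characters G T" using \<phi> N mem_subset C(1) by blast+
    obtain k where "1 \<le> dist (\<phi> x ^ k) 1"
      using exists_power_far_from_one[OF character_simps(1)[OF ch x] \<phi>(3)] by blast
    moreover have "x [^] k \<in> N"
      by (induction k) (use N \<phi> one_mem subgroup.m_closed[OF subgroup] in auto)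
    ultimately show ?thesis using \<phi>(1) character_simps(5)[OF ch x] by metis
  qed
  then obtain cc xx where cc: "\<And>N. N \<in> \<N> \<Longrightarrow> cc N \<in> C" and xx: "\<And>N. N \<in> \<N> \<Longrightarrow> xx N \<in> N"
    and far: "\<And>N. N \<in> \<N> \<Longrightarrow> 1 \<le> dist (cc N (xx N)) 1" by metis
  obtain K where K: "\<And>\<phi>. \<phi> \<in> characters G T \<Longrightarrow> K \<phi> \<in> \<N>"
    "\<And>\<phi>. \<phi> \<in> characters G T \<Longrightarrow> \<phi> \<in> annihilator (K \<phi>)"
    using character_annihilator by metis
  \<comment> \<open>\<open>S N\<close> is a smaller subgroup on which the bad character chosen for
    \<open>N\<close> has become trivial.\<close>
  define S where "S N = N \<inter> K (cc N)" for N
  have S: "S N \<in> \<N>" "S N \<subseteq> N" "cc N \<in> annihilator (S N)" if "N \<in> \<N>" for N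
  proof -
    have ch: "cc N \<in> characters G T" using cc that C(1) by blast
    show "S N \<in> \<N>" unfolding S_def using that K(1)[OF ch] by (rule Int_mem)
    show "S N \<subseteq> N" by (auto simp: S_def)
    show "cc N \<in> annihilator (S N)" using K(2)[OF ch] by (auto simp: S_def annihilator_def)
  qed
  obtain r :: "real rel" and \<Omega> where wf: "wf r" and tr: "trans r" and tot: "total_on \<Omega> r"
    and r\<Omega>: "r \<subseteq> \<Omega> \<times> \<Omega>" and ne: "\<Omega> \<noteq> {}" and count: "\<And>a. countable {b. (b, a) \<in> r}"
    and bdd: "\<And>E. countable E \<Longrightarrow> E \<subseteq> \<Omega> \<Longrightarrow> \<exists>c\<in>\<Omega>. \<forall>b\<in>E. (b, c) \<in> r"
    using exists_omega_1_order by blast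
  \<comment> \<open>Each stage has only countably many predecessors, so the intersection stays in
    \<open>\<N>\<close>. The factor \<open>carrier G\<close> covers the least index, where the
    intersection is over the empty family.\<close>
  define n where "n = wfrec r (\<lambda>f a. carrier G \<inter> (\<Inter>b\<in>{b. (b, a) \<in> r}. S (f b)))"
  have n_eq: "n a = carrier G \<inter> (\<Inter>b\<in>{b. (b, a) \<in> r}. S (n b))" for a
  proof -
    have "n a = carrier G \<inter> (\<Inter>b\<in>{b. (b, a) \<in> r}. S (cut n r a b))"
      unfolding n_def by (rule wfrec[OF wf])
    also have "(\<Inter>b\<in>{b. (b, a) \<in> r}. S (cut n r a b)) = (\<Inter>b\<in>{b. (b, a) \<in> r}. S (n b))"
      by (intro INF_cong refl) (simp add: cut_apply)
    finally show ?thesis .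
  qed
  have n: "n a \<in> \<N>" for a
    using wf
  proof (induction a rule: wf_induct_rule)
    case (less a)
    have "n a = \<Inter>(insert (carrier G) ((\<lambda>b. S (n b)) ` {b. (b, a) \<in> r}))"
      by (subst n_eq) simp
    also have "\<dots> \<in> \<N>"
      using count[of a] less S(1) carrier_mem by (intro Inter_mem) auto
    finally show ?case .
  qed
  have n_sub: "n a \<subseteq> S (n b)" if "(b, a) \<in> r" for a b
    using that by (subst n_eq) blast
  define \<chi>' x' where "\<chi>' a = cc (n a)" and "x' a = xx (n a)" for a
  have \<chi>C: "\<chi>' a \<in> C" and \<chi>S: "\<chi>' a \<in> annihilator (S (n a))" and x'n: "x' a \<in> n a"
    and \<chi>x: "1 \<le> dist (\<chi>' a (x' a)) 1" for a
    using n S(3) cc xx far by (simp_all add: \<chi>'_def x'_def)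
  have \<chi>ch: "\<chi>' a \<in> characters G T" for a using \<chi>C C(1) by blast
  define tail where "tail g = {a \<in> \<Omega>. a = g \<or> (g, a) \<in> r}" for g
  \<comment> \<open>Finitely many tails have a common index above their starting points, so
    compactness of \<open>C\<close> provides a cluster point along the whole order.\<close>
  have "C \<inter> (\<Inter>g\<in>\<Omega>. closure (\<chi>' ` tail g)) \<noteq> {}"
  proof (rule compact_imp_fip_image[OF C(2)])
    fix F assume F: "finite F" "F \<subseteq> \<Omega>"
    then obtain c where c: "c \<in> \<Omega>" "\<forall>b\<in>F. (b, c) \<in> r"
      using bdd[OF countable_finite] by blast
    have "\<chi>' c \<in> closure (\<chi>' ` tail b)" if "b \<in> F" for b
      using that c by (intro subsetD[OF closure_subset]) (auto simp: tail_def)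
    then show "C \<inter> (\<Inter>g\<in>F. closure (\<chi>' ` tail g)) \<noteq> {}" using \<chi>C by blast
  qed auto
  then obtain \<psi> where \<psi>: "\<psi> \<in> C" "\<And>g. g \<in> \<Omega> \<Longrightarrow> \<psi> \<in> closure (\<chi>' ` tail g)" by blast
  have \<psi>ch: "\<psi> \<in> characters G T" using \<psi> C(1) by blast
  have \<psi>_closed: "\<psi> \<in> Z" if "g \<in> \<Omega>" "closed Z" "\<And>a. a \<in> tail g \<Longrightarrow> \<chi>' a \<in> Z" for g Z
    using \<psi>(2)[OF that(1)] closure_minimal[of "\<chi>' ` tail g" Z] that(2,3) by blast
  have cont: "continuous_on UNIV (\<lambda>f::'a \<Rightarrow> complex. f x)" for x by simp
  \<comment> \<open>\<open>\<psi>\<close> is trivial on \<open>K \<psi>\<close>, which need not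
    contain any \<open>n a\<close>. Absorption places some \<open>n g\<close> inside its product
    with the intersection of the chain, where \<open>\<psi>\<close> is trivial as well.\<close>
  have "\<exists>M\<in>n ` \<Omega>. M \<subseteq> K \<psi> <#> \<Inter>(n ` \<Omega>)"
  proof (rule absorbing)
    show "n ` \<Omega> \<subseteq> \<N>" using n by blast
    show "K \<psi> \<in> \<N>" by (rule K(1)[OF \<psi>ch])
    fix \<E> assume "countable \<E>" "\<E> \<subseteq> n ` \<Omega>"
    then obtain E where E: "countable E" "E \<subseteq> \<Omega>" "\<E> = n ` E"
      by (metis countable_subset_image)
    then obtain c where c: "c \<in> \<Omega>" "\<forall>b\<in>E. (b, c) \<in> r" using bdd by blast
    have "n c \<subseteq> n b" if "b \<in> E" for b
      using n_sub[of b c] S(2)[OF n, of b] c(2) that by blast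
    then show "\<exists>M\<in>n ` \<Omega>. \<forall>L\<in>\<E>. M \<subseteq> L" unfolding E(3) using c(1) by blast
  qed
  then obtain g where g: "g \<in> \<Omega>" "n g \<subseteq> K \<psi> <#> \<Inter>(n ` \<Omega>)" by blast
  \<comment> \<open>Every index \<open>a\<close> has a later one \<open>c\<close>, and
    \<open>n c\<close> lies in \<open>S (n a)\<close>, so each \<open>\<chi>' a\<close> is trivial
    on the intersection. This is a closed condition and passes to \<open>\<psi>\<close>.\<close>
  have \<psi>_Inter: "\<psi> x = 1" if x: "x \<in> \<Inter>(n ` \<Omega>)" for x
  proof -
    have "\<chi>' a x = 1" if a: "a \<in> tail g" for a
    proof -
      obtain c where "c \<in> \<Omega>" "(a, c) \<in> r" using bdd[of "{a}"] a by (auto simp: tail_def)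
      then have "x \<in> S (n a)" using x n_sub by blast
      then show ?thesis using \<chi>S by (auto simp: annihilator_def)
    qed
    moreover have "closed {f::'a \<Rightarrow> complex. f x = 1}"
      by (rule closed_Collect_eq[OF cont continuous_on_const])
    ultimately show ?thesis using \<psi>_closed[OF g(1), of "{f. f x = 1}"] by simp
  qed
  have \<psi>_ng: "\<psi> y = 1" if "y \<in> n g" for y
  proof -
    have "y \<in> K \<psi> <#> \<Inter>(n ` \<Omega>)" using that g(2) by blast
    then obtain h k where hk: "h \<in> K \<psi>" "k \<in> \<Inter>(n ` \<Omega>)" "y = h \<otimes> k"
      unfolding set_mult_def by blast
    then have "h \<in> carrier G" "k \<in> carrier G" using K(1)[OF \<psi>ch] g(1) n mem_subset by blast+
    then show ?thesis
      using hk(1,3) \<psi>_Inter[OF hk(2)] K(2)[OF \<psi>ch] character_simps(2)[OF \<psi>ch]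
      by (simp add: annihilator_def)
  qed
  have n_g: "n a \<subseteq> n g" if "a \<in> tail g" for a
    using that n_sub[of g a] S(2)[OF n, of g] by (auto simp: tail_def)
  \<comment> \<open>\<open>u\<close> lies in all cosets fixed so far. If \<open>\<chi>' a\<close> is
    too close to 1 at \<open>u\<close>, multiplication by \<open>x' a\<close> moves it away without
    leaving these cosets, since \<open>x' a\<close> belongs to \<open>n a\<close> and thus to
    \<open>S (n b)\<close> for every earlier \<open>b\<close>.\<close>
  define t where "t = wfrec r (\<lambda>f a.
    let u = SOME u. u \<in> n g \<and> (\<forall>b. (b, a) \<in> r \<and> b \<in> tail g \<longrightarrow> u \<in> f b <# S (n b))
    in if 1/2 \<le> dist (\<chi>' a u) 1 then u else u \<otimes> x' a)"
  define v where "v a = (SOME u. u \<in> n g \<and> (\<forall>b. (b, a) \<in> r \<and> b \<in> tail g \<longrightarrow> u \<in> t b <# S (n b)))" for a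
  have t_eq: "t a = (if 1/2 \<le> dist (\<chi>' a (v a)) 1 then v a else v a \<otimes> x' a)" for a
  proof -
    have "t a = (let u = SOME u. u \<in> n g \<and>
        (\<forall>b. (b, a) \<in> r \<and> b \<in> tail g \<longrightarrow> u \<in> cut t r a b <# S (n b))
      in if 1/2 \<le> dist (\<chi>' a u) 1 then u else u \<otimes> x' a)"
      unfolding t_def by (rule wfrec[OF wf])
    moreover have "(\<lambda>u. u \<in> n g \<and> (\<forall>b. (b, a) \<in> r \<and> b \<in> tail g \<longrightarrow> u \<in> cut t r a b <# S (n b)))
      = (\<lambda>u. u \<in> n g \<and> (\<forall>b. (b, a) \<in> r \<and> b \<in> tail g \<longrightarrow> u \<in> t b <# S (n b)))"
      by (intro ext conj_cong refl all_cong) (simp add: cut_apply)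
    ultimately show ?thesis by (simp only: v_def Let_def)
  qed
  define P where "P a \<longleftrightarrow> t a \<in> n g \<and> 1/2 \<le> dist (\<chi>' a (t a)) 1 \<and>
    (\<forall>b. (b, a) \<in> r \<and> b \<in> tail g \<longrightarrow> t a \<in> t b <# S (n b))" for a
  \<comment> \<open>Among finitely many indices the point \<open>t m\<close> of the greatest one
    lies in all the cosets; \<open>coset_fip\<close> extends this to any set of indices. It serves
    both at each stage of the recursion and at its end.\<close>
  have ex: "\<exists>u. u \<in> n g \<and> (\<forall>b\<in>B. u \<in> t b <# S (n b))" if B: "B \<subseteq> tail g" "\<And>b. b \<in> B \<Longrightarrow> P b" for B
  proof -
    let ?c = "\<lambda>b. t b <# S (n b)"
    have tc: "t b \<in> carrier G" if "b \<in> B" for b using B(2)[OF that] n mem_subset by (auto simp: P_def)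
    have "carrier G \<inter> \<Inter>(insert (n g) (?c ` B)) \<noteq> {}"
    proof (rule coset_fip)
      have "n g = \<one> <# n g" using mem_subset[OF n] by (auto simp: coset_iff[OF n])
      then show "\<exists>x\<in>carrier G. \<exists>N\<in>\<N>. c = x <# N" if "c \<in> insert (n g) (?c ` B)" for c
        using that tc n S(1)[OF n] by blast
      fix \<F> assume F: "finite \<F>" "\<F> \<subseteq> insert (n g) (?c ` B)"
      then have "finite (\<F> - {n g})" "\<F> - {n g} \<subseteq> ?c ` B" by auto
      then obtain B' where B': "B' \<subseteq> B" "finite B'" "\<F> - {n g} = ?c ` B'"
        by (meson finite_subset_image)
      have "\<exists>z\<in>n g. \<forall>b\<in>B'. z \<in> ?c b"
      proof (cases "B' = {}")
        case True
        then show ?thesis using one_mem[OF n] by blast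
      next
        case False
        have "total_on B' r"
          using tot by (rule total_on_subset) (use B' B(1) in \<open>auto simp: tail_def\<close>)
        then obtain m where m: "m \<in> B'" "\<forall>b\<in>B'. b = m \<or> (b, m) \<in> r"
          using exists_greatest_of_finite[OF B'(2) False tr] by blast
        have mB: "m \<in> B" using m(1) B'(1) by blast
        have "t m \<in> ?c b" if b: "b \<in> B'" for b
        proof (cases "b = m")
          case True
          then show ?thesis using mem_coset_self[OF S(1)[OF n] tc[OF mB]] by simp
        next
          case False
          then have "(b, m) \<in> r" "b \<in> tail g" using m(2) b B' B(1) by auto
          then show ?thesis using B(2)[OF mB] by (simp add: P_def)
        qed
        moreover have "t m \<in> n g" using B(2)[OF mB] by (simp add: P_def)
        ultimately show ?thesis by blast
      qed
      then show "\<Inter>\<F> \<noteq> {}" using B'(3) by blast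
    qed
    then show ?thesis by blast
  qed
  have P: "a \<in> tail g \<Longrightarrow> P a" for a
    using wf
  proof (induction a rule: wf_induct_rule)
    case (less a)
    have "\<exists>u. u \<in> n g \<and> (\<forall>b\<in>{b. (b, a) \<in> r \<and> b \<in> tail g}. u \<in> t b <# S (n b))"
      by (rule ex) (use less in auto)
    then have "\<exists>u. u \<in> n g \<and> (\<forall>b. (b, a) \<in> r \<and> b \<in> tail g \<longrightarrow> u \<in> t b <# S (n b))" by blast
    then have v: "v a \<in> n g \<and> (\<forall>b. (b, a) \<in> r \<and> b \<in> tail g \<longrightarrow> v a \<in> t b <# S (n b))"
      unfolding v_def by (rule someI_ex)
    have vc: "v a \<in> carrier G" and xc: "x' a \<in> carrier G" using v x'n n mem_subset by blast+
    show ?case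
    proof (cases "1/2 \<le> dist (\<chi>' a (v a)) 1")
      case True
      then show ?thesis using v by (simp add: P_def t_eq[of a])
    next
      case False
      then have t: "t a = v a \<otimes> x' a" by (simp add: t_eq)
      have "t a \<in> n g"
        unfolding t using v x'n n_g[OF less.prems] subgroup.m_closed[OF subgroup[OF n]] by blast
      moreover have "1/2 \<le> dist (\<chi>' a (t a)) 1"
      proof -
        \<comment> \<open>One factor is within 1/2 of 1 and the other at distance at least 1, so the
          product is at distance at least 1/2; the threshold balances the two cases.\<close>
        let ?p = "\<chi>' a (v a)" and ?q = "\<chi>' a (x' a)"
        have "?q - 1 = ?p * ?q - 1 - ?q * (?p - 1)" by (simp add: algebra_simps)
        then have "cmod (?q - 1) \<le> cmod (?p * ?q - 1) + cmod (?q * (?p - 1))"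
          by (metis norm_triangle_ineq4)
        moreover have "cmod (?q * (?p - 1)) < 1/2"
          using False character_simps(1)[OF \<chi>ch xc] by (simp add: norm_mult dist_norm)
        ultimately show ?thesis
          using \<chi>x[of a] character_simps(2)[OF \<chi>ch vc xc] by (simp add: t dist_norm)
      qed
      moreover have "t a \<in> t b <# S (n b)" if b: "(b, a) \<in> r" "b \<in> tail g" for b
      proof -
        have tb: "t b \<in> carrier G" using less.IH[OF b] n mem_subset by (auto simp: P_def)
        have "inv (t b) \<otimes> v a \<in> S (n b)" using v b coset_iff[OF S(1)[OF n] tb] by blast
        moreover have "x' a \<in> S (n b)" using x'n n_sub[OF b(1)] by blast
        ultimately have "(inv (t b) \<otimes> v a) \<otimes> x' a \<in> S (n b)"
          by (rule subgroup.m_closed[OF subgroup[OF S(1)[OF n]]])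
        then show ?thesis
          unfolding t coset_iff[OF S(1)[OF n] tb] using tb vc xc by (simp add: m_assoc)
      qed
      ultimately show ?thesis by (simp add: P_def)
    qed
  qed
  \<comment> \<open>\<open>\<chi>' a\<close> is constant on cosets of \<open>S (n a)\<close>, so its
    value at \<open>s\<close> is its value at \<open>t a\<close>. Distance 1/2 from 1 is a closed
    condition, inherited by \<open>\<psi>\<close> although \<open>s\<close> lies in
    \<open>n g\<close>.\<close>
  obtain s where s: "s \<in> n g" "\<And>b. b \<in> tail g \<Longrightarrow> s \<in> t b <# S (n b)"
    using ex[of "tail g"] P by blast
  have "\<chi>' a \<in> {f. 1/2 \<le> dist (f s) 1}" if a: "a \<in> tail g" for a
  proof -
    have "t a \<in> carrier G" using P[OF a] n mem_subset by (auto simp: P_def)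
    then have "\<chi>' a s = \<chi>' a (t a)" using annihilator_coset[OF S(1)[OF n] \<chi>S _ s(2)[OF a]] by blast
    then show ?thesis using P[OF a] by (simp add: P_def)
  qed
  moreover have "closed {f::'a \<Rightarrow> complex. 1/2 \<le> dist (f s) 1}"
    by (rule closed_Collect_le[OF continuous_on_const continuous_on_dist[OF cont continuous_on_const]])
  ultimately have "1/2 \<le> dist (\<psi> s) 1" using \<psi>_closed[OF g(1)] by blast
  then show False using \<psi>_ng[OF s(1)] by simp
qed

section \<open>Evaluation as a topological isomorphism\<close>

lemma evaluation_hom: "evaluation G T \<in> hom G (bidual_group G T)"
proof (rule homI)
  show "evaluation G T x \<in> carrier (bidual_group G T)" if "x \<in> carrier G" for x
    using evaluation_in_bidual[OF that] by (simp add: dual_group_def[of "dual_group G T"])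
  show "evaluation G T (x \<otimes> y) = evaluation G T x \<otimes>\<^bsub>bidual_group G T\<^esub> evaluation G T y"
    if "x \<in> carrier G" "y \<in> carrier G" for x y
    using that
    by (auto simp: evaluation_def dual_group_def[of "dual_group G T"] character_simps(2) fun_eq_iff)
qed

lemma bij_betw_evaluation:
  "bij_betw (evaluation G T) (carrier G) (characters (dual_group G T) (dual_topology G T))"
  unfolding bij_betw_def
proof (intro conjI inj_onI subset_antisym subsetI)
  fix x y assume x: "x \<in> carrier G" and y: "y \<in> carrier G" and eq: "evaluation G T x = evaluation G T y"
  show "x = y"
  proof (rule ccontr)
    assume "x \<noteq> y"
    then have "inv x \<otimes> y \<noteq> \<one>" using x y by (metis inv_equality inv_closed inv_inv)
    moreover have xy: "inv x \<otimes> y \<in> carrier G" using x y by simp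
    ultimately obtain N where N: "N \<in> \<N>" "inv x \<otimes> y \<notin> N" using separating by blast
    then obtain \<phi> where \<phi>: "\<phi> \<in> annihilator N" "\<phi> (inv x \<otimes> y) \<noteq> 1"
      using separated_by_annihilator[OF N(1) xy] by blast
    then have ch: "\<phi> \<in> characters G T" by (simp add: annihilator_def)
    have "\<phi> x = \<phi> y" using fun_cong[OF eq, of \<phi>] ch by (simp add: evaluation_def)
    then have "\<phi> (inv x \<otimes> y) = \<phi> (inv x \<otimes> x)"
      using character_simps(2)[OF ch inv_closed[OF x] y] character_simps(2)[OF ch inv_closed[OF x] x]
      by (simp only:)
    then show False using \<phi>(2) character_simps(3)[OF ch] x by simp
  qed
qed (use evaluation_in_bidual bidual_eq_evaluation in auto)

text \<open>Since a compact \<open>C\<close> lies in one annihilator, evaluations at points of the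
  same coset of that subgroup are equal on \<open>C\<close>, not merely close.\<close>

lemma continuous_map_evaluation: "continuous_map T (bidual_topology G T) (evaluation G T)"
  unfolding continuous_map_def
proof (intro conjI allI impI)
  show "evaluation G T \<in> topspace T \<rightarrow> topspace (bidual_topology G T)"
    using evaluation_in_bidual by (simp add: topspace)
  fix U assume U: "openin (bidual_topology G T) U"
  show "openin T {x \<in> topspace T. evaluation G T x \<in> U}"
    unfolding openin_iff
  proof (intro conjI ballI)
    fix x assume "x \<in> {x \<in> topspace T. evaluation G T x \<in> U}"
    then have x: "x \<in> carrier G" "evaluation G T x \<in> U" by (auto simp: topspace)
    then obtain C \<epsilon> where C: "compactin (dual_topology G T) C" "\<epsilon> > 0"
      and sub: "{\<Psi> \<in> characters (dual_group G T) (dual_topology G T).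
        \<forall>\<phi>\<in>C. dist (\<Psi> \<phi>) (evaluation G T x \<phi>) < \<epsilon>} \<subseteq> U"
      using U unfolding openin_dual_topology[of "dual_group G T"] by meson
    obtain N where N: "N \<in> \<N>" "C \<subseteq> annihilator N"
      using compact_subset_annihilator[of C] C(1)[unfolded compactin_dual_iff] by blast
    have "evaluation G T y \<in> U" if y: "y \<in> x <# N" for y
    proof -
      have yc: "y \<in> carrier G" using y coset_iff N(1) x(1) by blast
      have "evaluation G T y \<phi> = evaluation G T x \<phi>" if "\<phi> \<in> C" for \<phi>
        using annihilator_coset[OF N(1) _ x(1) y] that N(2) by (auto simp: evaluation_def)
      then show ?thesis using sub evaluation_in_bidual[OF yc] C(2) by auto
    qed
    then show "\<exists>N\<in>\<N>. x <# N \<subseteq> {x \<in> topspace T. evaluation G T x \<in> U}"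
      using N(1) coset_subset[OF N(1) x(1)] by (intro bexI[of _ N]) (auto simp: topspace)
  qed (auto simp: topspace)
qed

text \<open>The compact annihilator of \<open>N\<close> detects the coset of \<open>N\<close>: if
  two evaluations differ by less than 1 on it, their points are congruent modulo
  \<open>N\<close>.\<close>

lemma open_map_evaluation: "open_map T (bidual_topology G T) (evaluation G T)"
  unfolding open_map_def
proof (intro allI impI)
  fix W assume W: "openin T W"
  then have Wc: "W \<subseteq> carrier G" by (simp add: openin_iff)
  show "openin (bidual_topology G T) (evaluation G T ` W)"
    unfolding openin_dual_topology[of "dual_group G T"]
  proof (intro conjI ballI)
    show "evaluation G T ` W \<subseteq> characters (dual_group G T) (dual_topology G T)"
      using Wc evaluation_in_bidual by blast
    fix \<Phi> assume "\<Phi> \<in> evaluation G T ` W"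
    then obtain x where x: "x \<in> W" "\<Phi> = evaluation G T x" by blast
    then have xc: "x \<in> carrier G" using Wc by blast
    obtain N where N: "N \<in> \<N>" "x <# N \<subseteq> W" using W x(1) openin_iff by meson
    have "\<Psi> \<in> evaluation G T ` W"
      if \<Psi>: "\<Psi> \<in> characters (dual_group G T) (dual_topology G T)"
        "\<forall>\<phi>\<in>annihilator N. dist (\<Psi> \<phi>) (\<Phi> \<phi>) < 1" for \<Psi>
    proof -
      obtain y where y: "y \<in> carrier G" "\<Psi> = evaluation G T y"
        using bidual_eq_evaluation[OF \<Psi>(1)] by blast
      have "inv x \<otimes> y \<in> N"
      proof (rule ccontr)
        have xy: "inv x \<otimes> y \<in> carrier G" using xc y by simp
        assume "inv x \<otimes> y \<notin> N"
        then obtain \<phi> where \<phi>: "\<phi> \<in> annihilator N" "\<phi> (inv x \<otimes> y) \<noteq> 1"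
          using separated_by_annihilator[OF N(1) xy] by blast
        then have ch: "\<phi> \<in> characters G T" by (simp add: annihilator_def)
        obtain k where k: "1 \<le> dist (\<phi> (inv x \<otimes> y) ^ k) 1"
          using exists_power_far_from_one[OF character_simps(1)[OF ch xy] \<phi>(2)] by blast
        \<comment> \<open>Powers of a separating character remain in the annihilator and can push
          its value on \<open>inv x \<otimes> y\<close> to distance 1 from 1; hence the radius
          1.\<close>
        define \<phi>k where "\<phi>k = (\<lambda>z\<in>carrier G. \<phi> z ^ k)"
        have "\<phi>k \<in> hom G circle_group"
          by (rule homI) (simp_all add: \<phi>k_def norm_power character_simps(1,2)[OF ch] power_mult_distrib)
        moreover have triv: "\<forall>z\<in>N. \<phi>k z = 1"
          using \<phi>(1) mem_subset[OF N(1)] by (simp add: \<phi>k_def annihilator_def)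
        ultimately have "\<phi>k \<in> characters G T"
          unfolding character_iff using N(1)
          by (intro conjI bexI[of _ N]) (simp_all add: \<phi>k_def)
        then have \<phi>kN: "\<phi>k \<in> annihilator N" and \<phi>kc: "\<phi>k \<in> characters G T"
          using triv by (auto simp: annihilator_def)
        have eqk: "\<phi>k y = \<phi>k x * \<phi>k (inv x \<otimes> y)"
        proof -
          have "x \<otimes> (inv x \<otimes> y) = y" using xc y(1) by (simp add: m_assoc[symmetric])
          then show ?thesis using character_simps(2)[OF \<phi>kc xc xy] by simp
        qed
        have "dist (\<phi>k y) (\<phi>k x) = cmod (\<phi>k x * (\<phi>k (inv x \<otimes> y) - 1))"
          unfolding eqk by (simp add: dist_norm algebra_simps)
        also have "\<dots> = dist (\<phi> (inv x \<otimes> y) ^ k) 1"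
          using character_simps(1)[OF \<phi>kc xc] xy by (simp add: norm_mult dist_norm \<phi>k_def)
        finally have "1 \<le> dist (\<Psi> \<phi>k) (\<Phi> \<phi>k)" using k \<phi>kc x(2) y(2) by (simp add: evaluation_def)
        then show False using \<Psi>(2) \<phi>kN by force
      qed
      then have "y \<in> W" using coset_iff[OF N(1) xc] y(1) N(2) by blast
      then show ?thesis using y(2) by blast
    qed
    moreover have "compactin (dual_topology G T) (annihilator N)"
      using compact_annihilator[OF N(1)] by (auto simp: compactin_dual_iff annihilator_def)
    ultimately show "\<exists>K \<epsilon>. compactin (dual_topology G T) K \<and> \<epsilon> > 0 \<and>
        {\<Psi> \<in> characters (dual_group G T) (dual_topology G T). \<forall>\<phi>\<in>K. dist (\<Psi> \<phi>) (\<Phi> \<phi>) < \<epsilon>}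
          \<subseteq> evaluation G T ` W"
      by (intro exI[of _ "annihilator N"] exI[of _ "1::real"]) auto
  qed
qed

theorem reflexive: "reflexive_group G T"
  unfolding reflexive_group_def
proof (intro conjI topological_abelian_group)
  show "evaluation G T \<in> iso G (bidual_group G T)"
    using evaluation_hom bij_betw_evaluation by (simp add: iso_def dual_group_def[of "dual_group G T"])
  show "homeomorphic_map T (bidual_topology G T) (evaluation G T)"
    using bij_betw_evaluation
    by (intro bijective_open_imp_homeomorphic_map continuous_map_evaluation open_map_evaluation)
      (auto simp: bij_betw_def topspace)
qed

end

section \<open>Compact subgroups that are intersections of countably many open sets\<close>

lemma gdelta_in_continuous_preimage:
  assumes "continuous_map X Y f" "gdelta_in Y S"
  shows "gdelta_in X {x \<in> topspace X. f x \<in> S}"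
proof -
  obtain C where C: "\<And>n. openin Y (C n)" "\<And>n. C (Suc n) \<subseteq> C n" "\<Inter>(range C) = S"
    using assms(2) unfolding gdelta_in_descending by blast
  have "openin X {x \<in> topspace X. f x \<in> C n}" for n
    using assms(1) C(1) by (rule openin_continuous_map_preimage)
  moreover have "{x \<in> topspace X. f x \<in> S} = \<Inter>(range (\<lambda>n::nat. {x \<in> topspace X. f x \<in> C n}))"
    using C(3) by auto
  ultimately show ?thesis
    unfolding gdelta_in_descending using C(2)
    by (intro exI[of _ "\<lambda>n. {x \<in> topspace X. f x \<in> C n}"]) blast
qed

text \<open>One compact member is enough for the usual argument; without any, all members are the
  whole space.\<close>

lemma closedin_fip_compactin_or_topspace:
  assumes c: "\<And>c. c \<in> \<C> \<Longrightarrow> closedin X c \<and> (c = topspace X \<or> compactin X c)"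
    and fip: "\<And>\<F>. finite \<F> \<Longrightarrow> \<F> \<subseteq> \<C> \<Longrightarrow> \<Inter>\<F> \<noteq> {}"
    and ne: "topspace X \<noteq> {}"
  shows "topspace X \<inter> \<Inter>\<C> \<noteq> {}"
proof (cases "\<exists>c\<in>\<C>. compactin X c")
  case True
  then obtain c0 where c0: "c0 \<in> \<C>" "compactin X c0" by blast
  have "c0 \<inter> \<Inter>\<F> \<noteq> {}" if "finite \<F>" "\<F> \<subseteq> \<C>" for \<F>
    using fip[of "insert c0 \<F>"] that c0(1) by simp
  then have "c0 \<inter> \<Inter>\<C> \<noteq> {}"
    using c0(2) c unfolding compactin_fip by (metis (no_types, lifting))
  moreover have "c0 \<subseteq> topspace X" using c0(2) by (rule compactin_subset_topspace)
  ultimately show ?thesis by blast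
next
  case False
  then have "c = topspace X" if "c \<in> \<C>" for c using c that by blast
  then show ?thesis using ne by blast
qed

locale topological_abelian_group_loc = comm_group G for G (structure) +
  fixes T
  assumes topspace: "topspace T = carrier G"
    and continuous_mult: "continuous_map (prod_topology T T) T (\<lambda>(x, y). x \<otimes> y)"
    and continuous_inv: "continuous_map T T (\<lambda>x. inv x)"
    and Hausdorff: "Hausdorff_space T"
begin

lemma continuous_map_mult:
  "continuous_map X T f \<Longrightarrow> continuous_map X T g \<Longrightarrow> continuous_map X T (\<lambda>x. f x \<otimes> g x)"
  using continuous_map_compose[OF continuous_map_pairedI continuous_mult]
  by (simp add: o_def case_prod_unfold)

lemma continuous_map_inv: "continuous_map X T f \<Longrightarrow> continuous_map X T (\<lambda>x. inv (f x))"
  using continuous_map_compose[OF _ continuous_inv] by (simp add: o_def)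

lemma continuous_map_const': "a \<in> carrier G \<Longrightarrow> continuous_map X T (\<lambda>_. a)"
  by (simp add: topspace)

lemma openin_preimage:
  "continuous_map T T f \<Longrightarrow> openin T U \<Longrightarrow> openin T {x \<in> carrier G. f x \<in> U}"
  using openin_continuous_map_preimage[of T T f U] by (simp add: topspace)

section \<open>Admissible subgroups and their cosets\<close>

text \<open>The alternative \<open>N = carrier G\<close> describes the unrestricted factors of a
  box, where compactness cannot be expected.\<close>

definition admissible :: "'a set \<Rightarrow> bool"
  where "admissible N \<longleftrightarrow> subgroup N G \<and> gdelta_in T N \<and> (N = carrier G \<or> compactin T N)"

lemma admissible_closedin: "admissible N \<Longrightarrow> closedin T N"
  unfolding admissible_def using compactin_imp_closedin[OF Hausdorff] topspace closedin_topspace by metis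

lemma admissible_carrier: "admissible (carrier G)"
  unfolding admissible_def using subgroup_self topspace gdelta_in_topspace by metis

lemma admissible_Inter:
  assumes "countable \<D>" "\<D> \<noteq> {}" and D: "\<And>N. N \<in> \<D> \<Longrightarrow> admissible N"
  shows "admissible (\<Inter>\<D>)"
  unfolding admissible_def
proof (intro conjI)
  show "subgroup (\<Inter>\<D>) G"
    using assms by (intro subgroups_Inter) (auto simp: admissible_def)
  show "gdelta_in T (\<Inter>\<D>)"
    using assms by (intro gdelta_in_Inter) (auto simp: admissible_def)
  show "\<Inter>\<D> = carrier G \<or> compactin T (\<Inter>\<D>)"
  proof (cases "\<exists>N\<in>\<D>. compactin T N")
    case True
    then show ?thesis using closed_compactin_Inter D admissible_closedin by metis
  next
    case False
    then have "N = carrier G" if "N \<in> \<D>" for N using D[OF that] that by (auto simp: admissible_def)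
    then show ?thesis using \<open>\<D> \<noteq> {}\<close> by auto
  qed
qed

lemma exists_division_nbhd:
  assumes U: "openin T U" "\<one> \<in> U"
  shows "\<exists>V. openin T V \<and> \<one> \<in> V \<and> (\<forall>x\<in>V. \<forall>y\<in>V. x \<otimes> inv y \<in> U)"
proof -
  let ?P = "prod_topology T T"
  have "continuous_map ?P T (\<lambda>p. fst p \<otimes> inv (snd p))"
    by (intro continuous_map_mult continuous_map_inv continuous_map_fst continuous_map_snd)
  then have "openin ?P {p \<in> topspace ?P. fst p \<otimes> inv (snd p) \<in> U}"
    using U(1) by (rule openin_continuous_map_preimage)
  moreover have "(\<one>, \<one>) \<in> {p \<in> topspace ?P. fst p \<otimes> inv (snd p) \<in> U}"
    using U by (simp add: topspace)
  ultimately obtain A B where AB: "openin T A" "openin T B" "\<one> \<in> A" "\<one> \<in> B"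
    "A \<times> B \<subseteq> {p \<in> topspace ?P. fst p \<otimes> inv (snd p) \<in> U}"
    unfolding openin_prod_topology_alt by meson
  then show ?thesis by (intro exI[of _ "A \<inter> B"]) auto
qed

text \<open>The \<open>V n\<close> play the role of balls of geometrically shrinking radius around
  \<open>\<one>\<close>. Their intersection is a subgroup inside \<open>S\<close>, and the division
  property replaces the triangle inequality.\<close>

lemma exists_division_sequence:
  assumes S: "gdelta_in T S" "\<one> \<in> S"
  obtains V :: "nat \<Rightarrow> 'a set" where "\<And>n. openin T (V n)" "\<And>n. \<one> \<in> V n"
    "\<And>n x y. x \<in> V (Suc n) \<Longrightarrow> y \<in> V (Suc n) \<Longrightarrow> x \<otimes> inv y \<in> V n"
    "\<And>m n. m \<le> n \<Longrightarrow> V n \<subseteq> V m" "\<Inter>(range V) \<subseteq> S"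
proof -
  obtain C :: "nat \<Rightarrow> 'a set" where C: "\<And>n. openin T (C n)" "\<Inter>(range C) = S"
    using S(1) unfolding gdelta_in_descending by metis
  have C1: "\<one> \<in> C n" for n using C(2) S(2) by blast
  let ?P = "\<lambda>n V. openin T V \<and> \<one> \<in> V \<and> V \<subseteq> C n"
  have "\<exists>V. \<forall>n. ?P n (V n) \<and> (\<forall>x\<in>V (Suc n). \<forall>y\<in>V (Suc n). x \<otimes> inv y \<in> V n)"
  proof (rule dependent_nat_choice)
    show "\<exists>V. ?P 0 V" using C(1) C1 by blast
    fix V n assume "?P n V"
    then obtain W where "openin T W" "\<one> \<in> W" "\<forall>x\<in>W. \<forall>y\<in>W. x \<otimes> inv y \<in> V"
      using exists_division_nbhd[of V] by metis
    then show "\<exists>W. ?P (Suc n) W \<and> (\<forall>x\<in>W. \<forall>y\<in>W. x \<otimes> inv y \<in> V)"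
      using C(1) C1 by (intro exI[of _ "W \<inter> C (Suc n)"]) auto
  qed
  then obtain V where V': "\<forall>n. ?P n (V n) \<and> (\<forall>x\<in>V (Suc n). \<forall>y\<in>V (Suc n). x \<otimes> inv y \<in> V n)"
    by (rule exE)
  have V: "?P n (V n)" "x \<in> V (Suc n) \<Longrightarrow> y \<in> V (Suc n) \<Longrightarrow> x \<otimes> inv y \<in> V n" for n x y
    using spec[OF V', of n] by simp_all
  have "V (Suc n) \<subseteq> V n" for n
  proof
    fix x assume x: "x \<in> V (Suc n)"
    then have "x \<in> carrier G" using V(1) openin_subset topspace by blast
    then show "x \<in> V n" using V(2)[OF x, of \<one>] V(1) by simp
  qed
  then have "V n \<subseteq> V m" if "m \<le> n" for m n by (rule lift_Suc_antimono_le[OF _ that])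
  moreover have "\<Inter>(range V) \<subseteq> S" using V(1) C(2) by blast
  ultimately show ?thesis using that[of V] V by blast
qed

text \<open>The intersection of a division sequence is closed under quotients. It is also closed in
  the topology: if \<open>x\<close> misses \<open>V n\<close>, no \<open>y\<close> of the
  intersection has \<open>y \<otimes> inv x\<close> in \<open>V (Suc n)\<close>, because
  \<open>x\<close> is the quotient of \<open>y\<close> by \<open>y \<otimes> inv x\<close>.\<close>

lemma exists_closed_gdelta_subgroup:
  assumes "gdelta_in T S" "\<one> \<in> S"
  shows "\<exists>N. subgroup N G \<and> gdelta_in T N \<and> closedin T N \<and> N \<subseteq> S"
proof -
  obtain V where V: "\<And>n. openin T (V n)" "\<And>n. \<one> \<in> V n"
    "\<And>n x y. x \<in> V (Suc n) \<Longrightarrow> y \<in> V (Suc n) \<Longrightarrow> x \<otimes> inv y \<in> V n"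
    "\<And>m n. m \<le> n \<Longrightarrow> V n \<subseteq> V m" "\<Inter>(range V) \<subseteq> S"
    using exists_division_sequence[OF assms] by metis
  let ?N = "\<Inter>(range V)"
  have Vc: "V n \<subseteq> carrier G" for n using V(1) openin_subset topspace by blast
  have div: "x \<otimes> inv y \<in> ?N" if "x \<in> ?N" "y \<in> ?N" for x y using V(3) that by blast
  have one: "\<one> \<in> ?N" using V(2) by blast
  have sub: "?N \<subseteq> carrier G" using Vc by blast
  have inv: "inv x \<in> ?N" if "x \<in> ?N" for x using div[OF one that] that sub by auto
  have "subgroup ?N G"
  proof (rule subgroupI)
    show "x \<otimes> y \<in> ?N" if "x \<in> ?N" "y \<in> ?N" for x y
    proof -
      have "x \<otimes> inv (inv y) \<in> ?N" using div inv that by blast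
      moreover have "y \<in> carrier G" using that(2) sub by blast
      ultimately show ?thesis by simp
    qed
  qed (use sub one inv in blast)+
  moreover have "gdelta_in T ?N"
    using V(1,4) unfolding gdelta_in_descending by (intro exI[of _ V]) auto
  moreover have "closedin T ?N"
    unfolding closedin_def
  proof (intro conjI)
    show "?N \<subseteq> topspace T" using sub topspace by blast
    show "openin T (topspace T - ?N)"
      unfolding openin_subopen[of _ "topspace T - ?N"]
    proof
      fix x assume "x \<in> topspace T - ?N"
      then obtain n where x: "x \<in> carrier G" "x \<notin> V n" using topspace by auto
      let ?W = "{y \<in> carrier G. y \<otimes> inv x \<in> V (Suc n)}"
      have "openin T ?W"
        using x(1) V(1) by (intro openin_preimage continuous_map_mult continuous_map_const') auto
      moreover have "x \<in> ?W" using x V(2) by simp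
      moreover have "y \<notin> ?N" if y: "y \<in> ?W" for y
      proof
        assume "y \<in> ?N"
        then have "y \<otimes> inv (y \<otimes> inv x) \<in> V n" using V(3) y by blast
        moreover have "y \<otimes> inv (y \<otimes> inv x) = x"
          using x(1) y by (simp add: inv_mult m_ac(1)[symmetric])
        ultimately show False using x(2) by simp
      qed
      ultimately show "\<exists>W. openin T W \<and> x \<in> W \<and> W \<subseteq> topspace T - ?N"
        using topspace by (intro exI[of _ ?W]) auto
    qed
  qed
  ultimately show ?thesis using V(5) by blast
qed

lemma gdelta_in_translate:
  assumes "gdelta_in T S" "a \<in> carrier G"
  shows "gdelta_in T {x \<in> carrier G. a \<otimes> x \<in> S}"
proof -
  have "continuous_map T T (\<lambda>x. a \<otimes> x)"
    using assms(2) by (intro continuous_map_mult continuous_map_const') auto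
  from gdelta_in_continuous_preimage[OF this assms(1)] show ?thesis by (simp only: topspace)
qed

lemma coset_eq_preimage:
  assumes "N \<subseteq> carrier G" "x \<in> carrier G"
  shows "(x <# N) = {y \<in> carrier G. inv x \<otimes> y \<in> N}"
  using assms by (auto simp: l_coset_def m_assoc[symmetric] intro!: bexI[of _ "inv x \<otimes> y" for y])

lemma coset_carrier: "x \<in> carrier G \<Longrightarrow> (x <# carrier G) = carrier G"
  by (auto simp: coset_eq_preimage)

lemma gdelta_in_coset:
  assumes "admissible N" "x \<in> carrier G"
  shows "gdelta_in T (x <# N)"
proof -
  have "N \<subseteq> carrier G" using assms(1) subgroup.subset by (auto simp: admissible_def)
  then show ?thesis
    using gdelta_in_translate[of N "inv x"] assms by (simp add: coset_eq_preimage admissible_def)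
qed

lemma coset_closed_compact:
  assumes "admissible N" "x \<in> carrier G"
  shows "closedin T (x <# N) \<and> ((x <# N) = topspace T \<or> compactin T (x <# N))"
proof (cases "N = carrier G")
  case True
  then have "x <# N = topspace T" using assms(2) by (auto simp: coset_eq_preimage topspace)
  then show ?thesis by simp
next
  case False
  then have "compactin T N" using assms by (simp add: admissible_def)
  moreover have "continuous_map T T (\<lambda>y. x \<otimes> y)"
    using assms(2) by (intro continuous_map_mult continuous_map_const') auto
  ultimately have "compactin T ((\<lambda>y. x \<otimes> y) ` N)" by (rule image_compactin)
  also have "(\<lambda>y. x \<otimes> y) ` N = x <# N" by (auto simp: l_coset_def)
  finally show ?thesis using compactin_imp_closedin[OF Hausdorff] by blast
qed

lemma cosets_fip:
  assumes "\<And>c. c \<in> \<C> \<Longrightarrow> \<exists>x\<in>carrier G. \<exists>N. admissible N \<and> c = x <# N"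
    and "\<And>\<F>. finite \<F> \<Longrightarrow> \<F> \<subseteq> \<C> \<Longrightarrow> \<Inter>\<F> \<noteq> {}"
  shows "carrier G \<inter> \<Inter>\<C> \<noteq> {}"
proof -
  have "topspace T \<inter> \<Inter>\<C> \<noteq> {}"
  proof (rule closedin_fip_compactin_or_topspace)
    show "closedin T c \<and> (c = topspace T \<or> compactin T c)" if "c \<in> \<C>" for c
      using assms(1)[OF that] coset_closed_compact by blast
    show "topspace T \<noteq> {}" using topspace one_closed by auto
  qed (rule assms(2))
  then show ?thesis by (simp add: topspace)
qed

section \<open>Directed families of admissible subgroups\<close>

text \<open>If every member left \<open>W\<close>, the closed differences would have the finite
  intersection property inside a compact member, giving a point of the intersection outside
  \<open>W\<close>. With no compact member the family consists of the whole group.\<close>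

lemma directed_subset_open:
  assumes D: "\<D> \<noteq> {}" "\<And>N. N \<in> \<D> \<Longrightarrow> admissible N"
    and dir: "\<And>A B. A \<in> \<D> \<Longrightarrow> B \<in> \<D> \<Longrightarrow> \<exists>M\<in>\<D>. M \<subseteq> A \<inter> B"
    and W: "openin T W" "\<Inter>\<D> \<subseteq> W"
  shows "\<exists>M\<in>\<D>. M \<subseteq> W"
proof (rule ccontr)
  assume neg: "\<not> ?thesis"
  have below: "\<exists>M\<in>\<D>. M \<subseteq> \<Inter>\<F>" if "finite \<F>" "\<F> \<subseteq> \<D>" for \<F>
    using that
  proof (induction \<F> rule: finite_induct)
    case empty
    then show ?case using D(1) by auto
  next
    case (insert A \<F>)
    then obtain B M where "B \<in> \<D>" "B \<subseteq> \<Inter>\<F>" "M \<in> \<D>" "M \<subseteq> A \<inter> B" using dir by (metis insert_subset)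
    then show ?case by (intro bexI[of _ M]) auto
  qed
  show False
  proof (cases "\<exists>N\<in>\<D>. compactin T N")
    case True
    then obtain M0 where M0: "M0 \<in> \<D>" "compactin T M0" by blast
    have "M0 \<inter> \<Inter>((\<lambda>M. M - W) ` \<D>) \<noteq> {}"
    proof (rule M0(2)[unfolded compactin_fip, THEN conjunct2, rule_format], intro conjI ballI allI impI)
      show "closedin T c" if "c \<in> (\<lambda>M. M - W) ` \<D>" for c
        using that D(2) admissible_closedin W(1) by (auto intro: closedin_diff)
      fix \<F> assume F: "finite \<F> \<and> \<F> \<subseteq> (\<lambda>M. M - W) ` \<D>"
      then obtain \<F>' where F': "\<F>' \<subseteq> \<D>" "finite \<F>'" "\<F> = (\<lambda>M. M - W) ` \<F>'"
        by (meson finite_subset_image)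
      obtain M where M: "M \<in> \<D>" "M \<subseteq> \<Inter>(insert M0 \<F>')"
        using below[of "insert M0 \<F>'"] F' M0(1) by blast
      then obtain z where "z \<in> M" "z \<notin> W" using neg by blast
      then have "z \<in> M0 \<inter> \<Inter>\<F>" using M(2) F'(3) by auto
      then show "M0 \<inter> \<Inter>\<F> \<noteq> {}" by blast
    qed
    then obtain z where "z \<in> \<Inter>\<D>" "z \<notin> W" using M0(1) by blast
    then show False using W(2) by blast
  next
    case False
    then have all: "N = carrier G" if "N \<in> \<D>" for N using D(2) that by (auto simp: admissible_def)
    then have "\<Inter>\<D> = carrier G" using D(1) by auto
    then show False using neg all D(1) W(2) by blast
  qed
qed

text \<open>For each \<open>n\<close> some member lies in the \<open>V n\<close>-neighbourhood of
  \<open>\<Inter>\<D>\<close>. A point of all these members is thus approximable from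
  \<open>\<Inter>\<D>\<close> at every level, and compactness turns the approximations into one
  \<open>d\<close>. A sequence is used because the G_delta set \<open>S\<close> contains the
  intersection of the \<open>V n\<close>, but possibly none of them.\<close>

lemma directed_absorbing:
  assumes D: "\<D> \<noteq> {}" "\<And>N. N \<in> \<D> \<Longrightarrow> admissible N"
    and dir: "\<And>A B. A \<in> \<D> \<Longrightarrow> B \<in> \<D> \<Longrightarrow> \<exists>M\<in>\<D>. M \<subseteq> A \<inter> B"
    and S: "gdelta_in T S" "\<one> \<in> S"
  shows "\<exists>M::nat \<Rightarrow> 'a set. range M \<subseteq> \<D> \<and> (\<forall>y\<in>\<Inter>(range M). \<exists>d\<in>\<Inter>\<D>. y \<otimes> inv d \<in> S)"
proof -
  obtain V where V: "\<And>n. openin T (V n)" "\<And>n. \<one> \<in> V n"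
    "\<And>n x y. x \<in> V (Suc n) \<Longrightarrow> y \<in> V (Suc n) \<Longrightarrow> x \<otimes> inv y \<in> V n"
    "\<And>m n. m \<le> n \<Longrightarrow> V n \<subseteq> V m" "\<Inter>(range V) \<subseteq> S"
    using exists_division_sequence[OF S] by metis
  have Dc: "N \<subseteq> carrier G" and D1: "\<one> \<in> N" if "N \<in> \<D>" for N
    using D(2)[OF that] subgroup.subset subgroup.one_closed by (auto simp: admissible_def)
  have DDc: "\<Inter>\<D> \<subseteq> carrier G" using D(1) Dc by blast
  have "\<exists>M\<in>\<D>. M \<subseteq> (\<Union>d\<in>\<Inter>\<D>. {x \<in> carrier G. x \<otimes> inv d \<in> V n})" for n
  proof (rule directed_subset_open[OF D dir])
    show "openin T (\<Union>d\<in>\<Inter>\<D>. {x \<in> carrier G. x \<otimes> inv d \<in> V n})"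
    proof (intro openin_Union ballI, elim imageE, clarify)
      fix d assume "d \<in> \<Inter>\<D>"
      then have "d \<in> carrier G" using DDc by blast
      then show "openin T {x \<in> carrier G. x \<otimes> inv d \<in> V n}"
        using V(1) by (intro openin_preimage continuous_map_mult continuous_map_const') auto
    qed
    show "\<Inter>\<D> \<subseteq> (\<Union>d\<in>\<Inter>\<D>. {x \<in> carrier G. x \<otimes> inv d \<in> V n})"
    proof
      fix d assume d: "d \<in> \<Inter>\<D>"
      then have "d \<in> {x \<in> carrier G. x \<otimes> inv d \<in> V n}" using DDc V(2) by auto
      with d show "d \<in> (\<Union>d\<in>\<Inter>\<D>. {x \<in> carrier G. x \<otimes> inv d \<in> V n})" by blast
    qed
  qed
  then have "\<forall>n. \<exists>M. M \<in> \<D> \<and> M \<subseteq> (\<Union>d\<in>\<Inter>\<D>. {x \<in> carrier G. x \<otimes> inv d \<in> V n})" by blast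
  from choice[OF this] obtain M
    where M: "\<And>n. M n \<in> \<D>" "\<And>n. M n \<subseteq> (\<Union>d\<in>\<Inter>\<D>. {x \<in> carrier G. x \<otimes> inv d \<in> V n})"
    by blast
  have "\<exists>d\<in>\<Inter>\<D>. y \<otimes> inv d \<in> S" if y: "y \<in> \<Inter>(range M)" for y
  proof (cases "\<exists>N\<in>\<D>. compactin T N")
    case True
    have yc: "y \<in> carrier G" using y M(1) Dc by blast
    have comp: "compactin T (\<Inter>\<D>)"
      using True closed_compactin_Inter D(2) admissible_closedin by metis
    let ?A = "\<lambda>n. {d \<in> \<Inter>\<D>. y \<otimes> inv d \<in> V n}"
    have A: "?A n \<noteq> {}" for n using y M(2)[of n] by blast
    \<comment> \<open>The sets of admissible approximations decrease with \<open>n\<close>, so their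
      closures have the finite intersection property in the compact group
      \<open>\<Inter>\<D>\<close>.\<close>
    have "\<Inter>\<D> \<inter> \<Inter>(range (\<lambda>n. T closure_of ?A n)) \<noteq> {}"
    proof (rule comp[unfolded compactin_fip, THEN conjunct2, rule_format], intro conjI ballI allI impI)
      show "closedin T c" if "c \<in> range (\<lambda>n. T closure_of ?A n)" for c using that by auto
      fix \<F> assume F: "finite \<F> \<and> \<F> \<subseteq> range (\<lambda>n. T closure_of ?A n)"
      then obtain F' where F': "finite F'" "\<F> = (\<lambda>n. T closure_of ?A n) ` F'"
        by (meson finite_subset_image)
      define m where "m = Max F'"
      have m: "n \<le> m" if "n \<in> F'" for n using F'(1) that by (simp add: m_def)
      obtain d where d: "d \<in> ?A m" using A by blast
      have "d \<in> T closure_of ?A n" if "n \<in> F'" for n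
      proof -
        have "?A m \<subseteq> ?A n" using V(4)[OF m[OF that]] by blast
        moreover have "?A n \<subseteq> T closure_of ?A n"
          by (rule closure_of_subset) (use DDc topspace in blast)
        ultimately show ?thesis using d by blast
      qed
      then show "\<Inter>\<D> \<inter> \<Inter>\<F> \<noteq> {}" using d F'(2) by blast
    qed
    then obtain d where d: "d \<in> \<Inter>\<D>" "\<And>n. d \<in> T closure_of ?A n" by blast
    have dc: "d \<in> carrier G" using d(1) DDc by blast
    have "y \<otimes> inv d \<in> V n" for n
    proof -
      \<comment> \<open>Closures are removed at the cost of one level: near \<open>d\<close> there
        is an \<open>e\<close> with both \<open>y \<otimes> inv e\<close> and
        \<open>d \<otimes> inv e\<close> in \<open>V (Suc n)\<close>, and their quotient is
        \<open>y \<otimes> inv d\<close>.\<close>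
      let ?W = "{e \<in> carrier G. d \<otimes> inv e \<in> V (Suc n)}"
      have "openin T ?W"
        using dc V(1)
        by (intro openin_preimage continuous_map_mult continuous_map_inv continuous_map_const') auto
      moreover have "d \<in> ?W" using dc V(2) by simp
      ultimately obtain e where e: "e \<in> ?A (Suc n)" "e \<in> ?W"
        using d(2)[of "Suc n"] unfolding in_closure_of by meson
      then have "(y \<otimes> inv e) \<otimes> inv (d \<otimes> inv e) \<in> V n" using V(3) by blast
      also have "(y \<otimes> inv e) \<otimes> inv (d \<otimes> inv e) = y \<otimes> inv d"
      proof -
        have ec: "e \<in> carrier G" using e(2) by blast
        have "inv (d \<otimes> inv e) = e \<otimes> inv d" using dc ec by (simp add: inv_mult_group)
        moreover have "inv e \<otimes> (e \<otimes> inv d) = inv d" using dc ec by (simp add: m_assoc[symmetric])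
        ultimately show ?thesis using yc dc ec by (simp add: m_assoc)
      qed
      finally show ?thesis .
    qed
    then have "y \<otimes> inv d \<in> S" using V(5) by blast
    with d(1) show ?thesis by blast
  next
    case False
    then have all: "N = carrier G" if "N \<in> \<D>" for N using D(2) that by (auto simp: admissible_def)
    then have eq: "\<Inter>\<D> = carrier G" using D(1) by auto
    have "y \<in> carrier G" using y M(1) Dc by blast
    then show ?thesis unfolding eq using S(2) by (intro bexI[of _ y]) auto
  qed
  then show ?thesis using M(1) by (intro exI[of _ M]) blast
qed

end

section \<open>Pseudo-feathered groups\<close>

locale pseudo_feathered_group = topological_abelian_group_loc +
  assumes feathered: "\<exists>K. K \<noteq> {} \<and> compactin T K \<and> gdelta_in T K"
begin

text \<open>The compact G_delta set \<open>K\<close> is translated to contain \<open>\<one>\<close>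
  and intersected with the translated \<open>S\<close>. A closed G_delta subgroup inside is compact,
  being a closed subset of a translate of \<open>K\<close>.\<close>

lemma exists_admissible_in_gdelta:
  assumes S: "gdelta_in T S" "a \<in> S"
  shows "\<exists>N. admissible N \<and> a <# N \<subseteq> S"
proof -
  obtain K k where K: "k \<in> K" "compactin T K" "gdelta_in T K" using feathered by blast
  have k: "k \<in> carrier G" and a: "a \<in> carrier G"
    using K S gdelta_in_subset topspace by blast+
  let ?S = "{x \<in> carrier G. a \<otimes> x \<in> S} \<inter> {x \<in> carrier G. k \<otimes> x \<in> K}"
  have "gdelta_in T ?S" using S K k a by (intro gdelta_in_Int gdelta_in_translate) auto
  moreover have "\<one> \<in> ?S" using S K k a by simp
  ultimately obtain N where N: "subgroup N G" "gdelta_in T N" "closedin T N" "N \<subseteq> ?S"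
    using exists_closed_gdelta_subgroup by blast
  have "continuous_map T T (\<lambda>x. inv k \<otimes> x)"
    using k by (intro continuous_map_mult continuous_map_const') auto
  with K(2) have "compactin T ((\<lambda>x. inv k \<otimes> x) ` K)" by (rule image_compactin)
  moreover have "N \<subseteq> (\<lambda>x. inv k \<otimes> x) ` K"
  proof
    fix x assume "x \<in> N"
    then have "x \<in> carrier G" "k \<otimes> x \<in> K" using N(4) by auto
    then show "x \<in> (\<lambda>x. inv k \<otimes> x) ` K"
      using k by (intro image_eqI[of _ _ "k \<otimes> x"]) (simp_all add: m_assoc[symmetric])
  qed
  ultimately have "compactin T N" using N(3) by (rule closed_compactin)
  moreover have "a <# N \<subseteq> S" using N(4) by (auto simp: l_coset_def)
  ultimately show ?thesis using N unfolding admissible_def by blast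
qed

end

section \<open>Products\<close>

lemma topological_abelian_group_locI:
  assumes "topological_abelian_group G T"
  shows "topological_abelian_group_loc G T"
proof -
  interpret comm_group G using assms by (simp add: topological_abelian_group_def)
  show ?thesis
    by unfold_locales (use assms in \<open>auto simp: topological_abelian_group_def topological_group_def\<close>)
qed

lemma pseudo_feathered_groupI:
  assumes "topological_abelian_group G T" "pseudo_feathered G T"
  shows "pseudo_feathered_group G T"
proof -
  interpret topological_abelian_group_loc G T using assms(1) by (rule topological_abelian_group_locI)
  show ?thesis
    by unfold_locales (use assms(2) in \<open>auto simp: pseudo_feathered_def\<close>)
qed

section \<open>Boxes as a base of the P-modified product\<close>

locale pseudo_feathered_family =
  fixes I :: "'i set" and H :: "'i \<Rightarrow> ('a, 'b) monoid_scheme" and T :: "'i \<Rightarrow> 'a topology"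
  assumes feathered: "i \<in> I \<Longrightarrow> pseudo_feathered_group (H i) (T i)"
begin

abbreviation adm where "adm i \<equiv> topological_abelian_group_loc.admissible (H i) (T i)"

text \<open>Countably many restricted coordinates, rather than finitely many as in the Tychonoff
  topology, make the family closed under countable intersections and fine enough for G_delta
  sets.\<close>

definition boxes :: "('i \<Rightarrow> 'a) set set"
  where "boxes = {PiE I N | N. (\<forall>i\<in>I. adm i (N i)) \<and> countable {i \<in> I. N i \<noteq> carrier (H i)}}"

lemma loc: "i \<in> I \<Longrightarrow> topological_abelian_group_loc (H i) (T i)"
  using feathered pseudo_feathered_group.axioms(1) by blast

lemma comm: "i \<in> I \<Longrightarrow> comm_group (H i)"
  using loc topological_abelian_group_loc.axioms(1) by blast

lemma group: "i \<in> I \<Longrightarrow> group (H i)"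
  using comm comm_group.axioms(2) by blast

lemma topspace_factor: "i \<in> I \<Longrightarrow> topspace (T i) = carrier (H i)"
  using loc topological_abelian_group_loc.topspace by blast

lemma adm_subset: "i \<in> I \<Longrightarrow> adm i N \<Longrightarrow> N \<subseteq> carrier (H i)"
  using topological_abelian_group_loc.admissible_def[OF loc] subgroup.subset by blast

lemma adm_one: "i \<in> I \<Longrightarrow> adm i N \<Longrightarrow> \<one>\<^bsub>H i\<^esub> \<in> N"
  using topological_abelian_group_loc.admissible_def[OF loc] subgroup.one_closed by blast

lemma boxI:
  "(\<And>i. i \<in> I \<Longrightarrow> adm i (N i)) \<Longrightarrow> countable {i \<in> I. N i \<noteq> carrier (H i)} \<Longrightarrow> PiE I N \<in> boxes"
  unfolding boxes_def by blast

lemma box_subset_iff: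
  assumes "\<And>i. i \<in> I \<Longrightarrow> adm i (M i)"
  shows "PiE I M \<subseteq> PiE I N \<longleftrightarrow> (\<forall>i\<in>I. M i \<subseteq> N i)"
proof -
  have "PiE I M \<noteq> {}" unfolding PiE_eq_empty_iff using adm_one[OF _ assms] by blast
  then show ?thesis by (simp add: subset_PiE)
qed

lemma comm_product: "comm_group (product_group I H)"
proof -
  interpret group "product_group I H" using group by (rule product_group)
  show ?thesis
    by (rule group_comm_groupI) (auto simp: PiE_iff intro!: restrict_ext comm_monoid.m_comm
        comm_group.axioms(1)[OF comm])
qed

lemma coset_box:
  assumes x: "x \<in> carrier (product_group I H)" and N: "\<And>i. i \<in> I \<Longrightarrow> adm i (N i)"
  shows "(x <#\<^bsub>product_group I H\<^esub> PiE I N) = (\<Pi>\<^sub>E i\<in>I. x i <#\<^bsub>H i\<^esub> N i)"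
proof (intro subset_antisym subsetI)
  fix y assume "y \<in> x <#\<^bsub>product_group I H\<^esub> PiE I N"
  then show "y \<in> (\<Pi>\<^sub>E i\<in>I. x i <#\<^bsub>H i\<^esub> N i)"
    by (auto simp: l_coset_def PiE_iff)
next
  fix y assume y: "y \<in> (\<Pi>\<^sub>E i\<in>I. x i <#\<^bsub>H i\<^esub> N i)"
  then have "\<forall>i\<in>I. \<exists>h. h \<in> N i \<and> y i = x i \<otimes>\<^bsub>H i\<^esub> h"
    by (auto simp: l_coset_def PiE_iff)
  from bchoice[OF this] obtain h where h: "\<forall>i\<in>I. h i \<in> N i \<and> y i = x i \<otimes>\<^bsub>H i\<^esub> h i" by blast
  have "restrict h I \<in> PiE I N" using h by auto
  moreover have "y = x \<otimes>\<^bsub>product_group I H\<^esub> restrict h I"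
    using h y by (auto simp: PiE_iff extensional_def fun_eq_iff)
  ultimately show "y \<in> x <#\<^bsub>product_group I H\<^esub> PiE I N" unfolding l_coset_def by blast
qed

text \<open>Only the countably many restricted coordinates impose a condition, and each one is the
  preimage of a G_delta coset under a projection.\<close>

lemma gdelta_in_coset_box:
  assumes x: "x \<in> carrier (product_group I H)" and N: "\<And>i. i \<in> I \<Longrightarrow> adm i (N i)"
    and count: "countable {i \<in> I. N i \<noteq> carrier (H i)}"
  shows "gdelta_in (product_topology T I) (x <#\<^bsub>product_group I H\<^esub> PiE I N)"
proof -
  let ?X = "product_topology T I"
  let ?J = "{i \<in> I. N i \<noteq> carrier (H i)}"
  let ?B = "\<lambda>i. {f \<in> topspace ?X. f i \<in> x i <#\<^bsub>H i\<^esub> N i}"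
  have xi: "x i \<in> carrier (H i)" if "i \<in> I" for i using x that by auto
  have sub: "(x i <#\<^bsub>H i\<^esub> N i) \<subseteq> carrier (H i)" if "i \<in> I" for i
    using topological_abelian_group_loc.coset_eq_preimage[OF loc[OF that] adm_subset[OF that N[OF that]]
        xi[OF that]] by blast
  have triv: "(x i <#\<^bsub>H i\<^esub> N i) = carrier (H i)" if "i \<in> I - ?J" for i
  proof -
    have i: "i \<in> I" and eq: "N i = carrier (H i)" using that by auto
    show ?thesis
      unfolding eq by (rule topological_abelian_group_loc.coset_carrier[OF loc[OF i] xi[OF i]])
  qed
  have "gdelta_in ?X (\<Inter>(insert (topspace ?X) (?B ` ?J)))"
  proof (rule gdelta_in_Inter)
    fix S assume "S \<in> insert (topspace ?X) (?B ` ?J)"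
    then consider "S = topspace ?X" | i where "i \<in> I" "S = ?B i" by blast
    then show "gdelta_in ?X S"
    proof cases
      case 1
      then show ?thesis using gdelta_in_topspace by blast
    next
      case 2
      have "gdelta_in (T i) (x i <#\<^bsub>H i\<^esub> N i)"
        by (rule topological_abelian_group_loc.gdelta_in_coset[OF loc[OF 2(1)] N[OF 2(1)] xi[OF 2(1)]])
      moreover have "continuous_map ?X (T i) (\<lambda>f. f i)"
        by (rule continuous_map_product_projection[OF 2(1)])
      ultimately show ?thesis
        unfolding 2(2) by (intro gdelta_in_continuous_preimage)
    qed
  qed (use count in auto)
  also have "\<Inter>(insert (topspace ?X) (?B ` ?J)) = (\<Pi>\<^sub>E i\<in>I. x i <#\<^bsub>H i\<^esub> N i)"
  proof (intro subset_antisym subsetI)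
    fix f assume f: "f \<in> \<Inter>(insert (topspace ?X) (?B ` ?J))"
    then have ft: "f \<in> (\<Pi>\<^sub>E i\<in>I. topspace (T i))" by simp
    have "f i \<in> x i <#\<^bsub>H i\<^esub> N i" if i: "i \<in> I" for i
    proof (cases "i \<in> ?J")
      case True
      then show ?thesis using f by blast
    next
      case False
      then show ?thesis using triv[of i] i ft topspace_factor[OF i] by (auto simp: PiE_iff)
    qed
    then show "f \<in> (\<Pi>\<^sub>E i\<in>I. x i <#\<^bsub>H i\<^esub> N i)" using ft by (auto simp: PiE_iff)
  next
    fix f assume "f \<in> (\<Pi>\<^sub>E i\<in>I. x i <#\<^bsub>H i\<^esub> N i)"
    then show "f \<in> \<Inter>(insert (topspace ?X) (?B ` ?J))"
      using sub topspace_factor by (fastforce simp: PiE_iff)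
  qed
  also have "\<dots> = (x <#\<^bsub>product_group I H\<^esub> PiE I N)"
    by (rule coset_box[OF x, symmetric]) (rule N)
  finally show ?thesis .
qed

text \<open>Each of the countably many open sets restricts finitely many coordinates near
  \<open>x\<close>, so altogether countably many are restricted. In each of these the restrictions
  intersect to a G_delta set, which contains a coset of an admissible subgroup.\<close>

lemma exists_coset_box_in_gdelta:
  assumes S: "gdelta_in (product_topology T I) S" and x: "x \<in> S"
  shows "\<exists>N\<in>boxes. (x <#\<^bsub>product_group I H\<^esub> N) \<subseteq> S"
proof -
  obtain C :: "nat \<Rightarrow> _" where C: "\<And>n. openin (product_topology T I) (C n)" "\<Inter>(range C) = S"
    using S unfolding gdelta_in_descending by metis
  have xc: "x \<in> carrier (product_group I H)"
    using gdelta_in_subset[OF S] x topspace_factor by (auto simp: PiE_iff)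
  have "\<forall>n. \<exists>U. finite {i \<in> I. U i \<noteq> topspace (T i)} \<and> (\<forall>i\<in>I. openin (T i) (U i)) \<and> x \<in> PiE I U \<and>
      PiE I U \<subseteq> C n"
    using C x unfolding openin_product_topology_alt by blast
  from choice[OF this] obtain U where U: "\<And>n. finite {i \<in> I. U n i \<noteq> topspace (T i)}"
    "\<And>n i. i \<in> I \<Longrightarrow> openin (T i) (U n i)" "\<And>n. x \<in> PiE I (U n)" "\<And>n. PiE I (U n) \<subseteq> C n"
    by blast
  let ?J = "\<Union>n. {i \<in> I. U n i \<noteq> topspace (T i)}"
  have "\<exists>N. adm i N \<and> (x i <#\<^bsub>H i\<^esub> N) \<subseteq> (\<Inter>n. U n i) \<and> (i \<notin> ?J \<longrightarrow> N = carrier (H i))"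
    if i: "i \<in> I" for i
  proof (cases "i \<in> ?J")
    case True
    have "gdelta_in (T i) (\<Inter>(range (\<lambda>n. U n i)))"
      using U(2)[OF i] by (intro gdelta_in_Inter) (auto intro: open_imp_gdelta_in)
    moreover have "x i \<in> \<Inter>(range (\<lambda>n. U n i))" using U(3) i by (auto simp: PiE_iff)
    ultimately obtain N where "adm i N" "(x i <#\<^bsub>H i\<^esub> N) \<subseteq> (\<Inter>n. U n i)"
      using pseudo_feathered_group.exists_admissible_in_gdelta[OF feathered[OF i]] by metis
    then show ?thesis using True by (intro exI[of _ N]) simp
  next
    case False
    then have "U n i = carrier (H i)" for n using i topspace_factor[OF i] by auto
    moreover have "(x i <#\<^bsub>H i\<^esub> carrier (H i)) = carrier (H i)"
      using xc i by (intro topological_abelian_group_loc.coset_carrier[OF loc[OF i]]) auto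
    ultimately show ?thesis
      using topological_abelian_group_loc.admissible_carrier[OF loc[OF i]]
      by (intro exI[of _ "carrier (H i)"]) auto
  qed
  then have "\<forall>i\<in>I. \<exists>N. adm i N \<and> (x i <#\<^bsub>H i\<^esub> N) \<subseteq> (\<Inter>n. U n i) \<and> (i \<notin> ?J \<longrightarrow> N = carrier (H i))"
    by blast
  from bchoice[OF this] obtain N where N': "\<forall>i\<in>I. adm i (N i) \<and>
      (x i <#\<^bsub>H i\<^esub> N i) \<subseteq> (\<Inter>n. U n i) \<and> (i \<notin> ?J \<longrightarrow> N i = carrier (H i))" by (rule exE)
  have N: "adm i (N i)" "(x i <#\<^bsub>H i\<^esub> N i) \<subseteq> (\<Inter>n. U n i)" "i \<notin> ?J \<Longrightarrow> N i = carrier (H i)"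
    if "i \<in> I" for i
    using bspec[OF N' that] by simp_all
  have "countable ?J" using U(1) by (intro countable_UN) (auto intro: countable_finite)
  then have "countable {i \<in> I. N i \<noteq> carrier (H i)}"
    by (rule countable_subset[rotated]) (use N(3) in blast)
  with N(1) have "PiE I N \<in> boxes" by (intro boxI)
  moreover have "(x <#\<^bsub>product_group I H\<^esub> PiE I N) \<subseteq> S"
  proof -
    have "(\<Pi>\<^sub>E i\<in>I. x i <#\<^bsub>H i\<^esub> N i) \<subseteq> PiE I (U n)" for n
      using N(2) by (intro PiE_mono) blast
    then have "(\<Pi>\<^sub>E i\<in>I. x i <#\<^bsub>H i\<^esub> N i) \<subseteq> S" using U(4) C(2) by blast
    moreover have "(x <#\<^bsub>product_group I H\<^esub> PiE I N) = (\<Pi>\<^sub>E i\<in>I. x i <#\<^bsub>H i\<^esub> N i)"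
      by (rule coset_box[OF xc]) (rule N(1))
    ultimately show ?thesis by (simp only:)
  qed
  ultimately show ?thesis by blast
qed

lemma topspace_product: "topspace (product_topology T I) = carrier (product_group I H)"
  using topspace_factor by (simp cong: PiE_cong)

lemma openin_P_modification_product:
  "openin (P_modification (product_topology T I)) U \<longleftrightarrow>
    U \<subseteq> carrier (product_group I H) \<and>
      (\<forall>x\<in>U. \<exists>N\<in>boxes. (x <#\<^bsub>product_group I H\<^esub> N) \<subseteq> U)"
  unfolding openin_P_modification arbitrary_union_of_alt
proof (intro iffI conjI ballI)
  assume U: "\<forall>x\<in>U. \<exists>S. gdelta_in (product_topology T I) S \<and> x \<in> S \<and> S \<subseteq> U"
  then show "U \<subseteq> carrier (product_group I H)" using gdelta_in_subset topspace_product by blast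
  fix x assume "x \<in> U"
  then obtain S where S: "gdelta_in (product_topology T I) S" "x \<in> S" "S \<subseteq> U" using U by blast
  then show "\<exists>N\<in>boxes. (x <#\<^bsub>product_group I H\<^esub> N) \<subseteq> U" using exists_coset_box_in_gdelta by blast
next
  fix x assume U: "U \<subseteq> carrier (product_group I H) \<and> (\<forall>x\<in>U. \<exists>N\<in>boxes. (x <#\<^bsub>product_group I H\<^esub> N) \<subseteq> U)" and x: "x \<in> U"
  then obtain N where N: "\<forall>i\<in>I. adm i (N i)" "countable {i \<in> I. N i \<noteq> carrier (H i)}"
    "(x <#\<^bsub>product_group I H\<^esub> PiE I N) \<subseteq> U" unfolding boxes_def by blast
  have xc: "x \<in> carrier (product_group I H)" using U x by blast
  have "\<one>\<^bsub>product_group I H\<^esub> \<in> PiE I N" using N(1) adm_one by auto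
  then have "x \<otimes>\<^bsub>product_group I H\<^esub> \<one>\<^bsub>product_group I H\<^esub> \<in> x <#\<^bsub>product_group I H\<^esub> PiE I N" unfolding l_coset_def by blast
  then have "x \<in> x <#\<^bsub>product_group I H\<^esub> PiE I N" using monoid.r_one[OF group.is_monoid[OF comm_group.axioms(2)[OF comm_product]] xc] by simp
  then show "\<exists>S. gdelta_in (product_topology T I) S \<and> x \<in> S \<and> S \<subseteq> U"
    using gdelta_in_coset_box[OF xc _ N(2)] N(1,3) by blast
qed

lemma subgroup_box:
  assumes "N \<in> boxes"
  shows "subgroup N (product_group I H)"
proof -
  obtain M where M: "N = PiE I M" "\<forall>i\<in>I. adm i (M i)" using assms boxes_def by auto
  then have "\<forall>i\<in>I. subgroup (M i) (H i)"
    using topological_abelian_group_loc.admissible_def[OF loc] by blast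
  then show ?thesis unfolding M(1) by (simp add: PiE_subgroup_product_group group)
qed

lemma carrier_in_boxes: "carrier (product_group I H) \<in> boxes"
  unfolding carrier_product_group
  by (rule boxI) (use topological_abelian_group_loc.admissible_carrier[OF loc] in auto)

lemma Inter_in_boxes:
  assumes D: "countable \<D>" "\<D> \<noteq> {}" "\<D> \<subseteq> boxes"
  shows "\<Inter>\<D> \<in> boxes"
proof -
  have "\<forall>D\<in>\<D>. \<exists>N. D = PiE I N \<and> (\<forall>i\<in>I. adm i (N i)) \<and> countable {i \<in> I. N i \<noteq> carrier (H i)}"
    using D(3) unfolding boxes_def by blast
  from bchoice[OF this] obtain N where N': "\<forall>D\<in>\<D>. D = PiE I (N D) \<and>
      (\<forall>i\<in>I. adm i (N D i)) \<and> countable {i \<in> I. N D i \<noteq> carrier (H i)}" by (rule exE)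
  have N: "D = PiE I (N D)" "\<forall>i\<in>I. adm i (N D i)" "countable {i \<in> I. N D i \<noteq> carrier (H i)}"
    if "D \<in> \<D>" for D
    by (rule bspec[OF N' that, THEN conjunct1], rule bspec[OF N' that, THEN conjunct2, THEN conjunct1],
        rule bspec[OF N' that, THEN conjunct2, THEN conjunct2])
  have "\<Inter>\<D> = (\<Pi>\<^sub>E i\<in>I. \<Inter>D\<in>\<D>. N D i)"
  proof (intro subset_antisym subsetI)
    fix f assume f: "f \<in> \<Inter>\<D>"
    then have "f \<in> PiE I (N D)" if "D \<in> \<D>" for D using N(1)[OF that] that by blast
    then show "f \<in> (\<Pi>\<^sub>E i\<in>I. \<Inter>D\<in>\<D>. N D i)" using D(2) by (auto simp: PiE_iff)
  next
    fix f assume "f \<in> (\<Pi>\<^sub>E i\<in>I. \<Inter>D\<in>\<D>. N D i)"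
    then have "f \<in> PiE I (N D)" if "D \<in> \<D>" for D using that by (auto simp: PiE_iff)
    then show "f \<in> \<Inter>\<D>" using N(1) by blast
  qed
  moreover have "(\<Pi>\<^sub>E i\<in>I. \<Inter>D\<in>\<D>. N D i) \<in> boxes"
  proof (rule boxI)
    show "adm i (\<Inter>D\<in>\<D>. N D i)" if "i \<in> I" for i
      using D N(2) that
      by (intro topological_abelian_group_loc.admissible_Inter[OF loc[OF that]]) auto
    have "countable (\<Union>D\<in>\<D>. {i \<in> I. N D i \<noteq> carrier (H i)})"
      using D(1) N(3) by (intro countable_UN) auto
    moreover have "{i \<in> I. (\<Inter>D\<in>\<D>. N D i) \<noteq> carrier (H i)} \<subseteq>
        (\<Union>D\<in>\<D>. {i \<in> I. N D i \<noteq> carrier (H i)})"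
      using D(2) by auto
    ultimately show "countable {i \<in> I. (\<Inter>D\<in>\<D>. N D i) \<noteq> carrier (H i)}"
      by (rule countable_subset[rotated])
  qed
  ultimately show ?thesis by simp
qed

text \<open>One coordinate is enough: where \<open>x i\<close> is not the identity, the complement
  of \<open>x i\<close> is an open set around the identity and contains an admissible
  subgroup.\<close>

lemma exists_box_avoiding:
  assumes x: "x \<in> carrier (product_group I H)" "x \<noteq> \<one>\<^bsub>product_group I H\<^esub>"
  shows "\<exists>N\<in>boxes. x \<notin> N"
proof -
  have "x = \<one>\<^bsub>product_group I H\<^esub>" if "\<forall>i\<in>I. x i = \<one>\<^bsub>H i\<^esub>"
    using x(1) that by (auto simp: PiE_iff extensional_def fun_eq_iff)
  then have "\<exists>i\<in>I. x i \<noteq> \<one>\<^bsub>H i\<^esub>" using x(2) by blast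
  then obtain i where i: "i \<in> I" "x i \<noteq> \<one>\<^bsub>H i\<^esub>" by blast
  have xi: "x i \<in> carrier (H i)" using x(1) i(1) by auto
  have one: "\<one>\<^bsub>H i\<^esub> \<in> carrier (H i)" using group[OF i(1)] by (simp add: group.is_monoid)
  interpret Hi: pseudo_feathered_group "H i" "T i" by (rule feathered[OF i(1)])
  have "closedin (T i) {x i}"
    using closedin_Hausdorff_sing_eq[OF Hi.Hausdorff] xi Hi.topspace by simp
  then have "openin (T i) (topspace (T i) - {x i})" by (simp add: openin_diff)
  then have "gdelta_in (T i) (topspace (T i) - {x i})" by (rule open_imp_gdelta_in)
  moreover have "\<one>\<^bsub>H i\<^esub> \<in> topspace (T i) - {x i}" using i one Hi.topspace by auto
  ultimately obtain N where N: "Hi.admissible N" "(\<one>\<^bsub>H i\<^esub> <#\<^bsub>H i\<^esub> N) \<subseteq> topspace (T i) - {x i}"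
    using Hi.exists_admissible_in_gdelta by blast
  have "x i \<notin> N"
  proof
    assume "x i \<in> N"
    then have "\<one>\<^bsub>H i\<^esub> \<otimes>\<^bsub>H i\<^esub> x i \<in> \<one>\<^bsub>H i\<^esub> <#\<^bsub>H i\<^esub> N" unfolding l_coset_def by blast
    then show False using N(2) xi by auto
  qed
  let ?N = "\<lambda>j. if j = i then N else carrier (H j)"
  have "PiE I ?N \<in> boxes"
  proof (rule boxI)
    show "adm j (?N j)" if "j \<in> I" for j
      using N(1) topological_abelian_group_loc.admissible_carrier[OF loc[OF that]] by simp
    have "{j \<in> I. ?N j \<noteq> carrier (H j)} \<subseteq> {i}" by auto
    then show "countable {j \<in> I. ?N j \<noteq> carrier (H j)}" by (rule countable_subset) simp
  qed
  moreover have "x \<notin> PiE I ?N" using i(1) \<open>x i \<notin> N\<close> by (auto simp: PiE_iff)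
  ultimately show ?thesis by (intro bexI[of _ "PiE I ?N"])
qed

section \<open>The product as a complete P-group\<close>

sublocale linear_P_group "product_group I H" "P_modification (product_topology T I)" boxes
proof (intro linear_P_group.intro linear_P_group_axioms.intro comm_product)
  show "topspace (P_modification (product_topology T I)) = carrier (product_group I H)"
    by (simp only: topspace_P_modification topspace_product)
qed (fact openin_P_modification_product subgroup_box carrier_in_boxes Inter_in_boxes exists_box_avoiding)+

text \<open>Both axioms reduce to coordinates because cosets and intersections of boxes are
  products. The intersection property then glues points found in the factors. For absorption,
  countability of the restricted coordinates of \<open>N\<close> allows the sequences found in the
  factors to be bounded by one member of \<open>\<D>\<close>.\<close>

sublocale complete_P_group "product_group I H" "P_modification (product_topology T I)" boxes
proof unfold_locales
  let ?G = "product_group I H"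
  show "carrier ?G \<inter> \<Inter>\<C> \<noteq> {}"
    if coset: "\<And>c. c \<in> \<C> \<Longrightarrow> \<exists>x\<in>carrier ?G. \<exists>N\<in>boxes. c = x <#\<^bsub>?G\<^esub> N"
      and fip: "\<And>\<F>. finite \<F> \<Longrightarrow> \<F> \<subseteq> \<C> \<Longrightarrow> \<Inter>\<F> \<noteq> {}" for \<C>
  proof -
    have "\<forall>c\<in>\<C>. \<exists>p. fst p \<in> carrier ?G \<and> (\<forall>i\<in>I. adm i (snd p i)) \<and>
        c = (\<Pi>\<^sub>E i\<in>I. fst p i <#\<^bsub>H i\<^esub> snd p i)"
    proof
      fix c assume "c \<in> \<C>"
      then obtain x N where x: "x \<in> carrier ?G" and N: "\<forall>i\<in>I. adm i (N i)"
        and c: "c = x <#\<^bsub>?G\<^esub> PiE I N" using coset unfolding boxes_def by blast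
      have "c = (\<Pi>\<^sub>E i\<in>I. x i <#\<^bsub>H i\<^esub> N i)" unfolding c by (rule coset_box[OF x]) (use N in blast)
      then show "\<exists>p. fst p \<in> carrier ?G \<and> (\<forall>i\<in>I. adm i (snd p i)) \<and>
          c = (\<Pi>\<^sub>E i\<in>I. fst p i <#\<^bsub>H i\<^esub> snd p i)" using x N by (intro exI[of _ "(x, N)"]) simp
    qed
    from bchoice[OF this] obtain p where p': "\<forall>c\<in>\<C>. fst (p c) \<in> carrier ?G \<and>
        (\<forall>i\<in>I. adm i (snd (p c) i)) \<and> c = (\<Pi>\<^sub>E i\<in>I. fst (p c) i <#\<^bsub>H i\<^esub> snd (p c) i)"
      by (rule exE)
    have p: "fst (p c) \<in> carrier ?G" "\<forall>i\<in>I. adm i (snd (p c) i)"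
      "c = (\<Pi>\<^sub>E i\<in>I. fst (p c) i <#\<^bsub>H i\<^esub> snd (p c) i)" if "c \<in> \<C>" for c
      by (rule bspec[OF p' that, THEN conjunct1], rule bspec[OF p' that, THEN conjunct2, THEN conjunct1],
          rule bspec[OF p' that, THEN conjunct2, THEN conjunct2])
    have "\<exists>z. z \<in> carrier (H i) \<and> (\<forall>c\<in>\<C>. z \<in> fst (p c) i <#\<^bsub>H i\<^esub> snd (p c) i)" if i: "i \<in> I" for i
    proof -
      let ?c = "\<lambda>c. fst (p c) i <#\<^bsub>H i\<^esub> snd (p c) i"
      have "carrier (H i) \<inter> \<Inter>(?c ` \<C>) \<noteq> {}"
      proof (rule topological_abelian_group_loc.cosets_fip[OF loc[OF i]])
        show "\<exists>x\<in>carrier (H i). \<exists>N. adm i N \<and> d = x <#\<^bsub>H i\<^esub> N" if d: "d \<in> ?c ` \<C>" for d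
        proof -
          obtain c where c: "c \<in> \<C>" "d = ?c c" using d by blast
          have "fst (p c) i \<in> carrier (H i)" using p(1)[OF c(1)] i by auto
          then show ?thesis using bspec[OF p(2)[OF c(1)] i] c(2) by blast
        qed
        fix \<F> assume "finite \<F>" "\<F> \<subseteq> ?c ` \<C>"
        then obtain \<F>' where F': "\<F>' \<subseteq> \<C>" "finite \<F>'" "\<F> = ?c ` \<F>'"
          by (meson finite_subset_image)
        obtain f where f: "f \<in> \<Inter>\<F>'" using fip[OF F'(2,1)] by blast
        have "f i \<in> ?c c" if c: "c \<in> \<F>'" for c
        proof -
          have "f \<in> c" using f c by blast
          then have "f \<in> (\<Pi>\<^sub>E i\<in>I. fst (p c) i <#\<^bsub>H i\<^esub> snd (p c) i)" using p(3) c F'(1) by blast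
          then show ?thesis using i by (rule PiE_mem)
        qed
        then show "\<Inter>\<F> \<noteq> {}" unfolding F'(3) by blast
      qed
      then show ?thesis by blast
    qed
    then have "\<forall>i\<in>I. \<exists>z. z \<in> carrier (H i) \<and> (\<forall>c\<in>\<C>. z \<in> fst (p c) i <#\<^bsub>H i\<^esub> snd (p c) i)" by blast
    from bchoice[OF this] obtain z where z: "\<And>i. i \<in> I \<Longrightarrow> z i \<in> carrier (H i)"
      "\<And>i c. i \<in> I \<Longrightarrow> c \<in> \<C> \<Longrightarrow> z i \<in> fst (p c) i <#\<^bsub>H i\<^esub> snd (p c) i" by blast
    have "restrict z I \<in> c" if "c \<in> \<C>" for c
    proof -
      have "restrict z I \<in> (\<Pi>\<^sub>E i\<in>I. fst (p c) i <#\<^bsub>H i\<^esub> snd (p c) i)" using z(2) that by auto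
      then show ?thesis using p(3)[OF that] by simp
    qed
    moreover have "restrict z I \<in> carrier ?G" using z(1) by auto
    ultimately show ?thesis by blast
  qed
  show "\<exists>M\<in>\<D>. M \<subseteq> N <#>\<^bsub>?G\<^esub> \<Inter>\<D>"
    if D: "\<D> \<subseteq> boxes"
      and dir: "\<And>\<E>. countable \<E> \<Longrightarrow> \<E> \<subseteq> \<D> \<Longrightarrow> \<exists>M\<in>\<D>. \<forall>L\<in>\<E>. M \<subseteq> L"
      and N: "N \<in> boxes" for \<D> N
  proof -
    obtain NN where NN: "N = PiE I NN" "\<forall>i\<in>I. adm i (NN i)" "countable {i \<in> I. NN i \<noteq> carrier (H i)}"
      using N unfolding boxes_def by blast
    let ?J = "{i \<in> I. NN i \<noteq> carrier (H i)}"
    have "\<forall>D\<in>\<D>. \<exists>P. D = PiE I P \<and> (\<forall>i\<in>I. adm i (P i))"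
      using D unfolding boxes_def by blast
    from bchoice[OF this] obtain P where P': "\<forall>D\<in>\<D>. D = PiE I (P D) \<and> (\<forall>i\<in>I. adm i (P D i))"
      by (rule exE)
    have P: "D = PiE I (P D)" if "D \<in> \<D>" for D by (rule bspec[OF P' that, THEN conjunct1])
    have P_adm: "adm i (P D i)" if "D \<in> \<D>" "i \<in> I" for D i
      by (rule bspec[OF P' that(1), THEN conjunct2, THEN bspec, OF that(2)])
    have P_mono: "P A i \<subseteq> P B i" if "A \<in> \<D>" "B \<in> \<D>" "A \<subseteq> B" "i \<in> I" for A B i
    proof -
      have "PiE I (P A) \<subseteq> PiE I (P B)"
        using that(3) unfolding P[OF that(1), symmetric] P[OF that(2), symmetric] .
      then show ?thesis using box_subset_iff[of "P A" "P B"] P_adm that(1,4) by blast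
    qed
    \<comment> \<open>The lower bound of the empty subfamily is itself a member of
      \<open>\<D>\<close>.\<close>
    have ne: "\<D> \<noteq> {}" using dir[of "{}"] by auto
    have "\<exists>M::nat \<Rightarrow> _. range M \<subseteq> \<D> \<and>
        (\<forall>y. (\<forall>n. y \<in> P (M n) i) \<longrightarrow> (\<exists>d. (\<forall>D\<in>\<D>. d \<in> P D i) \<and> y \<otimes>\<^bsub>H i\<^esub> inv\<^bsub>H i\<^esub> d \<in> NN i))"
      if i: "i \<in> I" for i
    proof -
      let ?Di = "(\<lambda>D. P D i) ` \<D>"
      have "\<exists>M::nat \<Rightarrow> _. range M \<subseteq> ?Di \<and> (\<forall>y\<in>\<Inter>(range M). \<exists>d\<in>\<Inter>?Di. y \<otimes>\<^bsub>H i\<^esub> inv\<^bsub>H i\<^esub> d \<in> NN i)"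
      proof (rule topological_abelian_group_loc.directed_absorbing[OF loc[OF i]])
        show "?Di \<noteq> {}" using ne by blast
        show "adm i A" if "A \<in> ?Di" for A using that P_adm i by blast
        show "\<exists>M\<in>?Di. M \<subseteq> A \<inter> B" if AB: "A \<in> ?Di" "B \<in> ?Di" for A B
        proof -
          obtain D E where DE: "D \<in> \<D>" "E \<in> \<D>" "A = P D i" "B = P E i" using AB by blast
          obtain M where "M \<in> \<D>" "M \<subseteq> D" "M \<subseteq> E" using dir[of "{D, E}"] DE(1,2) by auto
          then have "P M i \<subseteq> A \<inter> B" "P M i \<in> ?Di" using P_mono DE i by auto
          then show ?thesis by blast
        qed
        show "gdelta_in (T i) (NN i)"
          using NN(2) i topological_abelian_group_loc.admissible_def[OF loc[OF i]] by blast
        show "\<one>\<^bsub>H i\<^esub> \<in> NN i" using adm_one[OF i] NN(2) i by blast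
      qed
      then obtain M :: "nat \<Rightarrow> _" where M: "range M \<subseteq> ?Di"
        "\<forall>y\<in>\<Inter>(range M). \<exists>d\<in>\<Inter>?Di. y \<otimes>\<^bsub>H i\<^esub> inv\<^bsub>H i\<^esub> d \<in> NN i" by blast
      have "\<forall>n. \<exists>D. D \<in> \<D> \<and> M n = P D i" using M(1) by blast
      from choice[OF this] obtain M' where *: "\<forall>n. M' n \<in> \<D> \<and> M n = P (M' n) i" by (rule exE)
      have M': "M' n \<in> \<D>" "M n = P (M' n) i" for n
        by (rule spec[OF *, THEN conjunct1], rule spec[OF *, THEN conjunct2])
      have "\<exists>d. (\<forall>D\<in>\<D>. d \<in> P D i) \<and> y \<otimes>\<^bsub>H i\<^esub> inv\<^bsub>H i\<^esub> d \<in> NN i" if "\<forall>n. y \<in> P (M' n) i" for y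
      proof -
        have "y \<in> \<Inter>(range M)" using that M'(2) by auto
        from bspec[OF M(2) this] obtain d where "d \<in> \<Inter>?Di" "y \<otimes>\<^bsub>H i\<^esub> inv\<^bsub>H i\<^esub> d \<in> NN i" ..
        then show ?thesis by (intro exI[of _ d]) simp
      qed
      then show ?thesis using M'(1) by (intro exI[of _ M']) blast
    qed
    then have "\<forall>i\<in>I. \<exists>M::nat \<Rightarrow> _. range M \<subseteq> \<D> \<and>
        (\<forall>y. (\<forall>n. y \<in> P (M n) i) \<longrightarrow> (\<exists>d. (\<forall>D\<in>\<D>. d \<in> P D i) \<and> y \<otimes>\<^bsub>H i\<^esub> inv\<^bsub>H i\<^esub> d \<in> NN i))"
      by blast
    from bchoice[OF this] obtain M :: "'i \<Rightarrow> nat \<Rightarrow> _" where M': "\<forall>i\<in>I. range (M i) \<subseteq> \<D> \<and>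
        (\<forall>y. (\<forall>n. y \<in> P (M i n) i) \<longrightarrow> (\<exists>d. (\<forall>D\<in>\<D>. d \<in> P D i) \<and> y \<otimes>\<^bsub>H i\<^esub> inv\<^bsub>H i\<^esub> d \<in> NN i))"
      by (rule exE)
    have M: "M i n \<in> \<D>" "(\<forall>n. y \<in> P (M i n) i) \<Longrightarrow>
        \<exists>d. (\<forall>D\<in>\<D>. d \<in> P D i) \<and> y \<otimes>\<^bsub>H i\<^esub> inv\<^bsub>H i\<^esub> d \<in> NN i" if "i \<in> I" for i n y
      using bspec[OF M' that] by auto
    \<comment> \<open>A sequence for each of countably many coordinates is still a countable
      subfamily, so a single \<open>L\<close> lies below all of its members.\<close>
    have "countable (\<Union>i\<in>?J. range (M i))" using NN(3) by (intro countable_UN) auto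
    moreover have "(\<Union>i\<in>?J. range (M i)) \<subseteq> \<D>" using M(1) by blast
    ultimately have "\<exists>L\<in>\<D>. \<forall>K\<in>(\<Union>i\<in>?J. range (M i)). L \<subseteq> K" by (rule dir)
    then obtain L where "L \<in> \<D>" and L_sub: "\<forall>K\<in>(\<Union>i\<in>?J. range (M i)). L \<subseteq> K" by (rule bexE)
    moreover have "L \<subseteq> M i n" if "i \<in> ?J" for i n
      by (rule bspec[OF L_sub UN_I[OF that rangeI]])
    ultimately have L: "L \<in> \<D>" "i \<in> ?J \<Longrightarrow> L \<subseteq> M i n" for i n by blast+
    have "L \<subseteq> N <#>\<^bsub>?G\<^esub> \<Inter>\<D>"
    proof
      fix y assume "y \<in> L"
      then have y: "y \<in> PiE I (P L)" using P[OF L(1)] by simp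
      have yc: "y i \<in> carrier (H i)" if "i \<in> I" for i
        using y P_adm[OF L(1) that] adm_subset[OF that] that by (auto simp: PiE_iff)
      have "\<exists>d. (\<forall>D\<in>\<D>. d \<in> P D i) \<and> y i \<otimes>\<^bsub>H i\<^esub> inv\<^bsub>H i\<^esub> d \<in> NN i" if i: "i \<in> I" for i
      proof (cases "i \<in> ?J")
        case True
        have "y i \<in> P (M i n) i" for n
          using P_mono[OF L(1) M(1)[OF i] L(2)[OF True] i] y i by (auto simp: PiE_iff)
        then show ?thesis using M(2)[OF i] by blast
      next
        \<comment> \<open>Here \<open>N\<close> imposes no restriction, so the identity can serve as
          the coordinate of the point of \<open>\<Inter>\<D>\<close>.\<close>
        case False
        then have "NN i = carrier (H i)" using i by blast
        then have "y i \<otimes>\<^bsub>H i\<^esub> inv\<^bsub>H i\<^esub> \<one>\<^bsub>H i\<^esub> \<in> NN i"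
          using yc[OF i] group[OF i] by (simp add: group.is_monoid monoid.m_closed)
        moreover have "\<forall>D\<in>\<D>. \<one>\<^bsub>H i\<^esub> \<in> P D i" using adm_one[OF i] P_adm i by blast
        ultimately show ?thesis by blast
      qed
      then have "\<forall>i\<in>I. \<exists>d. (\<forall>D\<in>\<D>. d \<in> P D i) \<and> y i \<otimes>\<^bsub>H i\<^esub> inv\<^bsub>H i\<^esub> d \<in> NN i" by blast
      from bchoice[OF this] obtain d where d: "\<And>i D. i \<in> I \<Longrightarrow> D \<in> \<D> \<Longrightarrow> d i \<in> P D i"
        "\<And>i. i \<in> I \<Longrightarrow> y i \<otimes>\<^bsub>H i\<^esub> inv\<^bsub>H i\<^esub> d i \<in> NN i" by blast
      have dc: "d i \<in> carrier (H i)" if "i \<in> I" for i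
        using d(1)[OF that L(1)] P_adm[OF L(1) that] adm_subset[OF that] by blast
      have "restrict d I \<in> D" if "D \<in> \<D>" for D
      proof -
        have "restrict d I \<in> PiE I (P D)" using d(1) that by auto
        then show ?thesis using P[OF that] by simp
      qed
      then have dD: "restrict d I \<in> \<Inter>\<D>" by blast
      have h: "(\<lambda>i\<in>I. y i \<otimes>\<^bsub>H i\<^esub> inv\<^bsub>H i\<^esub> d i) \<in> N" unfolding NN(1) using d(2) by auto
      have "(y i \<otimes>\<^bsub>H i\<^esub> inv\<^bsub>H i\<^esub> d i) \<otimes>\<^bsub>H i\<^esub> d i = y i" if i: "i \<in> I" for i
      proof -
        interpret group "H i" by (rule group[OF i])
        show ?thesis using yc[OF i] dc[OF i] by (simp add: m_assoc)
      qed
      then have "y = (\<lambda>i\<in>I. y i \<otimes>\<^bsub>H i\<^esub> inv\<^bsub>H i\<^esub> d i) \<otimes>\<^bsub>?G\<^esub> restrict d I"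
        using y by (auto simp: PiE_iff extensional_def fun_eq_iff)
      with h dD show "y \<in> N <#>\<^bsub>?G\<^esub> \<Inter>\<D>" unfolding set_mult_def by blast
    qed
    with L(1) show ?thesis by blast
  qed
qed

end

theorem theorem6p13:
  fixes I :: "'i set"
    and H :: "'i \<Rightarrow> ('a, 'b) monoid_scheme"
    and T :: "'i \<Rightarrow> 'a topology"
  assumes "\<And>i. i \<in> I \<Longrightarrow> topological_abelian_group (H i) (T i)"
    and "\<And>i. i \<in> I \<Longrightarrow> pseudo_feathered (H i) (T i)"
  shows "reflexive_group (product_group I H) (P_modification (product_topology T I))"
proof -
  interpret pseudo_feathered_family I H T
    by (rule pseudo_feathered_family.intro) (intro pseudo_feathered_groupI assms)
  show ?thesis by (rule reflexive)
qed

end
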